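(* Let $s,t\geq 1$ be integers and $r,r'\in\mathbb{Z}_2$. (1) If $s+t$ is even, then $\Omega^{-s}V(r)\otimes\Omega^{-t}V(r')\cong\Omega^{-(s+t)}V(r+r')\oplus stP(r+r')$ as $D_4$-modules. (2) If $s+t$ is odd, then $\Omega^{-s}V(r)\otimes\Omega^{-t}V(r')\cong\Omega^{-(s+t)}V(r+r')\oplus stP(r+r'+1)$ as $D_4$-modules.
   Context: Let $k$ be an algebraically closed field with $\mathrm{char}(k)\neq 2$. All modules are finite-dimensional left modules; $\otimes=\otimes_k$; $\mathbb{Z}_2=\mathbb{Z}/2\mathbb{Z}$; $nM$ denotes the direct sum of $n$ copies of $M$. $D_4$ is the $k$-algebra generated by $a,b,c,d$ subject to $ba=-ab$, $db=-bd$, $ca=-ac$, $dc=-cd$, $bc=cb$, $a^2=0$, $b^2=1$, $c^2=1$, $d^2=0$, $da+ad=1-bc$. It is a $16$-dimensional Hopf algebra (isomorphic to the Drinfeld double of Sweedler's 4-dimensional Hopf algebra) with comultiplication $\Delta(a)=a\otimes b+1\otimes a$, $\Delta(b)=b\otimes b$, $\Delta(c)=c\otimes c$, $\Delta(d)=d\otimes c+1\otimes d$, counit $\varepsilon(a)=\varepsilon(d)=0$, $\varepsilon(b)=\varepsilon(c)=1$, antipode $S(a)=-ab$, $S(b)=b$, $S(c)=c$, $S(d)=-dc$. Tensor products of $D_4$-modules are $D_4$-modules via $\Delta$. For $r\in\mathbb{Z}_2$, $V(r)$ is the one-dimensional simple module on which $a,d$ act as $0$ and $b,c$ act as $(-1)^r$,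 and $P(r)$ is the projective cover of $V(r)$ (it is 4-dimensional and is also the injective envelope of $V(r)$). For a module $M$, $\Omega^{-1}M$ is the cokernel of an injective envelope $M\to I(M)$, and $\Omega^{-s}$ is the $s$-fold iterate of $\Omega^{-1}$. *)

theory Defs
  imports
    "HOL-Library.Z2"
    "HOL-Computational_Algebra.Polynomial"
    "Jordan_Normal_Form.Matrix_Kernel"
begin

text \<open>
  A left module over the algebra \<open>D\<^sub>4\<close>, which is presented by generators \<open>a, b, c, d\<close> and
  relations, is a vector space together with four endomorphisms satisfying these relations.
  Finite-dimensional modules are taken with underlying space \<open>k\<^sup>n\<close> (column vectors of length
  \<open>n\<close>), so that the generators act by \<open>n \<times> n\<close> matrices; \<open>n = 0\<close> is allowed.  Since
  \<open>a, b, c, d\<close> generate the algebra, linear maps are \<open>D\<^sub>4\<close>-linear, and subspaces are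
  submodules, as soon as they are compatible with the action of the four generators.
\<close>

datatype gen = ga | gb | gc | gd

datatype 'k rep = Rep (vdim: nat) (act: "gen \<Rightarrow> 'k mat")

abbreviation space :: "'k rep \<Rightarrow> 'k vec set" where
  "space M \<equiv> carrier_vec (vdim M)"

definition D4_module :: "'k::field rep \<Rightarrow> bool" where
  "D4_module M \<longleftrightarrow>
     (\<forall>g. act M g \<in> carrier_mat (vdim M) (vdim M)) \<and>
     (let n = vdim M; A = act M ga; B = act M gb; C = act M gc; D = act M gd in
        B * A = - (A * B) \<and> D * B = - (B * D) \<and>
        C * A = - (A * C) \<and> D * C = - (C * D) \<and>
        B * C = C * B \<and>
        A * A = 0\<^sub>m n n \<and> B * B = 1\<^sub>m n \<and> C * C = 1\<^sub>m n \<and> D * D = 0\<^sub>m n n \<and>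
        D * A + A * D = 1\<^sub>m n - B * C)"

definition module_hom :: "'k::field rep \<Rightarrow> 'k rep \<Rightarrow> 'k mat \<Rightarrow> bool" where
  "module_hom M N f \<longleftrightarrow>
     f \<in> carrier_mat (vdim N) (vdim M) \<and> (\<forall>g. f * act M g = act N g * f)"

definition module_mono :: "'k::field rep \<Rightarrow> 'k rep \<Rightarrow> 'k mat \<Rightarrow> bool" where
  "module_mono M N f \<longleftrightarrow> module_hom M N f \<and> inj_on ((*\<^sub>v) f) (space M)"

definition module_epi :: "'k::field rep \<Rightarrow> 'k rep \<Rightarrow> 'k mat \<Rightarrow> bool" where
  "module_epi M N f \<longleftrightarrow> module_hom M N f \<and> (*\<^sub>v) f ` space M = space N"

definition module_iso :: "'k::field rep \<Rightarrow> 'k rep \<Rightarrow> bool" (infix "\<cong>\<^sub>D" 50) where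
  "M \<cong>\<^sub>D N \<longleftrightarrow>
     D4_module M \<and> D4_module N \<and>
     (\<exists>f. module_hom M N f \<and> bij_betw ((*\<^sub>v) f) (space M) (space N))"

definition is_submodule :: "'k::field rep \<Rightarrow> 'k vec set \<Rightarrow> bool" where
  "is_submodule M U \<longleftrightarrow>
     U \<subseteq> space M \<and> 0\<^sub>v (vdim M) \<in> U \<and>
     (\<forall>u\<in>U. \<forall>v\<in>U. u + v \<in> U) \<and> (\<forall>x. \<forall>u\<in>U. x \<cdot>\<^sub>v u \<in> U) \<and>
     (\<forall>g. \<forall>u\<in>U. act M g *\<^sub>v u \<in> U)"

definition injective_module :: "'k::field rep \<Rightarrow> bool" where
  "injective_module I \<longleftrightarrow> D4_module I \<and>
     (\<forall>M N f g. D4_module M \<and> D4_module N \<and> module_mono M N f \<and> module_hom M I g \<longrightarrow>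
        (\<exists>h. module_hom N I h \<and> h * f = g))"

definition projective_module :: "'k::field rep \<Rightarrow> bool" where
  "projective_module P \<longleftrightarrow> D4_module P \<and>
     (\<forall>M N f g. D4_module M \<and> D4_module N \<and> module_epi M N f \<and> module_hom P N g \<longrightarrow>
        (\<exists>h. module_hom P M h \<and> f * h = g))"

text \<open>An injective envelope is an essential monomorphism into an injective module.\<close>

definition injective_envelope :: "'k::field rep \<Rightarrow> 'k rep \<Rightarrow> 'k mat \<Rightarrow> bool" where
  "injective_envelope M I i \<longleftrightarrow>
     D4_module M \<and> injective_module I \<and> module_mono M I i \<and>
     (\<forall>U. is_submodule I U \<and> U \<noteq> {0\<^sub>v (vdim I)} \<longrightarrow>
        U \<inter> (*\<^sub>v) i ` space M \<noteq> {0\<^sub>v (vdim I)})"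

text \<open>A projective cover is an epimorphism with superfluous kernel from a projective module.\<close>

definition projective_cover :: "'k::field rep \<Rightarrow> 'k rep \<Rightarrow> 'k mat \<Rightarrow> bool" where
  "projective_cover M P p \<longleftrightarrow>
     D4_module M \<and> projective_module P \<and> module_epi P M p \<and>
     (\<forall>U. is_submodule P U \<and> {u + w | u w. u \<in> U \<and> w \<in> mat_kernel p} = space P \<longrightarrow>
        U = space P)"

text \<open>
  \<open>\<Omega>\<^sup>-\<^sup>1 M\<close> is determined only up to isomorphism.  It is therefore rendered as a relation:
  \<open>cosyzygy M C\<close> says that \<open>C\<close> is a cokernel of some injective envelope of \<open>M\<close>.  Accordingly,
  \<open>(cosyzygy ^^ s) M X\<close>, with the relational power, says that \<open>X\<close> is a choice of \<open>\<Omega>\<^sup>-\<^sup>s M\<close>.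
\<close>

definition cosyzygy :: "'k::field rep \<Rightarrow> 'k rep \<Rightarrow> bool" where
  "cosyzygy M C \<longleftrightarrow> D4_module C \<and>
     (\<exists>I i p. injective_envelope M I i \<and> module_epi I C p \<and>
        mat_kernel p = (*\<^sub>v) i ` space M)"

definition simple_module :: "bit \<Rightarrow> 'k::field rep" where
  "simple_module r = Rep 1 (\<lambda>g. case g of
       ga \<Rightarrow> 0\<^sub>m 1 1
     | gb \<Rightarrow> (if r = 0 then 1 else - 1) \<cdot>\<^sub>m 1\<^sub>m 1
     | gc \<Rightarrow> (if r = 0 then 1 else - 1) \<cdot>\<^sub>m 1\<^sub>m 1
     | gd \<Rightarrow> 0\<^sub>m 1 1)"

definition direct_sum :: "'k::field rep \<Rightarrow> 'k rep \<Rightarrow> 'k rep" (infixr "\<oplus>\<^sub>D" 65) where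
  "M \<oplus>\<^sub>D N = Rep (vdim M + vdim N) (\<lambda>g.
     four_block_mat (act M g) (0\<^sub>m (vdim M) (vdim N))
                    (0\<^sub>m (vdim N) (vdim M)) (act N g))"

primrec copies :: "nat \<Rightarrow> 'k::field rep \<Rightarrow> 'k rep" where
  "copies 0 M = Rep 0 (\<lambda>_. 0\<^sub>m 0 0)"
| "copies (Suc n) M = M \<oplus>\<^sub>D copies n M"

text \<open>
  Kronecker product: the matrix of \<open>A \<otimes> B\<close> with respect to the bases \<open>e\<^sub>i \<otimes> e\<^sub>j\<close>, where
  \<open>e\<^sub>i \<otimes> e\<^sub>j\<close> has index \<open>i * n + j\<close> and \<open>n\<close> is the dimension of the second factor.
\<close>

definition kronecker :: "'k::field mat \<Rightarrow> 'k mat \<Rightarrow> 'k mat" where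
  "kronecker A B = mat (dim_row A * dim_row B) (dim_col A * dim_col B)
     (\<lambda>(i, j). A $$ (i div dim_row B, j div dim_col B) * B $$ (i mod dim_row B, j mod dim_col B))"

text \<open>
  The action on a tensor product comes from the comultiplication
  \<open>\<Delta>(a) = a \<otimes> b + 1 \<otimes> a\<close>, \<open>\<Delta>(b) = b \<otimes> b\<close>, \<open>\<Delta>(c) = c \<otimes> c\<close>, \<open>\<Delta>(d) = d \<otimes> c + 1 \<otimes> d\<close>.
\<close>

definition tensor :: "'k::field rep \<Rightarrow> 'k rep \<Rightarrow> 'k rep" (infixr "\<otimes>\<^sub>D" 70) where
  "M \<otimes>\<^sub>D N = Rep (vdim M * vdim N) (\<lambda>g. case g of
       ga \<Rightarrow> kronecker (act M ga) (act N gb) + kronecker (1\<^sub>m (vdim M)) (act N ga)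
     | gb \<Rightarrow> kronecker (act M gb) (act N gb)
     | gc \<Rightarrow> kronecker (act M gc) (act N gc)
     | gd \<Rightarrow> kronecker (act M gd) (act N gc) + kronecker (1\<^sub>m (vdim M)) (act N gd))"

end

theory Submission
  imports Defs
begin

text \<open>
  The element \<open>bc\<close> acts as the identity on everything that occurs, so that the modules in question
  are graded modules over the exterior algebra on \<open>a, d\<close>, with grading given by \<open>b = c\<close>.
  Computing injective envelopes shows that \<open>\<Omega>\<^sup>-\<^sup>n V(r)\<close> is a Kronecker module (below: \<open>zigzag\<close>):
  it has a basis \<open>x\<^sub>0, \<dots>, x\<^sub>n\<^sub>-\<^sub>1, y\<^sub>0, \<dots>, y\<^sub>n\<close> with \<open>a x\<^sub>i = y\<^sub>i\<close> and \<open>d x\<^sub>i = y\<^sub>i\<^sub>+\<^sub>1\<close>, where the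
  \<open>y\<^sub>i\<close> span the socle.  In the tensor product of two such modules the \<open>s t\<close> elements \<open>x\<^sub>i \<otimes> x'\<^sub>j\<close>
  generate projective summands, a Kronecker module with \<open>n = s + t\<close> is visible among the remaining
  basis vectors, and together they generate everything, so that a dimension count finishes the proof.
\<close>

section \<open>Linear algebra\<close>

text \<open>\<open>cosyzygy\<close> and \<open>projective_cover\<close> leave the envelope, the
  cokernel and the cover arbitrary, so nothing may be computed in one chosen model: each object is
  known only through its defining property. Injectivity is therefore applied only to the socle
  inclusion of \<open>simple_module q\<close> into the explicit module \<open>P0 q\<close>, and
  essentiality only to two kinds of submodule: the image of 1 - bc, and the line through a vector of
  pure degree killed by a and d. Together they determine the cosyzygy up to the data recorded in
  \<open>zigzag\<close>. Characteristic other than 2 enters because the idempotents that split off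
  degrees have denominators 2 and 4, and because a vector equal to its own negative has to vanish.
  The parity in the theorem is a matter of degree: in the n-th cosyzygy of V(r) the y_i have degree
  r + n and the x_i have degree r + n + 1, so a tensor of x_i with x'_j has degree r + r' + s +
  t.\<close>

definition subsp :: "nat \<Rightarrow> 'k::field vec set \<Rightarrow> bool" where
  "subsp n U \<longleftrightarrow> U \<subseteq> carrier_vec n \<and> 0\<^sub>v n \<in> U \<and>
     (\<forall>u\<in>U. \<forall>v\<in>U. u + v \<in> U) \<and> (\<forall>x. \<forall>u\<in>U. x \<cdot>\<^sub>v u \<in> U)"

lemma subspI:
  assumes "\<And>u. u \<in> U \<Longrightarrow> u \<in> carrier_vec n" "0\<^sub>v n \<in> U"
    "\<And>u v. u \<in> U \<Longrightarrow> v \<in> U \<Longrightarrow> u + v \<in> U" "\<And>x u. u \<in> U \<Longrightarrow> x \<cdot>\<^sub>v u \<in> U"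
  shows "subsp n U"
  using assms unfolding subsp_def by auto

lemma subspD:
  assumes "subsp n U"
  shows "u \<in> U \<Longrightarrow> u \<in> carrier_vec n" "0\<^sub>v n \<in> U"
    "u \<in> U \<Longrightarrow> v \<in> U \<Longrightarrow> u + v \<in> U" "u \<in> U \<Longrightarrow> x \<cdot>\<^sub>v u \<in> U"
  using assms unfolding subsp_def by auto

lemma subsp_uminus:
  assumes "subsp n U" "u \<in> U"
  shows "- u \<in> U"
proof -
  have "- u = (-1) \<cdot>\<^sub>v u" by auto
  then show ?thesis using subspD(4)[OF assms, of "-1"] by metis
qed

lemma subsp_diff:
  assumes "subsp n U" "u \<in> U" "v \<in> U"
  shows "u - v \<in> U"
proof -
  have "u \<in> carrier_vec n" "v \<in> carrier_vec n" using assms subspD(1) by blast+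
  then have "u - v = u + (- v)" by auto
  then show ?thesis using subspD(3)[OF assms(1,2) subsp_uminus[OF assms(1,3)]] by simp
qed

lemma subsp_cancel:
  assumes "subsp n U" "u - v \<in> U" "v \<in> U" "u \<in> carrier_vec n"
  shows "u \<in> U"
proof -
  have "v \<in> carrier_vec n" using assms subspD(1) by blast
  then have "u = (u - v) + v" using assms(4) by auto
  then show ?thesis using subspD(3)[OF assms(1,2,3)] by metis
qed

lemma add_diff_cancel_vec:
  "u \<in> carrier_vec n \<Longrightarrow> v \<in> carrier_vec n \<Longrightarrow> (u + v) - v = (u :: 'k::field vec)"
  by (intro eq_vecI) auto

lemma diff_zero_vecD:
  assumes "v - w = 0\<^sub>v n" "v \<in> carrier_vec n" "w \<in> carrier_vec n"
  shows "v = (w :: 'k::field vec)"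
proof (rule eq_vecI)
  fix k assume "k < dim_vec w"
  moreover have "(v - w) $ k = 0\<^sub>v n $ k" using assms(1) by simp
  ultimately show "v $ k = w $ k" using assms(2,3) by simp
qed (use assms in simp)

lemma smult_zero_vec: "c \<cdot>\<^sub>v 0\<^sub>v n = (0\<^sub>v n :: 'k::field vec)"
  by (intro eq_vecI) auto

lemma zero_mult_mat_vec: "v \<in> carrier_vec n \<Longrightarrow> 0\<^sub>m m n *\<^sub>v v = (0\<^sub>v m :: 'k::field vec)"
  by (intro eq_vecI) auto

lemma mult_mat_vec_uminus:
  "F \<in> carrier_mat d n \<Longrightarrow> v \<in> carrier_vec n \<Longrightarrow> F *\<^sub>v (- v) = - (F *\<^sub>v (v :: 'k::field vec))"
  by (intro eq_vecI) auto

lemma mult_mat_vec_zero: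
  "F \<in> carrier_mat d n \<Longrightarrow> F *\<^sub>v 0\<^sub>v n = (0\<^sub>v d :: 'k::field vec)"
  by (intro eq_vecI) auto

lemma subsp_image:
  assumes "F \<in> carrier_mat d n"
  shows "subsp d ((*\<^sub>v) F ` (carrier_vec n :: 'k::field vec set))"
proof (rule subspI)
  fix u assume "u \<in> (*\<^sub>v) F ` carrier_vec n"
  then show "u \<in> carrier_vec d" using assms by auto
next
  show "0\<^sub>v d \<in> (*\<^sub>v) F ` carrier_vec n"
    by (rule image_eqI[of _ _ "0\<^sub>v n"]) (simp_all add: mult_mat_vec_zero[OF assms])
next
  fix u v assume "u \<in> (*\<^sub>v) F ` carrier_vec n" "v \<in> (*\<^sub>v) F ` carrier_vec n"
  then obtain u' v' where "u' \<in> carrier_vec n" "v' \<in> carrier_vec n" "u = F *\<^sub>v u'" "v = F *\<^sub>v v'"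
    by auto
  then show "u + v \<in> (*\<^sub>v) F ` carrier_vec n"
    by (intro image_eqI[of _ _ "u' + v'"]) (simp_all add: mult_add_distrib_mat_vec[OF assms])
next
  fix x u assume "u \<in> (*\<^sub>v) F ` carrier_vec n"
  then obtain u' where "u' \<in> carrier_vec n" "u = F *\<^sub>v u'" by auto
  then show "x \<cdot>\<^sub>v u \<in> (*\<^sub>v) F ` carrier_vec n"
    by (intro image_eqI[of _ _ "x \<cdot>\<^sub>v u'"]) (simp_all add: mult_mat_vec[OF assms])
qed

lemma subsp_vimage:
  assumes "F \<in> carrier_mat d n" "subsp d U"
  shows "subsp n {v \<in> carrier_vec n. F *\<^sub>v v \<in> (U :: 'k::field vec set)}"
  using assms
  by (intro subspI) (auto simp: mult_mat_vec_zero[OF assms(1)] subspD[OF assms(2)]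
      mult_add_distrib_mat_vec[OF assms(1)] mult_mat_vec[OF assms(1)])

text \<open>Written out in coordinates instead of as a sum of vectors, so that the value has
  dimension \<open>d\<close> whatever the \<open>x i\<close> are, and linearity reduces to sums of
  scalars. As the index runs over the naturals below \<open>m\<close>, combinations can be split,
  shifted and padded by zero coefficients.\<close>

definition lc :: "nat \<Rightarrow> nat \<Rightarrow> (nat \<Rightarrow> 'k) \<Rightarrow> (nat \<Rightarrow> 'k::field vec) \<Rightarrow> 'k vec" where
  "lc d m \<alpha> x = vec d (\<lambda>k. \<Sum>i<m. \<alpha> i * x i $ k)"

lemma lc_carrier [simp]: "lc d m \<alpha> x \<in> carrier_vec d"
  by (simp add: lc_def)

lemma lc_0 [simp]: "lc d 0 \<alpha> x = 0\<^sub>v d"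
  by (auto simp: lc_def)

lemma lc_Suc:
  "x m \<in> carrier_vec d \<Longrightarrow> lc d (Suc m) \<alpha> x = lc d m \<alpha> x + \<alpha> m \<cdot>\<^sub>v x m"
  by (intro eq_vecI) (auto simp: lc_def)

lemma lc_zero_coeff: "(\<And>i. i < m \<Longrightarrow> \<alpha> i = 0) \<Longrightarrow> lc d m \<alpha> x = 0\<^sub>v d"
  by (intro eq_vecI) (auto simp: lc_def)

lemma lc_cong: "(\<And>i. i < m \<Longrightarrow> x i = y i) \<Longrightarrow> lc d m \<alpha> x = lc d m \<alpha> y"
  by (simp add: lc_def)

lemma lc_in_subsp:
  assumes "subsp d U" "\<And>i. i < m \<Longrightarrow> x i \<in> U"
  shows "lc d m \<alpha> x \<in> U"
  using assms(2)
proof (induction m)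
  case 0
  then show ?case using subspD(2)[OF assms(1)] by simp
next
  case (Suc m)
  then have "x m \<in> U" "x m \<in> carrier_vec d" using subspD(1)[OF assms(1)] by auto
  then show ?case using Suc subspD(3,4)[OF assms(1)] by (simp add: lc_Suc)
qed

lemma mult_mat_vec_lc:
  assumes "F \<in> carrier_mat e d" "\<And>i. i < m \<Longrightarrow> x i \<in> carrier_vec d"
  shows "F *\<^sub>v lc d m \<alpha> x = lc e m \<alpha> (\<lambda>i. F *\<^sub>v x i)"
  using assms(2)
proof (induction m)
  case 0
  then show ?case by (simp add: mult_mat_vec_zero[OF assms(1)])
next
  case (Suc m)
  then have "x m \<in> carrier_vec d" "F *\<^sub>v x m \<in> carrier_vec e" using assms(1) by auto
  then show ?case using Suc
    by (simp add: lc_Suc mult_add_distrib_mat_vec[OF assms(1)] mult_mat_vec[OF assms(1)])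
qed

lemma lc_add: "lc d m \<alpha> x + lc d m \<beta> x = lc d m (\<lambda>i. \<alpha> i + \<beta> i) x"
  by (intro eq_vecI) (auto simp: lc_def sum.distrib algebra_simps)

lemma lc_diff: "lc d m \<alpha> x - lc d m \<beta> x = lc d m (\<lambda>i. \<alpha> i - \<beta> i) x"
  by (intro eq_vecI) (auto simp: lc_def sum_subtractf algebra_simps)

lemma lc_extend:
  assumes "m \<le> m'"
  shows "lc d m \<alpha> x = lc d m' (\<lambda>i. if i < m then \<alpha> i else 0) x"
proof (rule eq_vecI)
  fix k assume "k < dim_vec (lc d m' (\<lambda>i. if i < m then \<alpha> i else 0) x)"
  moreover have "(\<Sum>i<m. \<alpha> i * x i $ k) = (\<Sum>i<m'. (if i < m then \<alpha> i else 0) * x i $ k)"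
    using assms by (intro sum.mono_neutral_cong_left) auto
  ultimately show "lc d m \<alpha> x $ k = lc d m' (\<lambda>i. if i < m then \<alpha> i else 0) x $ k"
    by (simp add: lc_def)
qed (simp add: lc_def)

lemma lc_split: "lc d (n + m) \<alpha> x = lc d n \<alpha> x + lc d m (\<lambda>i. \<alpha> (n + i)) (\<lambda>i. x (n + i))"
proof -
  have "(\<Sum>i<n + m. f i) = (\<Sum>i<n. f i) + (\<Sum>i<m. f (n + i))" for f :: "nat \<Rightarrow> 'a"
    by (induction m) (auto simp: algebra_simps)
  then show ?thesis by (intro eq_vecI) (auto simp: lc_def)
qed

lemma lc_Suc_shift:
  assumes "x 0 \<in> carrier_vec d"
  shows "lc d (Suc m) \<alpha> x = \<alpha> 0 \<cdot>\<^sub>v x 0 + lc d m (\<lambda>i. \<alpha> (Suc i)) (\<lambda>i. x (Suc i))"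
  using assms by (intro eq_vecI) (auto simp: lc_def sum.lessThan_Suc_shift simp del: sum.lessThan_Suc)

lemma lc_unit:
  assumes "j < m" "x j \<in> carrier_vec d"
  shows "lc d m (\<lambda>i. if i = j then 1 else 0) x = x j"
proof (rule eq_vecI)
  fix k assume "k < dim_vec (x j)"
  then have k: "k < d" using assms(2) by simp
  have "(\<Sum>i<m. (if i = j then 1 else 0) * x i $ k) = (\<Sum>i<m. if i = j then x i $ k else 0)"
    by (intro sum.cong) auto
  then show "lc d m (\<lambda>i. if i = j then 1 else 0) x $ k = x j $ k"
    using k assms(1) by (simp add: lc_def)
qed (use assms in \<open>simp add: lc_def\<close>)

section \<open>Matrices given by their columns\<close>

definition cols_mat :: "nat \<Rightarrow> nat \<Rightarrow> (nat \<Rightarrow> 'k::field vec) \<Rightarrow> 'k mat" where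
  "cols_mat d m x = mat d m (\<lambda>(k, i). x i $ k)"

lemma cols_mat_carrier [simp]: "cols_mat d m x \<in> carrier_mat d m"
  by (simp add: cols_mat_def)

lemma cols_mat_mult: "v \<in> carrier_vec m \<Longrightarrow> cols_mat d m x *\<^sub>v v = lc d m (($) v) x"
  by (intro eq_vecI)
    (auto simp: cols_mat_def lc_def scalar_prod_def mult.commute atLeast0LessThan intro!: sum.cong)

lemma cols_mat_unit: "j < m \<Longrightarrow> x j \<in> carrier_vec d \<Longrightarrow> cols_mat d m x *\<^sub>v unit_vec m j = x j"
  by (intro eq_vecI) (auto simp: cols_mat_def)

lemma vec_eq_lc_unit:
  assumes "v \<in> carrier_vec n"
  shows "v = lc n n (($) v) (unit_vec n)"
proof (rule eq_vecI)
  fix k assume "k < dim_vec (lc n n (($) v) (unit_vec n))"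
  then have k: "k < n" by (simp add: lc_def)
  then have "(\<Sum>i<n. v $ i * unit_vec n i $ k) = (\<Sum>i<n. if i = k then v $ i else 0)"
    by (intro sum.cong) auto
  then show "v $ k = lc n n (($) v) (unit_vec n) $ k" using k by (simp add: lc_def)
qed (use assms in \<open>simp add: lc_def\<close>)

lemma unit_vecs_generate:
  assumes "subsp n U" "\<And>i. i < n \<Longrightarrow> unit_vec n i \<in> U" "v \<in> carrier_vec n"
  shows "v \<in> (U :: 'k::field vec set)"
  by (subst vec_eq_lc_unit[OF assms(3)]) (rule lc_in_subsp[OF assms(1,2)])

lemma mat_eqI_vec:
  assumes "F \<in> carrier_mat d n" "G \<in> carrier_mat d n"
    "\<And>v. v \<in> carrier_vec n \<Longrightarrow> F *\<^sub>v v = G *\<^sub>v (v :: 'k::field vec)"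
  shows "F = G"
proof (rule eq_matI)
  fix i j assume ij: "i < dim_row G" "j < dim_col G"
  then have j: "j < n" and i: "i < d" using assms by auto
  have "(F *\<^sub>v unit_vec n j) $ i = (G *\<^sub>v unit_vec n j) $ i" using assms(3) by simp
  moreover have "(F *\<^sub>v unit_vec n j) $ i = F $$ (i, j)" "(G *\<^sub>v unit_vec n j) $ i = G $$ (i, j)"
    using i j assms(1,2) by auto
  ultimately show "F $$ (i, j) = G $$ (i, j)" by simp
qed (use assms in auto)

section \<open>Right inverses, bijectivity and comparison of dimensions\<close>

lemma surj_right_inverse:
  assumes G: "G \<in> carrier_mat d m" and surj: "(*\<^sub>v) G ` carrier_vec m = (carrier_vec d :: 'k::field vec set)"
  obtains R where "R \<in> carrier_mat m d" "G * R = 1\<^sub>m d"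
proof -
  have "\<forall>i. \<exists>r. r \<in> carrier_vec m \<and> G *\<^sub>v r = (unit_vec d i :: 'k vec)"
    using surj by (metis (no_types, lifting) imageE unit_vec_carrier)
  then obtain r where r: "\<And>i. r i \<in> carrier_vec m" "\<And>i. G *\<^sub>v r i = (unit_vec d i :: 'k vec)"
    by metis
  let ?R = "cols_mat m d r"
  have "G * ?R = 1\<^sub>m d"
  proof (rule mat_eqI_vec)
    fix v :: "'k vec" assume v: "v \<in> carrier_vec d"
    have "(G * ?R) *\<^sub>v v = G *\<^sub>v lc m d (($) v) r"
      using v by (simp add: assoc_mult_mat_vec[OF G cols_mat_carrier] cols_mat_mult)
    also have "\<dots> = lc d d (($) v) (unit_vec d)"
      by (simp add: mult_mat_vec_lc[OF G r(1)] r(2))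
    also have "\<dots> = 1\<^sub>m d *\<^sub>v v" using v by (simp flip: vec_eq_lc_unit)
    finally show "(G * ?R) *\<^sub>v v = 1\<^sub>m d *\<^sub>v v" .
  qed (use G in \<open>auto intro: mult_carrier_mat\<close>)
  then show ?thesis using that cols_mat_carrier by blast
qed

text \<open>Were m < d, padding \<open>G\<close> with zero columns and a right inverse
  \<open>R\<close> with zero rows would give square matrices whose product is still 1. A one-sided
  inverse of a square matrix is two-sided, but in the opposite product row m is zero.\<close>

lemma surj_dim_le:
  assumes G: "G \<in> carrier_mat d m" and surj: "(*\<^sub>v) G ` carrier_vec m = (carrier_vec d :: 'k::field vec set)"
  shows "d \<le> m"
proof (rule ccontr)
  assume "\<not> d \<le> m"
  then have md: "m < d" by simp
  obtain R where R: "R \<in> carrier_mat m d" "G * R = 1\<^sub>m d" using surj_right_inverse[OF assms] .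
  define G' where "G' = mat d d (\<lambda>(i, j). if j < m then G $$ (i, j) else 0)"
  define R' where "R' = mat d d (\<lambda>(i, j). if i < m then R $$ (i, j) else 0)"
  have "G' * R' = G * R"
  proof (rule eq_matI)
    fix i j assume "i < dim_row (G * R)" "j < dim_col (G * R)"
    then have ij: "i < d" "j < d" using G R by auto
    have "(G' * R') $$ (i, j) = (\<Sum>k<d. if k < m then G $$ (i, k) * R $$ (k, j) else 0)"
      using ij by (auto simp: G'_def R'_def scalar_prod_def atLeast0LessThan intro!: sum.cong)
    also have "\<dots> = (\<Sum>k<m. G $$ (i, k) * R $$ (k, j))"
      using md by (intro sum.mono_neutral_cong_right) auto
    also have "\<dots> = (G * R) $$ (i, j)"
      using ij G R(1) by (auto simp: scalar_prod_def atLeast0LessThan)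
    finally show "(G' * R') $$ (i, j) = (G * R) $$ (i, j)" .
  qed (use G R in \<open>auto simp: G'_def R'_def\<close>)
  then have "R' * G' = 1\<^sub>m d"
    using R mat_mult_left_right_inverse[of G' d R'] by (simp add: G'_def R'_def)
  then have "(R' * G') $$ (m, m) = 1" using md by simp
  moreover have "(R' * G') $$ (m, m) = 0"
    using md by (auto simp: R'_def G'_def scalar_prod_def)
  ultimately show False by simp
qed

text \<open>Injectivity makes the right inverse a left inverse as well; then both matrices are onto,
  and comparing dimensions both ways gives m = d.\<close>

lemma bij_inverse:
  assumes G: "G \<in> carrier_mat d m"
    and bij: "bij_betw ((*\<^sub>v) G) (carrier_vec m) (carrier_vec d :: 'k::field vec set)"
  obtains R where "R \<in> carrier_mat m d" "G * R = 1\<^sub>m d" "R * G = 1\<^sub>m m" "m = d"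
proof -
  have surj: "(*\<^sub>v) G ` carrier_vec m = carrier_vec d" and inj: "inj_on ((*\<^sub>v) G) (carrier_vec m)"
    using bij by (auto simp: bij_betw_def)
  obtain R where R: "R \<in> carrier_mat m d" "G * R = 1\<^sub>m d" using surj_right_inverse[OF G surj] .
  have "R * G = 1\<^sub>m m"
  proof (rule mat_eqI_vec)
    fix v :: "'k vec" assume v: "v \<in> carrier_vec m"
    have "G *\<^sub>v (R * G *\<^sub>v v) = (G * R) *\<^sub>v (G *\<^sub>v v)"
      using G R(1) v by (simp add: assoc_mult_mat_vec[of _ m d] assoc_mult_mat_vec[OF G R(1)])
    also have "\<dots> = G *\<^sub>v v" using R(2) G v by simp
    finally show "R * G *\<^sub>v v = 1\<^sub>m m *\<^sub>v v"
      using inj v R(1) G unfolding inj_on_def by (simp add: assoc_mult_mat_vec[OF R(1) G])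
  qed (use R(1) G in auto)
  moreover have "(*\<^sub>v) R ` carrier_vec d = (carrier_vec m :: 'k vec set)"
  proof (intro equalityI subsetI)
    fix v :: "'k vec" assume v: "v \<in> carrier_vec m"
    then have "R *\<^sub>v (G *\<^sub>v v) = v"
      using assoc_mult_mat_vec[OF R(1) G, symmetric] calculation by simp
    then show "v \<in> (*\<^sub>v) R ` carrier_vec d"
      using v G by (intro image_eqI[of _ _ "G *\<^sub>v v"]) auto
  qed (use R in auto)
  ultimately show ?thesis
    using that R surj_dim_le[OF G surj] surj_dim_le[OF R(1)] by force
qed

lemma bij_of_inverse:
  assumes "R \<in> carrier_mat m d" "G \<in> carrier_mat d m" "G * R = 1\<^sub>m d" "R * G = 1\<^sub>m m"
  shows "bij_betw ((*\<^sub>v) R) (carrier_vec d) (carrier_vec m :: 'k::field vec set)"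
proof (rule bij_betw_byWitness[where f' = "(*\<^sub>v) G"])
  show "\<forall>a\<in>carrier_vec d. G *\<^sub>v (R *\<^sub>v a) = a"
    using assms(3) assoc_mult_mat_vec[OF assms(2,1), symmetric] by simp
  show "\<forall>a\<in>carrier_vec m. R *\<^sub>v (G *\<^sub>v a) = a"
    using assms(4) assoc_mult_mat_vec[OF assms(1,2), symmetric] by simp
qed (use assms in auto)

lemma surj_square_bij:
  assumes G: "G \<in> carrier_mat d d"
    and surj: "(*\<^sub>v) G ` carrier_vec d = (carrier_vec d :: 'k::field vec set)"
  shows "bij_betw ((*\<^sub>v) G) (carrier_vec d) (carrier_vec d)"
proof -
  obtain R where R: "R \<in> carrier_mat d d" "G * R = 1\<^sub>m d" using surj_right_inverse[OF G surj] .
  then have "R * G = 1\<^sub>m d" using mat_mult_left_right_inverse[OF G R(1)] by simp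
  then show ?thesis using bij_of_inverse[OF G R(1)] R(2) by blast
qed

lemma subsp_equalizer:
  assumes "F \<in> carrier_mat d n" "G \<in> carrier_mat d n"
  shows "subsp n {v \<in> carrier_vec n. F *\<^sub>v v = G *\<^sub>v (v :: 'k::field vec)}"
  using assms
  by (intro subspI) (auto simp: mult_mat_vec_zero[OF assms(1)] mult_mat_vec_zero[OF assms(2)]
      mult_add_distrib_mat_vec[OF assms(1)] mult_mat_vec[OF assms(1)]
      mult_add_distrib_mat_vec[OF assms(2)] mult_mat_vec[OF assms(2)])

text \<open>Spanning as a vector space, not as a module. It is phrased through subspaces because the
  sets to be proved full are given by closure properties, so that it suffices to test them on the
  elements of \<open>S\<close>.\<close>

definition generates :: "nat \<Rightarrow> 'k::field vec set \<Rightarrow> bool" where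
  "generates n S \<longleftrightarrow> S \<subseteq> carrier_vec n \<and> (\<forall>U. subsp n U \<and> S \<subseteq> U \<longrightarrow> carrier_vec n \<subseteq> U)"

lemma generatesD:
  assumes "generates n S" "subsp n U" "\<And>v. v \<in> S \<Longrightarrow> v \<in> U" "v \<in> carrier_vec n"
  shows "v \<in> U"
  using assms unfolding generates_def by blast

lemma generates_unit_vecs: "generates n (unit_vec n ` {..<n} :: 'k::field vec set)"
  unfolding generates_def by (auto intro: unit_vecs_generate)

lemma mat_eqI_generates:
  assumes "F \<in> carrier_mat d n" "G \<in> carrier_mat d n" "generates n S"
    "\<And>v. v \<in> S \<Longrightarrow> F *\<^sub>v v = G *\<^sub>v v"
  shows "F = G"
proof (rule mat_eqI_vec[OF assms(1,2)])
  fix v :: "'a vec" assume "v \<in> carrier_vec n"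
  then have "v \<in> {v \<in> carrier_vec n. F *\<^sub>v v = G *\<^sub>v v}"
    using generatesD[OF assms(3) subsp_equalizer[OF assms(1,2)]] assms(3,4)
    by (auto simp: generates_def)
  then show "F *\<^sub>v v = G *\<^sub>v v" by simp
qed

section \<open>Modules\<close>

definition sg :: "bit \<Rightarrow> 'k::field" where
  "sg q = (if q = 0 then 1 else - 1)"

lemma sg_simps [simp]: "sg 0 = 1" "sg 1 = - 1" "sg q * sg q = 1" "sg q * (sg q * x) = x"
  by (auto simp: sg_def)

lemma sg_nonzero [simp]: "sg q \<noteq> (0 :: 'k::field)"
  by (simp add: sg_def)

lemma sg_add: "sg (q + q') = sg q * sg q'"
  by (cases q; cases q') auto

lemma sg_add_1 [simp]: "sg (q + 1) = - sg q" "sg (1 + q) = - sg q"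
  by (simp_all add: sg_add)

lemma bit_add_1_1: "q + 1 + 1 = (q :: bit)"
  by (cases q) auto

lemma act_carrier: "D4_module M \<Longrightarrow> act M g \<in> carrier_mat (vdim M) (vdim M)"
  by (simp add: D4_module_def)

lemma act_closed [simp]: "D4_module M \<Longrightarrow> v \<in> space M \<Longrightarrow> act M g *\<^sub>v v \<in> space M"
  by (meson act_carrier mult_mat_vec_carrier)

lemma act_linear:
  assumes "D4_module M"
  shows "u \<in> space M \<Longrightarrow> v \<in> space M \<Longrightarrow> act M g *\<^sub>v (u + v) = act M g *\<^sub>v u + act M g *\<^sub>v v"
    and "u \<in> space M \<Longrightarrow> v \<in> space M \<Longrightarrow> act M g *\<^sub>v (u - v) = act M g *\<^sub>v u - act M g *\<^sub>v v"
    and "v \<in> space M \<Longrightarrow> act M g *\<^sub>v (x \<cdot>\<^sub>v v) = x \<cdot>\<^sub>v (act M g *\<^sub>v v)"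
    and "v \<in> space M \<Longrightarrow> act M g *\<^sub>v (- v) = - (act M g *\<^sub>v v)"
    and "act M g *\<^sub>v 0\<^sub>v (vdim M) = 0\<^sub>v (vdim M)"
  using act_carrier[OF assms, of g]
  by (auto simp: mult_add_distrib_mat_vec mult_minus_distrib_mat_vec mult_mat_vec
      mult_mat_vec_zero intro!: eq_vecI)

text \<open>The defining relations acting on vectors, oriented as rewrite rules: a moves to the left
  of d, and b, c move to the right of both, with b before c. Words thus tend to the monomial order
  a, d, b, c of the standard 16-element basis.\<close>

lemma D4_rels:
  assumes M: "D4_module M" and v: "v \<in> space M"
  shows "act M ga *\<^sub>v (act M ga *\<^sub>v v) = 0\<^sub>v (vdim M)"
    and "act M gd *\<^sub>v (act M gd *\<^sub>v v) = 0\<^sub>v (vdim M)"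
    and "act M gb *\<^sub>v (act M gb *\<^sub>v v) = v"
    and "act M gc *\<^sub>v (act M gc *\<^sub>v v) = v"
    and "act M gb *\<^sub>v (act M ga *\<^sub>v v) = - (act M ga *\<^sub>v (act M gb *\<^sub>v v))"
    and "act M gb *\<^sub>v (act M gd *\<^sub>v v) = - (act M gd *\<^sub>v (act M gb *\<^sub>v v))"
    and "act M gc *\<^sub>v (act M ga *\<^sub>v v) = - (act M ga *\<^sub>v (act M gc *\<^sub>v v))"
    and "act M gc *\<^sub>v (act M gd *\<^sub>v v) = - (act M gd *\<^sub>v (act M gc *\<^sub>v v))"
    and "act M gc *\<^sub>v (act M gb *\<^sub>v v) = act M gb *\<^sub>v (act M gc *\<^sub>v v)"
    and "act M gd *\<^sub>v (act M ga *\<^sub>v v) =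
           v - act M gb *\<^sub>v (act M gc *\<^sub>v v) - act M ga *\<^sub>v (act M gd *\<^sub>v v)"
proof -
  note c = act_carrier[OF M]
  have assoc: "act M g *\<^sub>v (act M h *\<^sub>v v) = (act M g * act M h) *\<^sub>v v" for g h
    using assoc_mult_mat_vec[OF c c v] by simp
  have neg: "(- (act M g * act M h)) *\<^sub>v v = - ((act M g * act M h) *\<^sub>v v)" for g h
    using v c[of g] c[of h] by (intro eq_vecI) auto
  have rel: "act M gb * act M ga = - (act M ga * act M gb)" "act M gd * act M gb = - (act M gb * act M gd)"
      "act M gc * act M ga = - (act M ga * act M gc)" "act M gd * act M gc = - (act M gc * act M gd)"
      "act M gb * act M gc = act M gc * act M gb"
      "act M ga * act M ga = 0\<^sub>m (vdim M) (vdim M)" "act M gb * act M gb = 1\<^sub>m (vdim M)"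
      "act M gc * act M gc = 1\<^sub>m (vdim M)" "act M gd * act M gd = 0\<^sub>m (vdim M) (vdim M)"
      "act M gd * act M ga + act M ga * act M gd = 1\<^sub>m (vdim M) - act M gb * act M gc"
    using M by (auto simp: D4_module_def Let_def)
  show "act M ga *\<^sub>v (act M ga *\<^sub>v v) = 0\<^sub>v (vdim M)" "act M gd *\<^sub>v (act M gd *\<^sub>v v) = 0\<^sub>v (vdim M)"
    "act M gb *\<^sub>v (act M gb *\<^sub>v v) = v" "act M gc *\<^sub>v (act M gc *\<^sub>v v) = v"
    "act M gc *\<^sub>v (act M gb *\<^sub>v v) = act M gb *\<^sub>v (act M gc *\<^sub>v v)"
    using v by (auto simp: assoc rel)
  show "act M gb *\<^sub>v (act M ga *\<^sub>v v) = - (act M ga *\<^sub>v (act M gb *\<^sub>v v))"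
    "act M gc *\<^sub>v (act M ga *\<^sub>v v) = - (act M ga *\<^sub>v (act M gc *\<^sub>v v))"
    unfolding assoc rel neg by simp_all
  \<comment> \<open>The definition has d on the left of b and c here, opposite to the chosen
    orientation; negating both sides turns these two relations round.\<close>
  have "- (act M gd *\<^sub>v (act M gb *\<^sub>v v)) = - (- (act M gb *\<^sub>v (act M gd *\<^sub>v v)))"
    "- (act M gd *\<^sub>v (act M gc *\<^sub>v v)) = - (- (act M gc *\<^sub>v (act M gd *\<^sub>v v)))"
    unfolding assoc rel neg by simp_all
  then show "act M gb *\<^sub>v (act M gd *\<^sub>v v) = - (act M gd *\<^sub>v (act M gb *\<^sub>v v))"
    "act M gc *\<^sub>v (act M gd *\<^sub>v v) = - (act M gd *\<^sub>v (act M gc *\<^sub>v v))"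
    by simp_all
  have "(act M gd * act M ga + act M ga * act M gd) *\<^sub>v v = (1\<^sub>m (vdim M) - act M gb * act M gc) *\<^sub>v v"
    by (simp add: rel)
  then have *: "act M gd *\<^sub>v (act M ga *\<^sub>v v) + act M ga *\<^sub>v (act M gd *\<^sub>v v)
      = v - act M gb *\<^sub>v (act M gc *\<^sub>v v)"
    using v by (simp add: assoc add_mult_distrib_mat_vec[OF mult_carrier_mat[OF c c] mult_carrier_mat[OF c c]]
        minus_mult_distrib_mat_vec[OF one_carrier_mat mult_carrier_mat[OF c c]])
  have cl: "act M gd *\<^sub>v (act M ga *\<^sub>v v) \<in> space M" "act M ga *\<^sub>v (act M gd *\<^sub>v v) \<in> space M"
    using M v by auto
  have "act M gd *\<^sub>v (act M ga *\<^sub>v v) =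
      (act M gd *\<^sub>v (act M ga *\<^sub>v v) + act M ga *\<^sub>v (act M gd *\<^sub>v v)) - act M ga *\<^sub>v (act M gd *\<^sub>v v)"
    by (rule add_diff_cancel_vec[OF cl, symmetric])
  then show "act M gd *\<^sub>v (act M ga *\<^sub>v v) =
           v - act M gb *\<^sub>v (act M gc *\<^sub>v v) - act M ga *\<^sub>v (act M gd *\<^sub>v v)"
    unfolding * .
qed

text \<open>Each relation is an equality of two linear maps, hence needs checking only on a spanning
  set. Unit vectors, concatenations and pure tensors serve as such sets below.\<close>

lemma D4_moduleI:
  assumes c: "\<And>g. act M g \<in> carrier_mat (vdim M) (vdim M)" and gen: "generates (vdim M) S"
    and rels: "\<And>v. v \<in> S \<Longrightarrow> act M ga *\<^sub>v (act M ga *\<^sub>v v) = 0\<^sub>v (vdim M)"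
      "\<And>v. v \<in> S \<Longrightarrow> act M gd *\<^sub>v (act M gd *\<^sub>v v) = 0\<^sub>v (vdim M)"
      "\<And>v. v \<in> S \<Longrightarrow> act M gb *\<^sub>v (act M gb *\<^sub>v v) = v"
      "\<And>v. v \<in> S \<Longrightarrow> act M gc *\<^sub>v (act M gc *\<^sub>v v) = v"
      "\<And>v. v \<in> S \<Longrightarrow> act M gb *\<^sub>v (act M ga *\<^sub>v v) = - (act M ga *\<^sub>v (act M gb *\<^sub>v v))"
      "\<And>v. v \<in> S \<Longrightarrow> act M gd *\<^sub>v (act M gb *\<^sub>v v) = - (act M gb *\<^sub>v (act M gd *\<^sub>v v))"
      "\<And>v. v \<in> S \<Longrightarrow> act M gc *\<^sub>v (act M ga *\<^sub>v v) = - (act M ga *\<^sub>v (act M gc *\<^sub>v v))"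
      "\<And>v. v \<in> S \<Longrightarrow> act M gd *\<^sub>v (act M gc *\<^sub>v v) = - (act M gc *\<^sub>v (act M gd *\<^sub>v v))"
      "\<And>v. v \<in> S \<Longrightarrow> act M gb *\<^sub>v (act M gc *\<^sub>v v) = act M gc *\<^sub>v (act M gb *\<^sub>v v)"
      "\<And>v. v \<in> S \<Longrightarrow> act M gd *\<^sub>v (act M ga *\<^sub>v v) + act M ga *\<^sub>v (act M gd *\<^sub>v v)
         = v - act M gb *\<^sub>v (act M gc *\<^sub>v v)"
  shows "D4_module (M :: 'k::field rep)"
proof -
  have S: "v \<in> space M" if "v \<in> S" for v using gen that by (auto simp: generates_def)
  have assoc: "(act M g * act M h) *\<^sub>v v = act M g *\<^sub>v (act M h *\<^sub>v v)" if "v \<in> S" for g h v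
    using assoc_mult_mat_vec[OF c c S[OF that]] .
  have neg: "(- (act M g * act M h)) *\<^sub>v v = - (act M g *\<^sub>v (act M h *\<^sub>v v))" if "v \<in> S" for g h v
    unfolding assoc[OF that, symmetric] using S[OF that] c[of g] c[of h] by (intro eq_vecI) auto
  note cc [simp] = mult_carrier_mat[OF c c]
  note eq = mat_eqI_generates[OF _ _ gen, of _ "vdim M"]
  show ?thesis
    unfolding D4_module_def Let_def
    by (intro conjI allI c eq)
      (auto simp: assoc neg rels S cc c add_mult_distrib_mat_vec[OF cc cc S]
        minus_mult_distrib_mat_vec[OF one_carrier_mat cc S] minus_carrier_mat[OF cc])
qed

section \<open>Homomorphisms and submodules\<close>

lemma module_homD:
  assumes "module_hom M N f" "D4_module M" "D4_module N"
  shows "f \<in> carrier_mat (vdim N) (vdim M)"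
    and "v \<in> space M \<Longrightarrow> f *\<^sub>v v \<in> space N"
    and "v \<in> space M \<Longrightarrow> f *\<^sub>v (act M g *\<^sub>v v) = act N g *\<^sub>v (f *\<^sub>v v)"
proof -
  show f: "f \<in> carrier_mat (vdim N) (vdim M)" using assms by (simp add: module_hom_def)
  show "v \<in> space M \<Longrightarrow> f *\<^sub>v v \<in> space N" using f by (meson mult_mat_vec_carrier)
  assume v: "v \<in> space M"
  have "f *\<^sub>v (act M g *\<^sub>v v) = (f * act M g) *\<^sub>v v"
    using assoc_mult_mat_vec[OF f act_carrier[OF assms(2)] v] by simp
  also have "\<dots> = (act N g * f) *\<^sub>v v" using assms by (simp add: module_hom_def)
  also have "\<dots> = act N g *\<^sub>v (f *\<^sub>v v)"
    using assoc_mult_mat_vec[OF act_carrier[OF assms(3)] f v] .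
  finally show "f *\<^sub>v (act M g *\<^sub>v v) = act N g *\<^sub>v (f *\<^sub>v v)" .
qed

lemma hom_linear:
  assumes "module_hom M N f"
  shows "u \<in> space M \<Longrightarrow> v \<in> space M \<Longrightarrow> f *\<^sub>v (u + v) = f *\<^sub>v u + f *\<^sub>v v"
    and "u \<in> space M \<Longrightarrow> v \<in> space M \<Longrightarrow> f *\<^sub>v (u - v) = f *\<^sub>v u - f *\<^sub>v v"
    and "v \<in> space M \<Longrightarrow> f *\<^sub>v (x \<cdot>\<^sub>v v) = x \<cdot>\<^sub>v (f *\<^sub>v v)"
    and "v \<in> space M \<Longrightarrow> f *\<^sub>v (- v) = - (f *\<^sub>v v)"
    and "f *\<^sub>v 0\<^sub>v (vdim M) = 0\<^sub>v (vdim N)"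
  using assms unfolding module_hom_def
  by (auto simp: mult_add_distrib_mat_vec mult_minus_distrib_mat_vec mult_mat_vec
      mult_mat_vec_zero intro!: eq_vecI)

lemma module_homI:
  assumes M: "D4_module M" "D4_module N" and f: "f \<in> carrier_mat (vdim N) (vdim M)"
    and gen: "generates (vdim M) S"
    and eq: "\<And>g v. v \<in> S \<Longrightarrow> f *\<^sub>v (act M g *\<^sub>v v) = act N g *\<^sub>v (f *\<^sub>v v)"
  shows "module_hom M N f"
  unfolding module_hom_def
proof (intro conjI allI f)
  fix g
  show "f * act M g = act N g * f"
  proof (rule mat_eqI_generates[OF mult_carrier_mat[OF f act_carrier[OF M(1)]]
        mult_carrier_mat[OF act_carrier[OF M(2)] f] gen])
    fix v assume "v \<in> S"
    moreover from this have "v \<in> space M" using gen by (auto simp: generates_def)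
    ultimately show "(f * act M g) *\<^sub>v v = (act N g * f) *\<^sub>v v"
      using assoc_mult_mat_vec[OF f act_carrier[OF M(1)]]
        assoc_mult_mat_vec[OF act_carrier[OF M(2)] f] eq by simp
  qed
qed

lemma module_hom_comp:
  assumes "D4_module L" "D4_module M" "D4_module N" "module_hom L M f" "module_hom M N f'"
  shows "module_hom L N (f' * f)"
proof (rule module_homI[OF assms(1,3) _ generates_unit_vecs])
  note f = module_homD[OF assms(4,1,2)] and f' = module_homD[OF assms(5,2,3)]
  show "f' * f \<in> carrier_mat (vdim N) (vdim L)" using f(1) f'(1) by simp
  fix g v assume "v \<in> (unit_vec (vdim L) :: nat \<Rightarrow> 'a vec) ` {..<vdim L}"
  then have v: "v \<in> space L" by auto
  then show "f' * f *\<^sub>v (act L g *\<^sub>v v) = act N g *\<^sub>v (f' * f *\<^sub>v v)"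
    using assms(1) by (simp add: assoc_mult_mat_vec[OF f'(1) f(1)] f f')
qed

lemma hom_image_submodule:
  assumes "D4_module M" "D4_module N" "module_hom M N f"
  shows "is_submodule N ((*\<^sub>v) f ` space M)"
proof -
  note f = module_homD[OF assms(3,1,2)]
  have "act N g *\<^sub>v u \<in> (*\<^sub>v) f ` space M" if "u \<in> (*\<^sub>v) f ` space M" for g u
  proof -
    from that obtain v where "v \<in> space M" "u = f *\<^sub>v v" by (rule imageE)
    then show ?thesis using f(3)[of v g] assms(1) by (intro image_eqI[of _ _ "act M g *\<^sub>v v"]) auto
  qed
  then show ?thesis
    using subsp_image[OF f(1)] unfolding is_submodule_def subsp_def by auto
qed

lemma is_submoduleD:
  assumes "is_submodule M U"
  shows "subsp (vdim M) U" "u \<in> U \<Longrightarrow> act M g *\<^sub>v u \<in> U"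
  using assms unfolding is_submodule_def subsp_def by auto

text \<open>A surjection between spaces of equal finite dimension is bijective, and its inverse is
  again a homomorphism. The isomorphism points backwards because the map built later goes from a
  direct sum onto a tensor product.\<close>

lemma module_iso_of_epi:
  assumes "D4_module M" "D4_module N" "module_epi M N f" "vdim M = vdim N"
  shows "N \<cong>\<^sub>D M"
proof -
  have hom: "module_hom M N f" and surj: "(*\<^sub>v) f ` space M = space N"
    using assms(3) by (auto simp: module_epi_def)
  note f = module_homD[OF hom assms(1,2)]
  have "bij_betw ((*\<^sub>v) f) (space M) (space N)"
    using surj_square_bij[of f "vdim N"] f(1) surj assms(4) by simp
  then obtain R where R: "R \<in> carrier_mat (vdim M) (vdim N)" "f * R = 1\<^sub>m (vdim N)" "R * f = 1\<^sub>m (vdim M)"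
    using bij_inverse[OF f(1)] by metis
  have "module_hom N M R"
  proof (rule module_homI[OF assms(2,1) R(1) generates_unit_vecs])
    fix g v assume "v \<in> (unit_vec (vdim N) :: nat \<Rightarrow> 'a vec) ` {..<vdim N}"
    then have v: "v \<in> space N" by auto
    then obtain u where u: "u \<in> space M" "v = f *\<^sub>v u" using surj by auto
    have Rf: "R *\<^sub>v (f *\<^sub>v w) = w" if "w \<in> space M" for w
      using assoc_mult_mat_vec[OF R(1) f(1) that] R(3) that by simp
    have "R *\<^sub>v (act N g *\<^sub>v v) = R *\<^sub>v (f *\<^sub>v (act M g *\<^sub>v u))" using f(3) u by simp
    then show "R *\<^sub>v (act N g *\<^sub>v v) = act M g *\<^sub>v (R *\<^sub>v v)"
      using u assms(1) by (simp add: Rf)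
  qed
  then show ?thesis
    using bij_of_inverse[OF R(1) f(1) R(2,3)] assms(1,2) unfolding module_iso_def by blast
qed

section \<open>Vectors of pure degree\<close>

definition homog :: "'k::field rep \<Rightarrow> bit \<Rightarrow> 'k vec \<Rightarrow> bool" where
  "homog M q w \<longleftrightarrow> w \<in> space M \<and> act M gb *\<^sub>v w = sg q \<cdot>\<^sub>v w \<and> act M gc *\<^sub>v w = sg q \<cdot>\<^sub>v w"

lemma homogD:
  assumes "homog M q w"
  shows "w \<in> space M" "act M gb *\<^sub>v w = sg q \<cdot>\<^sub>v w" "act M gc *\<^sub>v w = sg q \<cdot>\<^sub>v w"
  using assms by (auto simp: homog_def)

text \<open>Where b and c act by the same sign, bc acts as the identity, so da + ad = 1 - bc makes a
  and d anticommute; as both anticommute with b and c, they change the degree by one.\<close>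

lemma homog_act:
  assumes M: "D4_module M" and w: "homog M q w"
  shows "homog M (q + 1) (act M ga *\<^sub>v w)" "homog M (q + 1) (act M gd *\<^sub>v w)"
    and "act M gd *\<^sub>v (act M ga *\<^sub>v w) = - (act M ga *\<^sub>v (act M gd *\<^sub>v w))"
proof -
  note w' = homogD[OF w]
  show "homog M (q + 1) (act M ga *\<^sub>v w)" "homog M (q + 1) (act M gd *\<^sub>v w)"
    using M w' by (auto simp: homog_def D4_rels act_linear intro!: eq_vecI)
  have "v - v - u = - u" if "v \<in> space M" "u \<in> space M" for u v :: "'a vec"
    using that by (intro eq_vecI) auto
  moreover have "act M gb *\<^sub>v (act M gc *\<^sub>v w) = w"
    using M w' by (simp add: act_linear smult_smult_assoc)
  ultimately show "act M gd *\<^sub>v (act M ga *\<^sub>v w) = - (act M ga *\<^sub>v (act M gd *\<^sub>v w))"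
    using M w'(1) by (simp add: D4_rels(10))
qed

lemma subsp_homog:
  assumes "D4_module M"
  shows "subsp (vdim M) {w. homog M q w}"
  by (rule subspI)
    (auto simp: homog_def act_linear[OF assms] smult_add_distrib_vec smult_smult_assoc mult.commute)

lemma homog_subtract:
  "D4_module M \<Longrightarrow> homog M q u \<Longrightarrow> homog M q v \<Longrightarrow> homog M q (u - v)"
  using subsp_diff[OF subsp_homog, of M u q v] by simp

lemma homog_smult: "D4_module M \<Longrightarrow> homog M q u \<Longrightarrow> homog M q (c \<cdot>\<^sub>v u)"
  using subspD(4)[OF subsp_homog, of M u q c] by simp

lemma hom_homog:
  assumes "D4_module M" "D4_module N" "module_hom M N f" "homog M q w"
  shows "homog N q (f *\<^sub>v w)"
  using module_homD[OF assms(3,1,2)] homogD[OF assms(4)] hom_linear(3)[OF assms(3), of w]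
  unfolding homog_def by metis

text \<open>Here \<open>w\<close> is (1 + sg q b)(1 + sg q c) v, four times the projection of
  \<open>v\<close> to degree \<open>q\<close>: applying b or c permutes the four terms up to the
  sign \<open>sg q\<close>.\<close>

lemma homog_average:
  assumes M: "D4_module M" and v: "v \<in> space M"
    and w_def: "w = v + sg q \<cdot>\<^sub>v (act M gb *\<^sub>v v) + sg q \<cdot>\<^sub>v (act M gc *\<^sub>v v) + act M gb *\<^sub>v (act M gc *\<^sub>v v)"
  shows "homog M q w"
proof -
  have cl: "act M gb *\<^sub>v v \<in> space M" "act M gc *\<^sub>v v \<in> space M" "act M gb *\<^sub>v (act M gc *\<^sub>v v) \<in> space M"
    using M v by auto
  have b: "act M gb *\<^sub>v w = act M gb *\<^sub>v v + sg q \<cdot>\<^sub>v v + sg q \<cdot>\<^sub>v (act M gb *\<^sub>v (act M gc *\<^sub>v v)) + act M gc *\<^sub>v v"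
    unfolding w_def using M v cl by (simp add: act_linear D4_rels assoc_add_vec[of _ "vdim M"])
  have c: "act M gc *\<^sub>v w = act M gc *\<^sub>v v + sg q \<cdot>\<^sub>v (act M gb *\<^sub>v (act M gc *\<^sub>v v)) + sg q \<cdot>\<^sub>v v + act M gb *\<^sub>v v"
    unfolding w_def using M v cl by (simp add: act_linear D4_rels assoc_add_vec[of _ "vdim M"])
  show ?thesis
    unfolding homog_def b c
    unfolding w_def using M v cl
    by (auto intro!: eq_vecI simp: algebra_simps carrier_vecD[OF cl(1)] carrier_vecD[OF cl(2)]
        carrier_vecD[OF cl(3)] simp del: dim_mult_mat_vec index_mult_mat_vec)
qed

lemma four_nonzero: "(2::'k::field) \<noteq> 0 \<Longrightarrow> (4::'k) \<noteq> 0"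
  by (metis mult_eq_0_iff numeral_Bit0 mult_2 numeral_code(2) one_add_one)

text \<open>Project an arbitrary preimage to degree \<open>q\<close>. The projection commutes with
  \<open>f\<close> and fixes \<open>w\<close>, and its denominator 4 is invertible outside
  characteristic 2.\<close>

lemma hom_homog_lift:
  assumes M: "D4_module M" and N: "D4_module N" and epi: "module_epi M N f"
    and w: "homog N q w" and two: "(2::'k::field) \<noteq> 0"
  obtains v where "homog M q v" "f *\<^sub>v v = (w :: 'k vec)"
proof -
  have hom: "module_hom M N f" and surj: "(*\<^sub>v) f ` space M = space N"
    using epi by (auto simp: module_epi_def)
  note f = module_homD[OF hom M N]
  note w' = homogD[OF w]
  obtain u where u: "u \<in> space M" "f *\<^sub>v u = w"
    using surj w'(1) by (metis imageE)
  define v where "v = u + sg q \<cdot>\<^sub>v (act M gb *\<^sub>v u) + sg q \<cdot>\<^sub>v (act M gc *\<^sub>v u) + act M gb *\<^sub>v (act M gc *\<^sub>v u)"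
  have h: "homog M q v" by (rule homog_average[OF M u(1) v_def])
  have "f *\<^sub>v v = w + sg q \<cdot>\<^sub>v (sg q \<cdot>\<^sub>v w) + sg q \<cdot>\<^sub>v (sg q \<cdot>\<^sub>v w) + sg q \<cdot>\<^sub>v (sg q \<cdot>\<^sub>v w)"
    unfolding v_def using u M N w' by (simp add: hom_linear[OF hom] f act_linear)
  also have "\<dots> = 4 \<cdot>\<^sub>v w"
    using w'(1) by (intro eq_vecI) auto
  finally have "f *\<^sub>v (inverse 4 \<cdot>\<^sub>v v) = inverse 4 \<cdot>\<^sub>v (4 \<cdot>\<^sub>v w)"
    using homogD(1)[OF h] by (simp add: hom_linear[OF hom])
  also have "\<dots> = w" using four_nonzero[OF two] by (simp add: smult_smult_assoc)
  finally show ?thesis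
    using that[of "inverse 4 \<cdot>\<^sub>v v"] subspD(4)[OF subsp_homog[OF M, of q], of v] h by simp
qed

section \<open>Simple modules and their projective covers\<close>

lemma vdim_simple [simp]: "vdim (simple_module q) = 1"
  by (simp add: simple_module_def)

lemma act_simple:
  assumes "v \<in> carrier_vec 1"
  shows "act (simple_module q) ga *\<^sub>v v = 0\<^sub>v 1" "act (simple_module q) gd *\<^sub>v v = 0\<^sub>v 1"
    "act (simple_module q) gb *\<^sub>v v = sg q \<cdot>\<^sub>v v" "act (simple_module q) gc *\<^sub>v v = sg q \<cdot>\<^sub>v v"
  using assms by (auto simp: simple_module_def sg_def scalar_prod_def intro!: eq_vecI)

lemma act_simple_carrier: "act (simple_module q) g \<in> carrier_mat 1 1"
  by (cases g) (auto simp: simple_module_def)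

lemma D4_simple: "D4_module (simple_module q :: 'k::field rep)"
  by (rule D4_moduleI[OF _ generates_unit_vecs])
    (auto simp: act_simple_carrier[unfolded One_nat_def] act_simple[unfolded One_nat_def] sg_def intro!: eq_vecI)

text \<open>The basis is \<open>p, a p, d p, a d p\<close>, where \<open>p\<close> generates the module.\<close>

definition P0 :: "bit \<Rightarrow> 'k::field rep" where
  "P0 q = Rep 4 (\<lambda>g. case g of
       ga \<Rightarrow> mat 4 4 (\<lambda>(i, j). if (i, j) \<in> {(1, 0), (3, 2)} then 1 else 0)
     | gb \<Rightarrow> mat 4 4 (\<lambda>(i, j). if i = j then (if i \<in> {0, 3} then sg q else - sg q) else 0)
     | gc \<Rightarrow> mat 4 4 (\<lambda>(i, j). if i = j then (if i \<in> {0, 3} then sg q else - sg q) else 0)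
     | gd \<Rightarrow> mat 4 4 (\<lambda>(i, j). if (i, j) = (2, 0) then 1 else if (i, j) = (3, 1) then - 1 else 0))"

lemma vdim_P0 [simp]: "vdim (P0 q) = 4"
  by (simp add: P0_def)

lemma act_P0_carrier: "act (P0 q) g \<in> carrier_mat 4 4"
  by (cases g) (auto simp: P0_def)

lemma less_4_cases: "i < (4::nat) \<longleftrightarrow> i = 0 \<or> i = 1 \<or> i = 2 \<or> i = 3"
  by auto

lemma act_P0:
  "act (P0 q) ga *\<^sub>v unit_vec 4 0 = unit_vec 4 1"
  "act (P0 q) ga *\<^sub>v unit_vec 4 (Suc 0) = 0\<^sub>v 4"
  "act (P0 q) ga *\<^sub>v unit_vec 4 2 = unit_vec 4 3"
  "act (P0 q) ga *\<^sub>v unit_vec 4 3 = 0\<^sub>v 4"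
  "act (P0 q) gd *\<^sub>v unit_vec 4 0 = unit_vec 4 2"
  "act (P0 q) gd *\<^sub>v unit_vec 4 (Suc 0) = - unit_vec 4 3"
  "act (P0 q) gd *\<^sub>v unit_vec 4 2 = 0\<^sub>v 4"
  "act (P0 q) gd *\<^sub>v unit_vec 4 3 = 0\<^sub>v 4"
  by (auto simp: P0_def less_4_cases intro!: eq_vecI)

lemma act_P0':
  assumes "g = gb \<or> g = gc"
  shows "act (P0 q) g *\<^sub>v unit_vec 4 0 = sg q \<cdot>\<^sub>v unit_vec 4 0"
  "act (P0 q) g *\<^sub>v unit_vec 4 (Suc 0) = - sg q \<cdot>\<^sub>v unit_vec 4 1"
  "act (P0 q) g *\<^sub>v unit_vec 4 2 = - sg q \<cdot>\<^sub>v unit_vec 4 2"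
  "act (P0 q) g *\<^sub>v unit_vec 4 3 = sg q \<cdot>\<^sub>v unit_vec 4 3"
  using assms by (auto simp: P0_def less_4_cases intro!: eq_vecI)

lemma D4_P0: "D4_module (P0 q :: 'k::field rep)"
proof -
  have z: "act (P0 q) g *\<^sub>v 0\<^sub>v 4 = (0\<^sub>v 4 :: 'k vec)" for g
    by (rule mult_mat_vec_zero[OF act_P0_carrier])
  have s: "act (P0 q) g *\<^sub>v (x \<cdot>\<^sub>v unit_vec 4 i) = x \<cdot>\<^sub>v (act (P0 q) g *\<^sub>v (unit_vec 4 i :: 'k vec))" for g x i
    by (rule mult_mat_vec[OF act_P0_carrier]) simp
  have n: "act (P0 q) g *\<^sub>v (- unit_vec 4 i) = - (act (P0 q) g *\<^sub>v (unit_vec 4 i :: 'k vec))" for g i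
    by (rule mult_mat_vec_uminus[OF act_P0_carrier]) simp
  show ?thesis
    by (rule D4_moduleI[OF _ generates_unit_vecs])
      (auto simp: less_4_cases act_P0_carrier act_P0 act_P0' z s n smult_smult_assoc,
        auto intro!: eq_vecI)
qed

text \<open>The generator p of \<open>P0 q\<close> satisfies only those relations that hold for
  every vector of degree \<open>q\<close>, so it may be sent to any such \<open>w\<close>; the other
  basis vectors must then go to a w, d w and a d w.\<close>

lemma P0_hom:
  assumes C: "D4_module C" and w: "homog C q w"
  obtains f where "module_hom (P0 q) C f" "f *\<^sub>v unit_vec 4 0 = w"
    "f *\<^sub>v unit_vec 4 3 = act C ga *\<^sub>v (act C gd *\<^sub>v w)"
proof -
  define x where "x i = [w, act C ga *\<^sub>v w, act C gd *\<^sub>v w, act C ga *\<^sub>v (act C gd *\<^sub>v w)] ! i" for i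
  define f where "f = cols_mat (vdim C) 4 x"
  note w0 = homogD(1)[OF w]
  have x: "x 0 = w" "x 1 = act C ga *\<^sub>v w" "x 2 = act C gd *\<^sub>v w" "x 3 = act C ga *\<^sub>v (act C gd *\<^sub>v w)"
    by (simp_all add: x_def)
  have xc: "x i \<in> space C" if "i < 4" for i
    using that C w0 by (auto simp: less_4_cases x simp flip: One_nat_def)
  have fc: "f \<in> carrier_mat (vdim C) 4" by (simp add: f_def)
  have fx: "f *\<^sub>v unit_vec 4 i = x i" if "i < 4" for i
    using cols_mat_unit[of i 4 x] xc[OF that] that by (simp add: f_def)
  have fx': "f *\<^sub>v unit_vec 4 0 = w" "f *\<^sub>v unit_vec 4 (Suc 0) = act C ga *\<^sub>v w"
    "f *\<^sub>v unit_vec 4 2 = act C gd *\<^sub>v w" "f *\<^sub>v unit_vec 4 3 = act C ga *\<^sub>v (act C gd *\<^sub>v w)"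
    using fx[of 0] fx[of 1] fx[of 2] fx[of 3] by (simp_all add: x[unfolded One_nat_def])
  have "homog C q (act C ga *\<^sub>v (act C gd *\<^sub>v w))"
    using homog_act(1)[OF C homog_act(2)[OF C w]] by (simp only: bit_add_1_1)
  note h = homogD[OF w] homogD[OF this] homogD[OF homog_act(1)[OF C w]] homogD[OF homog_act(2)[OF C w]]
  have "module_hom (P0 q) C f"
  proof (rule module_homI[OF D4_P0 C _ generates_unit_vecs])
    show "f \<in> carrier_mat (vdim C) (vdim (P0 q))" using fc by simp
    fix g v assume "v \<in> (unit_vec (vdim (P0 q)) :: nat \<Rightarrow> 'a vec) ` {..<vdim (P0 q)}"
    then have "v = unit_vec 4 0 \<or> v = unit_vec 4 (Suc 0) \<or> v = unit_vec 4 2 \<or> v = unit_vec 4 3"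
      by (auto simp: less_4_cases)
    then show "f *\<^sub>v (act (P0 q) g *\<^sub>v v) = act C g *\<^sub>v (f *\<^sub>v v)"
      using C w0
      by (cases g) (auto simp: act_P0 act_P0' fx' mult_mat_vec[OF fc] mult_mat_vec_uminus[OF fc]
          mult_mat_vec_zero[OF fc] D4_rels(1-9) homog_act(3)[OF C w]
          homog_act(3)[OF C homog_act(2)[OF C w]] h act_linear)
  qed
  then show ?thesis using that fx' by blast
qed

lemma simple_hom:
  assumes C: "D4_module C" and w: "homog C q w"
    "act C ga *\<^sub>v w = 0\<^sub>v (vdim C)" "act C gd *\<^sub>v w = 0\<^sub>v (vdim C)"
  shows "module_hom (simple_module q) C (cols_mat (vdim C) 1 (\<lambda>_. w))"
    and "cols_mat (vdim C) 1 (\<lambda>_. w) *\<^sub>v unit_vec 1 0 = w"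
proof -
  let ?f = "cols_mat (vdim C) 1 (\<lambda>_. w)"
  note w' = homogD[OF w(1)]
  have fc: "?f \<in> carrier_mat (vdim C) 1" by simp
  show e: "?f *\<^sub>v unit_vec 1 0 = w"
    by (rule cols_mat_unit) (use w' in auto)
  show "module_hom (simple_module q) C ?f"
  proof (rule module_homI[OF D4_simple C _ generates_unit_vecs])
    fix g v
    assume "v \<in> (unit_vec (vdim (simple_module q :: 'a rep)) :: nat \<Rightarrow> 'a vec) ` {..<vdim (simple_module q :: 'a rep)}"
    then have "v = unit_vec 1 0" by auto
    then show "?f *\<^sub>v (act (simple_module q) g *\<^sub>v v) = act C g *\<^sub>v (?f *\<^sub>v v)"
      by (cases g) (simp_all add: e w w' act_simple mult_mat_vec[OF fc] mult_mat_vec_zero[OF fc]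
          del: One_nat_def)
  qed simp
qed

text \<open>The socle inclusion: \<open>unit_vec 4 3\<close> is a d p, which a and d kill. This is
  the monomorphism against which injectivity is tested later.\<close>

lemma simple_into_P0:
  "module_mono (simple_module q) (P0 q :: 'k::field rep) (cols_mat 4 1 (\<lambda>_. unit_vec 4 3))"
  "cols_mat 4 1 (\<lambda>_. unit_vec 4 3) *\<^sub>v unit_vec 1 0 = (unit_vec 4 3 :: 'k vec)"
proof -
  let ?f = "cols_mat 4 1 (\<lambda>_. unit_vec 4 3) :: 'k mat"
  have h: "homog (P0 q) q (unit_vec 4 3 :: 'k vec)"
    by (auto simp: homog_def act_P0')
  have "module_hom (simple_module q) (P0 q) ?f" "?f *\<^sub>v unit_vec 1 0 = unit_vec 4 3"
    using simple_hom[OF D4_P0 h] by (simp_all add: act_P0)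
  moreover have "inj_on ((*\<^sub>v) ?f) (carrier_vec 1)"
  proof (rule inj_onI)
    fix u v :: "'k vec" assume uv: "u \<in> carrier_vec 1" "v \<in> carrier_vec 1" "?f *\<^sub>v u = ?f *\<^sub>v v"
    have "(?f *\<^sub>v w) $ 3 = w $ 0" if "w \<in> carrier_vec 1" for w
      using that by (simp add: cols_mat_mult lc_def)
    then show "u = v" using uv by (intro eq_vecI) (auto simp: less_Suc_eq, metis)
  qed
  ultimately show "module_mono (simple_module q) (P0 q) ?f" "?f *\<^sub>v unit_vec 1 0 = unit_vec 4 3"
    by (simp_all add: module_mono_def)
qed

lemma P0_onto_simple:
  obtains \<pi> where "module_epi (P0 q) (simple_module q :: 'k::field rep) \<pi>"
    "\<And>z. z \<in> carrier_vec 4 \<Longrightarrow> \<pi> *\<^sub>v z = z $ 0 \<cdot>\<^sub>v (unit_vec 1 0 :: 'k vec)"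
proof -
  define \<pi> where "\<pi> = (mat 1 4 (\<lambda>(i, j). if j = 0 then 1 else 0) :: 'k mat)"
  have pc: "\<pi> \<in> carrier_mat 1 4" by (simp add: \<pi>_def)
  have p: "\<pi> *\<^sub>v z = z $ 0 \<cdot>\<^sub>v unit_vec 1 0" if "z \<in> carrier_vec 4" for z
  proof (rule eq_vecI)
    fix i assume "i < dim_vec (z $ 0 \<cdot>\<^sub>v unit_vec 1 0)"
    then have i: "i = 0" by simp
    have "(\<pi> *\<^sub>v z) $ i = (\<Sum>j = 0..<4. (if j = 0 then 1 else 0) * z $ j)"
      using that i by (auto simp: \<pi>_def scalar_prod_def intro!: sum.cong)
    also have "\<dots> = (\<Sum>j = 0..<4. if j = 0 then z $ j else 0)" by (intro sum.cong) auto
    finally show "(\<pi> *\<^sub>v z) $ i = (z $ 0 \<cdot>\<^sub>v unit_vec 1 0) $ i" using i by simp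
  qed (simp add: \<pi>_def)
  have "module_hom (P0 q) (simple_module q) \<pi>"
  proof (rule module_homI[OF D4_P0 D4_simple _ generates_unit_vecs])
    fix g v assume "v \<in> (unit_vec (vdim (P0 q)) :: nat \<Rightarrow> 'k vec) ` {..<vdim (P0 q)}"
    then have "v = unit_vec 4 0 \<or> v = unit_vec 4 (Suc 0) \<or> v = unit_vec 4 2 \<or> v = unit_vec 4 3"
      by (auto simp: less_4_cases)
    then show "\<pi> *\<^sub>v (act (P0 q) g *\<^sub>v v) = act (simple_module q) g *\<^sub>v (\<pi> *\<^sub>v v)"
      by (cases g) (auto simp: p act_simple[unfolded One_nat_def] act_P0 act_P0' intro!: eq_vecI)
  qed (use pc in simp)
  moreover have "(*\<^sub>v) \<pi> ` space (P0 q) = (space (simple_module q) :: 'k vec set)"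
  proof (intro equalityI subsetI)
    fix v :: "'k vec" assume "v \<in> space (simple_module q)"
    then have "v = \<pi> *\<^sub>v (v $ 0 \<cdot>\<^sub>v unit_vec 4 0)"
      by (simp add: p) (auto intro!: eq_vecI)
    then show "v \<in> (*\<^sub>v) \<pi> ` space (P0 q)" by (rule image_eqI) simp
  qed (use pc in auto)
  ultimately have "module_epi (P0 q) (simple_module q) \<pi>" by (simp add: module_epi_def)
  then show ?thesis using that p by blast
qed

text \<open>The coefficient of p is the only obstruction to generating: a d z is a nonzero multiple
  of the socle vector, a z and d z then yield a p and d p modulo it, and \<open>z\<close> itself
  finally yields p.\<close>

lemma P0_local:
  assumes U: "is_submodule (P0 q) U" and z: "z \<in> U" "z $ 0 \<noteq> 0"
  shows "U = (carrier_vec 4 :: 'k::field vec set)"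
proof -
  have s: "subsp 4 U" using is_submoduleD(1)[OF U] by simp
  note act_in = is_submoduleD(2)[OF U]
  have zc: "z \<in> carrier_vec 4" using subspD(1)[OF s z(1)] .
  have zz: "z = z $ 0 \<cdot>\<^sub>v unit_vec 4 0 + z $ 1 \<cdot>\<^sub>v unit_vec 4 1 + z $ 2 \<cdot>\<^sub>v unit_vec 4 2 + z $ 3 \<cdot>\<^sub>v unit_vec 4 3"
    using zc by (intro eq_vecI) (auto simp: less_4_cases)
  have az: "act (P0 q) ga *\<^sub>v z = z $ 0 \<cdot>\<^sub>v unit_vec 4 1 + z $ 2 \<cdot>\<^sub>v unit_vec 4 3"
    using zc by (intro eq_vecI) (auto simp: P0_def scalar_prod_def less_4_cases eval_nat_numeral)
  have dz: "act (P0 q) gd *\<^sub>v z = z $ 0 \<cdot>\<^sub>v unit_vec 4 2 - z $ 1 \<cdot>\<^sub>v unit_vec 4 3"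
    using zc by (intro eq_vecI) (auto simp: P0_def scalar_prod_def less_4_cases eval_nat_numeral)
  have "act (P0 q) ga *\<^sub>v (act (P0 q) gd *\<^sub>v z) = z $ 0 \<cdot>\<^sub>v unit_vec 4 3"
    unfolding dz
    by (intro eq_vecI) (auto simp: P0_def scalar_prod_def less_4_cases eval_nat_numeral)
  then have "inverse (z $ 0) \<cdot>\<^sub>v (z $ 0 \<cdot>\<^sub>v unit_vec 4 3) \<in> U"
    using subspD(4)[OF s] act_in z(1) by metis
  then have e3: "unit_vec 4 3 \<in> U" using z(2) by (simp add: smult_smult_assoc)
  have cancel: "unit_vec 4 i \<in> U" if "u \<in> U" "v \<in> U" "u = z $ 0 \<cdot>\<^sub>v unit_vec 4 i + v" "i < 4" for u v i
  proof -
    have vc: "v \<in> carrier_vec 4" using subspD(1)[OF s that(2)] .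
    have "z $ 0 \<cdot>\<^sub>v unit_vec 4 i = u - v"
      unfolding that(3) using vc by (intro eq_vecI) auto
    then have "inverse (z $ 0) \<cdot>\<^sub>v (z $ 0 \<cdot>\<^sub>v unit_vec 4 i) \<in> U"
      using subspD(4)[OF s] subsp_diff[OF s that(1,2)] by metis
    then show ?thesis using z(2) by (simp add: smult_smult_assoc)
  qed
  have e1: "unit_vec 4 1 \<in> U"
    by (rule cancel[OF act_in[OF z(1)] subspD(4)[OF s e3] az]) simp
  have e2: "unit_vec 4 2 \<in> U"
  proof (rule cancel[OF act_in[OF z(1)] subspD(4)[OF s e3]])
    show "act (P0 q) gd *\<^sub>v z = z $ 0 \<cdot>\<^sub>v unit_vec 4 2 + (- z $ 1) \<cdot>\<^sub>v unit_vec 4 3"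
      unfolding dz by (intro eq_vecI) auto
  qed simp
  have e0: "unit_vec 4 0 \<in> U"
  proof (rule cancel[OF z(1)])
    show "z $ 1 \<cdot>\<^sub>v unit_vec 4 1 + z $ 2 \<cdot>\<^sub>v unit_vec 4 2 + z $ 3 \<cdot>\<^sub>v unit_vec 4 3 \<in> U"
      by (intro subspD(3)[OF s] subspD(4)[OF s] e1 e2 e3)
    show "z = z $ 0 \<cdot>\<^sub>v unit_vec 4 0 + (z $ 1 \<cdot>\<^sub>v unit_vec 4 1 + z $ 2 \<cdot>\<^sub>v unit_vec 4 2 + z $ 3 \<cdot>\<^sub>v unit_vec 4 3)"
      using zc by (intro eq_vecI) (auto simp: less_4_cases)
  qed simp
  have "unit_vec 4 i \<in> U" if "i < 4" for i
    using that e0 e1 e2 e3 by (auto simp: less_4_cases)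
  then show ?thesis
    using unit_vecs_generate[OF s] subspD(1)[OF s] by blast
qed

lemma projective_cover_simple:
  assumes cover: "projective_cover (simple_module q) P p" and two: "(2::'k::field) \<noteq> 0"
  obtains h where "module_epi (P :: 'k rep) (P0 q) h" "vdim P = 4" "D4_module P"
proof -
  have P: "D4_module P" and epi: "module_epi P (simple_module q) p"
    and lift: "\<And>M N f g. D4_module M \<Longrightarrow> D4_module N \<Longrightarrow> module_epi M N f \<Longrightarrow> module_hom P N g \<Longrightarrow>
      \<exists>h. module_hom P M h \<and> f * h = g"
    and superfluous: "\<And>U. is_submodule P U \<Longrightarrow> {u + w | u w. u \<in> U \<and> w \<in> mat_kernel p} = space P \<Longrightarrow> U = space P"
    using cover unfolding projective_cover_def projective_module_def by blast+
  note S = D4_simple[of q]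
  have p: "module_hom P (simple_module q) p" using epi by (simp add: module_epi_def)
  note p' = module_homD[OF p P S]
  have "homog (simple_module q) q (unit_vec 1 0 :: 'k vec)"
    by (simp add: homog_def act_simple del: One_nat_def)
  then obtain w where w: "homog P q w" "p *\<^sub>v w = unit_vec 1 0"
    using hom_homog_lift[OF P S epi _ two] by blast
  obtain \<pi> where \<pi>: "module_epi (P0 q) (simple_module q :: 'k rep) \<pi>"
    "\<And>z. z \<in> carrier_vec 4 \<Longrightarrow> \<pi> *\<^sub>v z = z $ 0 \<cdot>\<^sub>v (unit_vec 1 0 :: 'k vec)"
    using P0_onto_simple[of q] by blast
  obtain h where h: "module_hom P (P0 q) h" "\<pi> * h = p"
    using lift[OF D4_P0 S \<pi>(1) p] by blast
  note h' = module_homD[OF h(1) P D4_P0]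
  have \<pi>c: "\<pi> \<in> carrier_mat 1 4" using \<pi>(1) by (simp add: module_epi_def module_hom_def)
  have "\<pi> *\<^sub>v (h *\<^sub>v w) = unit_vec 1 0"
    using assoc_mult_mat_vec[OF \<pi>c, of h "vdim P" w] h'(1) homogD(1)[OF w(1)] h(2) w(2) by simp
  then have "(h *\<^sub>v w) $ 0 \<cdot>\<^sub>v unit_vec 1 0 = (unit_vec 1 0 :: 'k vec)"
    using \<pi>(2) h'(2)[OF homogD(1)[OF w(1)]] by simp
  then have "((h *\<^sub>v w) $ 0 \<cdot>\<^sub>v unit_vec 1 0) $ 0 = (unit_vec 1 0 :: 'k vec) $ 0" by simp
  then have nz: "(h *\<^sub>v w) $ 0 \<noteq> 0" by auto
  have surj: "(*\<^sub>v) h ` space P = (carrier_vec 4 :: 'k vec set)"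
    by (rule P0_local[OF hom_image_submodule[OF P D4_P0 h(1)] _ nz]) (use homogD(1)[OF w(1)] in blast)
  obtain k where k: "module_hom (P0 q) P k" "k *\<^sub>v unit_vec 4 0 = w"
    using P0_hom[OF P w(1)] by blast
  note k' = module_homD[OF k(1) D4_P0 P]
  have "(*\<^sub>v) k ` space (P0 q) = space P"
  proof (rule superfluous[OF hom_image_submodule[OF D4_P0 P k(1)]])
    show "{u + w |u w. u \<in> (*\<^sub>v) k ` space (P0 q) \<and> w \<in> mat_kernel p} = space P"
    proof (intro equalityI subsetI)
      fix v assume v: "v \<in> space P"
      \<comment> \<open>Subtracting the multiple of \<open>w\<close> with the same image under
        \<open>p\<close> leaves an element of the kernel.\<close>
      define c where "c = (p *\<^sub>v v) $ 0"
      have wc: "w \<in> space P" using homogD(1)[OF w(1)] .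
      have pv: "p *\<^sub>v v = c \<cdot>\<^sub>v unit_vec 1 0"
        using carrier_vecD[OF p'(2)[OF v]] by (intro eq_vecI) (auto simp: c_def simp del: dim_mult_mat_vec)
      then have "p *\<^sub>v (v - c \<cdot>\<^sub>v w) = 0\<^sub>v 1"
        using v wc w(2) by (simp add: hom_linear[OF p] del: One_nat_def)
      then have "v - c \<cdot>\<^sub>v w \<in> mat_kernel p"
        using v wc p'(1) by (intro mat_kernelI[of p 1 "vdim P"]) auto
      moreover have "c \<cdot>\<^sub>v w \<in> (*\<^sub>v) k ` space (P0 q)"
        using k hom_linear(3)[OF k(1), of "unit_vec 4 0" c] by (intro image_eqI[of _ _ "c \<cdot>\<^sub>v unit_vec 4 0"]) auto
      moreover have "v = c \<cdot>\<^sub>v w + (v - c \<cdot>\<^sub>v w)"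
        using v wc by (intro eq_vecI) auto
      ultimately show "v \<in> {u + w |u w. u \<in> (*\<^sub>v) k ` space (P0 q) \<and> w \<in> mat_kernel p}"
        by blast
    next
      fix v assume "v \<in> {u + w |u w. u \<in> (*\<^sub>v) k ` space (P0 q) \<and> w \<in> mat_kernel p}"
      then obtain u w' where "u \<in> (*\<^sub>v) k ` space (P0 q)" "w' \<in> mat_kernel p" "v = u + w'" by blast
      then show "v \<in> space P"
        using k'(2) mat_kernelD(1)[OF p'(1)] by auto
    qed
  qed
  then have "vdim P \<le> 4" using surj_dim_le[OF k'(1)] by simp
  moreover have "4 \<le> vdim P" using surj_dim_le[of h 4 "vdim P"] h'(1) surj by simp
  moreover have "module_epi P (P0 q) h" using h(1) surj by (simp add: module_epi_def)
  ultimately show ?thesis using that P by simp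
qed

section \<open>The cosyzygies of the simple modules\<close>

text \<open>\<open>q\<close> is the degree of the socle vectors, so the \<open>x i\<close> sit in
  degree \<open>q + 1\<close>. The whole family has to span, but independence is demanded only of
  the \<open>y i\<close>: since a maps \<open>x i\<close> to \<open>y i\<close>, that of the
  \<open>x i\<close> follows. For \<open>n = 0\<close> only \<open>y 0\<close> remains, as in a
  simple module.\<close>

definition zigzag :: "nat \<Rightarrow> bit \<Rightarrow> 'k::field rep \<Rightarrow> (nat \<Rightarrow> 'k vec) \<Rightarrow> (nat \<Rightarrow> 'k vec) \<Rightarrow> bool" where
  "zigzag n q M x y \<longleftrightarrow> D4_module M \<and>
     (\<forall>i<n. homog M (q + 1) (x i) \<and> act M ga *\<^sub>v x i = y i \<and> act M gd *\<^sub>v x i = y (Suc i)) \<and>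
     (\<forall>i\<le>n. homog M q (y i) \<and> act M ga *\<^sub>v y i = 0\<^sub>v (vdim M) \<and> act M gd *\<^sub>v y i = 0\<^sub>v (vdim M)) \<and>
     generates (vdim M) (x ` {..<n} \<union> y ` {..n}) \<and>
     (\<forall>\<beta>. lc (vdim M) (Suc n) \<beta> y = 0\<^sub>v (vdim M) \<longrightarrow> (\<forall>i\<le>n. \<beta> i = 0))"

lemma zigzagD:
  assumes "zigzag n q M x y"
  shows "D4_module M"
    and "i < n \<Longrightarrow> homog M (q + 1) (x i)" "i < n \<Longrightarrow> x i \<in> space M"
      "i < n \<Longrightarrow> act M ga *\<^sub>v x i = y i" "i < n \<Longrightarrow> act M gd *\<^sub>v x i = y (Suc i)"
    and "i \<le> n \<Longrightarrow> homog M q (y i)" "i \<le> n \<Longrightarrow> y i \<in> space M"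
      "i \<le> n \<Longrightarrow> act M ga *\<^sub>v y i = 0\<^sub>v (vdim M)" "i \<le> n \<Longrightarrow> act M gd *\<^sub>v y i = 0\<^sub>v (vdim M)"
    and "generates (vdim M) (x ` {..<n} \<union> y ` {..n})"
    and "lc (vdim M) (Suc n) \<beta> y = 0\<^sub>v (vdim M) \<Longrightarrow> i \<le> n \<Longrightarrow> \<beta> i = 0"
  using assms unfolding zigzag_def homog_def by blast+

lemma homog_lc: "D4_module M \<Longrightarrow> (\<And>i. i < m \<Longrightarrow> homog M q (x i)) \<Longrightarrow> homog M q (lc (vdim M) m \<alpha> x)"
  using lc_in_subsp[OF subsp_homog, of M m x q \<alpha>] by auto

lemma homog_both:
  assumes "homog M q v" "homog M (q + 1) v" and two: "(2::'k::field) \<noteq> 0"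
  shows "v = 0\<^sub>v (vdim M :: nat) \<and> v \<in> (space M :: 'k vec set)"
proof -
  have v: "v \<in> space M" using homogD(1)[OF assms(1)] .
  have "sg q \<cdot>\<^sub>v v = - sg q \<cdot>\<^sub>v v" 
    using homogD(2)[OF assms(1)] homogD(2)[OF assms(2), unfolded sg_add_1] by simp
  then have "sg q * v $ i = - sg q * v $ i" if "i < vdim M" for i
    using that v by (metis carrier_vecD index_smult_vec(1))
  then have "sg q * (2 * v $ i) = 0" if "i < vdim M" for i
    using that by (simp add: algebra_simps)
  then have "v $ i = 0" if "i < vdim M" for i using that two by simp
  then show ?thesis using v by (auto intro!: eq_vecI)
qed

lemma zigzag_expand:
  assumes W: "zigzag n q M x y" and v: "v \<in> space M"
  obtains \<alpha> \<beta> where "v = lc (vdim M) n \<alpha> x + lc (vdim M) (Suc n) \<beta> y"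
proof -
  let ?d = "vdim M"
  let ?U = "{lc ?d n \<alpha> x + lc ?d (Suc n) \<beta> y | \<alpha> \<beta>. True}"
  have "subsp ?d ?U"
  proof (rule subspI)
    show "0\<^sub>v ?d \<in> ?U"
      using lc_zero_coeff[of n "\<lambda>_. 0" ?d x] lc_zero_coeff[of "Suc n" "\<lambda>_. 0" ?d y]
      by (intro CollectI exI[of _ "\<lambda>_. 0"]) auto
  next
    fix u v assume "u \<in> ?U" "v \<in> ?U"
    then obtain \<alpha> \<beta> \<alpha>' \<beta>' where "u = lc ?d n \<alpha> x + lc ?d (Suc n) \<beta> y"
      "v = lc ?d n \<alpha>' x + lc ?d (Suc n) \<beta>' y" by blast
    then have "u + v = lc ?d n (\<lambda>i. \<alpha> i + \<alpha>' i) x + lc ?d (Suc n) (\<lambda>i. \<beta> i + \<beta>' i) y"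
      unfolding lc_add[symmetric] by (auto intro!: eq_vecI simp: lc_def)
    then show "u + v \<in> ?U" by blast
  next
    fix c u assume "u \<in> ?U"
    then obtain \<alpha> \<beta> where "u = lc ?d n \<alpha> x + lc ?d (Suc n) \<beta> y" by blast
    then have "c \<cdot>\<^sub>v u = lc ?d n (\<lambda>i. c * \<alpha> i) x + lc ?d (Suc n) (\<lambda>i. c * \<beta> i) y"
      by (auto intro!: eq_vecI simp: lc_def sum_distrib_left algebra_simps simp del: sum.lessThan_Suc)
    then show "c \<cdot>\<^sub>v u \<in> ?U" by blast
  qed auto
  moreover have "u \<in> ?U" if u: "u \<in> x ` {..<n} \<union> y ` {..n}" for u
  proof -
    have "u \<in> space M" using u zigzagD(3,7)[OF W] by auto
    consider i where "i < n" "u = x i" | i where "i < Suc n" "u = y i"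
      using u by (auto simp: less_Suc_eq_le)
    then show ?thesis
    proof cases
      case 1
      then have "u = lc ?d n (\<lambda>j. if j = i then 1 else 0) x + lc ?d (Suc n) (\<lambda>_. 0) y"
        using \<open>u \<in> space M\<close> by (simp add: lc_unit lc_zero_coeff)
      then show ?thesis by blast
    next
      case 2
      then have "u = lc ?d n (\<lambda>_. 0) x + lc ?d (Suc n) (\<lambda>j. if j = i then 1 else 0) y"
        using \<open>u \<in> space M\<close> by (simp add: lc_unit lc_zero_coeff)
      then show ?thesis by blast
    qed
  qed
  ultimately have "v \<in> ?U" using generatesD[OF zigzagD(10)[OF W] _ _ v] by blast
  then show ?thesis using that by blast
qed

text \<open>In the expansion of \<open>v\<close>, the part of the wrong degree is also a difference
  of two vectors of the right degree; being of both degrees, it vanishes by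
  \<open>homog_both\<close>.\<close>

lemma zigzag_homog:
  assumes W: "zigzag n q M x y" and two: "(2::'k::field) \<noteq> 0"
  shows "homog M (q + 1) v \<Longrightarrow> \<exists>\<alpha>. v = lc (vdim M) n \<alpha> x"
    and "homog M q v \<Longrightarrow> \<exists>\<beta>. v = lc (vdim M) (Suc n) \<beta> (y :: nat \<Rightarrow> 'k vec)"
proof -
  let ?d = "vdim M"
  note M = zigzagD(1)[OF W]
  have X: "homog M (q + 1) (lc ?d n \<alpha> x)" for \<alpha> by (intro homog_lc zigzagD(2)[OF W] M)
  have Y: "homog M q (lc ?d (Suc n) \<beta> y)" for \<beta> by (intro homog_lc zigzagD(6)[OF W] M) simp
  have diff: "homog M r (u - w)" if "homog M r u" "homog M r w" for r u w
    using subsp_diff[OF subsp_homog[OF M, of r], of u w] that by simp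
  {
    assume v: "homog M (q + 1) v"
    obtain \<alpha> \<beta> where *: "v = lc ?d n \<alpha> x + lc ?d (Suc n) \<beta> y"
      using zigzag_expand[OF W homogD(1)[OF v]] .
    have "v - lc ?d n \<alpha> x = lc ?d (Suc n) \<beta> y" unfolding * by (auto intro!: eq_vecI simp: lc_def)
    then have "lc ?d (Suc n) \<beta> y = 0\<^sub>v ?d" using homog_both[OF Y _ two] diff[OF v X] by metis
    then have "v = lc ?d n \<alpha> x" unfolding * by (simp add: right_zero_vec[OF lc_carrier])
    then show "\<exists>\<alpha>. v = lc ?d n \<alpha> x" by blast
  next
    assume v: "homog M q v"
    obtain \<alpha> \<beta> where *: "v = lc ?d n \<alpha> x + lc ?d (Suc n) \<beta> y"
      using zigzag_expand[OF W homogD(1)[OF v]] .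
    have "v - lc ?d (Suc n) \<beta> y = lc ?d n \<alpha> x" unfolding * by (auto intro!: eq_vecI simp: lc_def)
    then have "lc ?d n \<alpha> x = 0\<^sub>v ?d" using homog_both[OF _ X two] diff[OF v Y] by metis
    then have "v = lc ?d (Suc n) \<beta> y" unfolding * by simp
    then show "\<exists>\<beta>. v = lc ?d (Suc n) \<beta> y" by blast
  }
qed

lemma zigzag_x_independent:
  assumes W: "zigzag n q M x y" and "act M ga *\<^sub>v lc (vdim M) n \<alpha> x = 0\<^sub>v (vdim M)"
  shows "i < n \<Longrightarrow> \<alpha> i = 0"
proof -
  let ?d = "vdim M"
  have "act M ga *\<^sub>v lc ?d n \<alpha> x = lc ?d n \<alpha> (\<lambda>i. act M ga *\<^sub>v x i)"
    by (intro mult_mat_vec_lc act_carrier zigzagD(1,3)[OF W])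
  also have "\<dots> = lc ?d n \<alpha> y" by (intro lc_cong zigzagD(4)[OF W])
  also have "\<dots> = lc ?d (Suc n) (\<lambda>i. if i < n then \<alpha> i else 0) y" by (intro lc_extend) simp
  finally have "i \<le> n \<Longrightarrow> (if i < n then \<alpha> i else 0) = 0" for i
    using assms(2) zigzagD(11)[OF W, of "\<lambda>i. if i < n then \<alpha> i else 0" i] by simp
  then show "i < n \<Longrightarrow> \<alpha> i = 0" by (metis less_imp_le)
qed

text \<open>The \<open>2 * n + 1\<close> vectors form a basis, so the matrix \<open>G\<close> having
  them as columns is invertible. This yields the dimension and, as \<open>F * R\<close>, a linear
  map with prescribed values on the basis.\<close>

lemma zigzag_basis:
  assumes W: "zigzag n q M x y"
  shows "vdim M = 2 * n + 1"
    and "(\<And>i. i < n \<Longrightarrow> u i \<in> carrier_vec e) \<Longrightarrow> (\<And>i. i \<le> n \<Longrightarrow> v i \<in> carrier_vec e) \<Longrightarrow>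
      \<exists>f \<in> carrier_mat e (vdim M). (\<forall>i<n. f *\<^sub>v x i = u i) \<and> (\<forall>i\<le>n. f *\<^sub>v y i = v i)"
proof -
  let ?d = "vdim M" and ?m = "n + Suc n"
  note M = zigzagD(1)[OF W]
  define z where "z i = (if i < n then x i else y (i - n))" for i
  have zc: "z i \<in> space M" if "i < ?m" for i using that zigzagD(3,7)[OF W] by (auto simp: z_def)
  define G where "G = cols_mat ?d ?m z"
  have G: "G \<in> carrier_mat ?d ?m" by (simp add: G_def del: add_Suc_right)
  have Gz: "G *\<^sub>v unit_vec ?m i = z i" if "i < ?m" for i
    unfolding G_def using that zc by (intro cols_mat_unit)
  have surj: "(*\<^sub>v) G ` carrier_vec ?m = space M"
  proof (intro equalityI subsetI)
    fix w assume "w \<in> space M"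
    then show "w \<in> (*\<^sub>v) G ` carrier_vec ?m"
    proof (rule generatesD[OF zigzagD(10)[OF W] subsp_image[OF G], rotated])
      fix w assume "w \<in> x ` {..<n} \<union> y ` {..n}"
      then obtain i where "i < ?m" "w = z i"
      proof
        assume "w \<in> x ` {..<n}"
        then obtain i where "i < n" "w = x i" by auto
        then show ?thesis using that[of i] by (simp add: z_def)
      next
        assume "w \<in> y ` {..n}"
        then obtain i where "i \<le> n" "w = y i" by auto
        then show ?thesis using that[of "n + i"] by (simp add: z_def)
      qed
      then show "w \<in> (*\<^sub>v) G ` carrier_vec ?m"
        using Gz by (intro image_eqI[of _ _ "unit_vec ?m i"]) auto
    qed
  qed (use G in auto)
  \<comment> \<open>Applying a kills the \<open>y\<close> part and turns the \<open>x\<close> part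
    into a combination of the \<open>y i\<close>; so the \<open>x\<close> coefficients vanish first,
    and then the \<open>y\<close> coefficients.\<close>
  have ker: "c = 0\<^sub>v ?m" if c: "c \<in> carrier_vec ?m" and 0: "G *\<^sub>v c = 0\<^sub>v ?d" for c
  proof -
    let ?X = "lc ?d n (($) c) x" and ?Y = "lc ?d (Suc n) (\<lambda>i. c $ (n + i)) y"
    have "lc ?d ?m (($) c) z = lc ?d n (($) c) z + lc ?d (Suc n) (\<lambda>i. c $ (n + i)) (\<lambda>i. z (n + i))"
      by (rule lc_split)
    also have "lc ?d n (($) c) z = ?X" by (intro lc_cong) (simp add: z_def)
    also have "lc ?d (Suc n) (\<lambda>i. c $ (n + i)) (\<lambda>i. z (n + i)) = ?Y" by (intro lc_cong) (simp add: z_def)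
    finally have XY: "?X + ?Y = 0\<^sub>v ?d" using 0 c by (simp add: G_def cols_mat_mult del: add_Suc_right)
    have "act M ga *\<^sub>v ?Y = lc ?d (Suc n) (\<lambda>i. c $ (n + i)) (\<lambda>i. act M ga *\<^sub>v y i)"
      by (intro mult_mat_vec_lc act_carrier zigzagD(1,7)[OF W]) simp
    also have "\<dots> = lc ?d (Suc n) (\<lambda>i. c $ (n + i)) (\<lambda>i. 0\<^sub>v ?d)"
      by (intro lc_cong zigzagD(8)[OF W]) simp
    also have "\<dots> = 0\<^sub>v ?d" by (intro eq_vecI) (auto simp: lc_def)
    finally have "act M ga *\<^sub>v (?X + ?Y) = act M ga *\<^sub>v ?X"
      using M by (simp add: act_linear)
    then have "act M ga *\<^sub>v ?X = 0\<^sub>v ?d" using XY M by (simp add: act_linear)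
    then have c1: "c $ i = 0" if "i < n" for i using zigzag_x_independent[OF W] that by blast
    then have "?X = 0\<^sub>v ?d" by (intro lc_zero_coeff) simp
    then have "?Y = 0\<^sub>v ?d" using XY by simp
    then have c2: "c $ (n + i) = 0" if "i \<le> n" for i using zigzagD(11)[OF W _ that] by blast
    show ?thesis
    proof (rule eq_vecI)
      fix i assume "i < dim_vec (0\<^sub>v ?m :: 'a vec)"
      then show "c $ i = 0\<^sub>v ?m $ i"
        using c1[of i] c2[of "i - n"] by (cases "i < n") auto
    qed (use c in simp)
  qed
  have "inj_on ((*\<^sub>v) G) (carrier_vec ?m)"
  proof (rule inj_onI)
    fix c c' assume c: "c \<in> carrier_vec ?m" "c' \<in> carrier_vec ?m" "G *\<^sub>v c = G *\<^sub>v c'"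
    have "G *\<^sub>v (c - c') = 0\<^sub>v ?d"
      using c G by (simp add: mult_minus_distrib_mat_vec[OF G] del: add_Suc_right)
    then have "c - c' = 0\<^sub>v ?m" using ker c by simp
    then have "(c - c') $ i = 0" if "i < ?m" for i using that by simp
    then show "c = c'" using c by (intro eq_vecI) auto
  qed
  then obtain R where R: "R \<in> carrier_mat ?m ?d" "R * G = 1\<^sub>m ?m" and d: "?m = ?d"
    using bij_inverse[OF G] surj unfolding bij_betw_def by metis
  show "vdim M = 2 * n + 1" using d by simp
  assume uv: "\<And>i. i < n \<Longrightarrow> u i \<in> carrier_vec e" "\<And>i. i \<le> n \<Longrightarrow> v i \<in> carrier_vec e"
  define F where "F = cols_mat e ?m (\<lambda>i. if i < n then u i else v (i - n))"
  have F: "F \<in> carrier_mat e ?m" by (simp add: F_def del: add_Suc_right)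
  have FR: "(F * R) *\<^sub>v z i = (if i < n then u i else v (i - n))" if i: "i < ?m" for i
  proof -
    have "R *\<^sub>v z i = unit_vec ?m i"
      using assoc_mult_mat_vec[OF R(1) G unit_vec_carrier, of i] Gz[OF i] R(2) by simp
    then have "(F * R) *\<^sub>v z i = F *\<^sub>v unit_vec ?m i"
      using assoc_mult_mat_vec[OF F R(1) zc[OF i]] by simp
    also have "\<dots> = (if i < n then u i else v (i - n))"
      unfolding F_def using i uv by (intro cols_mat_unit) auto
    finally show ?thesis .
  qed
  show "\<exists>f \<in> carrier_mat e ?d. (\<forall>i<n. f *\<^sub>v x i = u i) \<and> (\<forall>i\<le>n. f *\<^sub>v y i = v i)"
  proof (rule bexI[of _ "F * R"], intro conjI allI impI)
    show "F * R \<in> carrier_mat e ?d" using F R(1) by (rule mult_carrier_mat)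
    show "F * R *\<^sub>v x i = u i" if "i < n" for i using FR[of i] that by (simp add: z_def)
    show "F * R *\<^sub>v y i = v i" if "i \<le> n" for i using FR[of "n + i"] that by (simp add: z_def)
  qed
qed

lemma simple_zigzag:
  "zigzag 0 q (simple_module q :: 'k::field rep) (\<lambda>_. 0\<^sub>v 1) (\<lambda>_. unit_vec 1 0)"
  unfolding zigzag_def
proof (intro conjI allI impI)
  show "generates (vdim (simple_module q :: 'k rep)) ((\<lambda>_. 0\<^sub>v 1) ` {..<0::nat} \<union> (\<lambda>_. unit_vec 1 0) ` {..0::nat} :: 'k vec set)"
    using generates_unit_vecs[of 1] by (simp add: lessThan_Suc atMost_0)
  fix \<beta> :: "nat \<Rightarrow> 'k" and i :: nat
  assume *: "lc (vdim (simple_module q :: 'k rep)) (Suc 0) \<beta> (\<lambda>_. unit_vec 1 0) = 0\<^sub>v (vdim (simple_module q :: 'k rep))"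
    and i: "i \<le> 0"
  have "lc 1 (Suc 0) \<beta> (\<lambda>_. unit_vec 1 0) $ 0 = 0" using * by simp
  then show "\<beta> i = 0" using i by (simp add: lc_def)
qed (auto simp: D4_simple homog_def act_simple[unfolded One_nat_def])

section \<open>Injective envelopes of zigzag modules\<close>

lemma zigzag_bc:
  assumes W: "zigzag n q M x y" and v: "v \<in> space M"
  shows "act M gb *\<^sub>v (act M gc *\<^sub>v v) = v"
proof -
  note M = zigzagD(1)[OF W]
  have "subsp (vdim M) {v \<in> space M. act M gb *\<^sub>v (act M gc *\<^sub>v v) = v}"
    by (rule subspI) (auto simp: act_linear[OF M] M)
  moreover have "u \<in> {v \<in> space M. act M gb *\<^sub>v (act M gc *\<^sub>v v) = v}"
    if u: "u \<in> x ` {..<n} \<union> y ` {..n}" for u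
  proof -
    obtain r where "homog M r u" using u zigzagD(2,6)[OF W] by blast
    then show ?thesis using M by (auto simp: homog_def act_linear smult_smult_assoc)
  qed
  ultimately show ?thesis using generatesD[OF zigzagD(10)[OF W] _ _ v] by blast
qed

text \<open>bc is a central involution, so the image of 1 - bc is a submodule on which bc acts as
  -1, whereas bc acts as 1 on the image of \<open>M\<close>. Outside characteristic 2 the two meet
  in 0, and essentiality kills the submodule. From bc = 1 and b b = 1 follows c = b.\<close>

lemma envelope_bc:
  assumes M: "D4_module M" and env: "injective_envelope M I i" and two: "(2::'k::field) \<noteq> 0"
    and bc: "\<And>v. v \<in> space M \<Longrightarrow> act M gb *\<^sub>v (act M gc *\<^sub>v v) = v" and u: "u \<in> space I"
  shows "act I gc *\<^sub>v u = act I gb *\<^sub>v (u :: 'k vec)"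
proof -
  have I: "D4_module I" and i: "module_hom M I i"
    and ess: "\<And>U. is_submodule I U \<Longrightarrow> U \<noteq> {0\<^sub>v (vdim I)} \<Longrightarrow> U \<inter> (*\<^sub>v) i ` space M \<noteq> {0\<^sub>v (vdim I)}"
    using env by (auto simp: injective_envelope_def injective_module_def module_mono_def)
  note i' = module_homD[OF i M I]
  define k where "k w = w - act I gb *\<^sub>v (act I gc *\<^sub>v w)" for w
  have kc: "k w \<in> space I" if "w \<in> space I" for w using that I by (simp add: k_def)
  have k_add: "k v + k w = k (v + w)" if "v \<in> space I" "w \<in> space I" for v w
  proof -
    have e: "(v + w) - (v' + w') = (v - v') + (w - w')"
      if "v \<in> space I" "w \<in> space I" "v' \<in> space I" "w' \<in> space I" for v w v' w' :: "'k vec"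
      using that by (intro eq_vecI) auto
    show ?thesis using that I by (simp add: k_def act_linear e)
  qed
  have k_smult: "c \<cdot>\<^sub>v k w = k (c \<cdot>\<^sub>v w)" if "w \<in> space I" for c w
  proof -
    have "c \<cdot>\<^sub>v (u - v) = c \<cdot>\<^sub>v u - c \<cdot>\<^sub>v v" if "u \<in> space I" "v \<in> space I" for u v
      using that by (intro eq_vecI) (auto simp: algebra_simps)
    then show ?thesis using that I by (simp add: k_def act_linear)
  qed
  have k_act: "act I g *\<^sub>v k w = k (act I g *\<^sub>v w)" if "w \<in> space I" for g w
    using that I by (cases g) (simp_all add: k_def act_linear D4_rels)
  have bck: "act I gb *\<^sub>v (act I gc *\<^sub>v k w) = - k w" if "w \<in> space I" for w
  proof -
    have "act I gb *\<^sub>v (act I gc *\<^sub>v k w) = act I gb *\<^sub>v (act I gc *\<^sub>v w) - w"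
      using that I by (simp add: k_def act_linear D4_rels)
    also have "\<dots> = - k w"
    proof -
      have neg: "v - w = - (w - v)" if "v \<in> space I" "w \<in> space I" for v w :: "'k vec"
        using that by (intro eq_vecI) auto
      show ?thesis unfolding k_def by (rule neg) (use that I in auto)
    qed
    finally show ?thesis .
  qed
  let ?U = "k ` space I"
  have k0: "k (0\<^sub>v (vdim I)) = 0\<^sub>v (vdim I)" using I by (simp add: k_def act_linear)
  have sub: "is_submodule I ?U"
    unfolding is_submodule_def
  proof (intro conjI allI ballI)
    show "0\<^sub>v (vdim I) \<in> ?U" using k0 by (intro image_eqI[of _ _ "0\<^sub>v (vdim I)"]) auto
  qed (use kc I in \<open>auto simp: k_add k_smult k_act\<close>)
  have "?U \<inter> (*\<^sub>v) i ` space M = {0\<^sub>v (vdim I)}"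
  proof (intro equalityI subsetI)
    fix z assume "z \<in> ?U \<inter> (*\<^sub>v) i ` space M"
    then obtain w m where w: "w \<in> space I" "z = k w" and m: "m \<in> space M" "z = i *\<^sub>v m" by blast
    have zc: "z \<in> space I" using kc w by simp
    have "act I gb *\<^sub>v (act I gc *\<^sub>v z) = z"
      using i'(3)[OF m(1), of gc] i'(3)[of "act M gc *\<^sub>v m" gb] bc[OF m(1)] M m by simp
    then have "z = - z" using bck[OF w(1)] w(2) by simp
    then have "z $ j = - (z $ j)" if "j < vdim I" for j
      using that zc by (metis carrier_vecD index_uminus_vec(1))
    then have "2 * z $ j = 0" if "j < vdim I" for j
      using that by (metis add.right_inverse mult_2)
    then have "z = 0\<^sub>v (vdim I)" using two zc by (intro eq_vecI) auto
    then show "z \<in> {0\<^sub>v (vdim I)}" by simp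
  next
    fix z :: "'k vec" assume "z \<in> {0\<^sub>v (vdim I)}"
    then have "z = 0\<^sub>v (vdim I)" by simp
    moreover have "0\<^sub>v (vdim I) \<in> (*\<^sub>v) i ` space M"
      using subspD(2)[OF subsp_image[OF i'(1)]] .
    moreover have "0\<^sub>v (vdim I) \<in> ?U" using sub by (simp add: is_submodule_def)
    ultimately show "z \<in> ?U \<inter> (*\<^sub>v) i ` space M" by simp
  qed
  then have "?U = {0\<^sub>v (vdim I)}" using ess[OF sub] by blast
  then have kz: "k w = 0\<^sub>v (vdim I)" if "w \<in> space I" for w using that by blast
  have "act I gb *\<^sub>v (act I gc *\<^sub>v u) = u - k u"
    using u I by (auto simp: k_def intro!: eq_vecI)
  then have "act I gb *\<^sub>v (act I gc *\<^sub>v u) = u" using kz[OF u] u by simp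
  then have "act I gb *\<^sub>v (act I gb *\<^sub>v (act I gc *\<^sub>v u)) = act I gb *\<^sub>v u" by simp
  then show ?thesis using u I by (simp add: D4_rels)
qed

text \<open>The line through \<open>z\<close> is a submodule, so by essentiality it meets the image
  of \<open>M\<close> nontrivially unless \<open>z\<close> is 0. The degree passes to the preimage
  because \<open>i\<close> is injective.\<close>

lemma envelope_socle:
  assumes M: "D4_module M" and env: "injective_envelope M I i"
    and z: "homog I r z" "act I ga *\<^sub>v z = 0\<^sub>v (vdim I)" "act I gd *\<^sub>v z = 0\<^sub>v (vdim I)"
  obtains m where "homog M r m" "z = i *\<^sub>v (m :: 'k::field vec)"
proof -
  have I: "D4_module I" and i: "module_hom M I i" and inj: "inj_on ((*\<^sub>v) i) (space M)"
    and ess: "\<And>U. is_submodule I U \<Longrightarrow> U \<noteq> {0\<^sub>v (vdim I)} \<Longrightarrow> U \<inter> (*\<^sub>v) i ` space M \<noteq> {0\<^sub>v (vdim I)}"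
    using env by (auto simp: injective_envelope_def injective_module_def module_mono_def)
  note i' = module_homD[OF i M I] and z' = homogD[OF z(1)]
  let ?U = "range (\<lambda>c. c \<cdot>\<^sub>v z)"
  have im: "subsp (vdim I) ((*\<^sub>v) i ` space M)" using subsp_image[OF i'(1)] .
  have "z \<in> (*\<^sub>v) i ` space M"
  proof (cases "z = 0\<^sub>v (vdim I)")
    case True
    then show ?thesis using subspD(2)[OF im] by simp
  next
    case False
    have zero: "0\<^sub>v (vdim I) = 0 \<cdot>\<^sub>v z" using z'(1) by auto
    have "is_submodule I ?U"
      unfolding is_submodule_def
    proof (intro conjI allI ballI)
      show "0\<^sub>v (vdim I) \<in> ?U" unfolding zero by blast
      show "u + v \<in> ?U" if "u \<in> ?U" "v \<in> ?U" for u v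
        using that by (auto simp: add_smult_distrib_vec[symmetric])
      show "c \<cdot>\<^sub>v u \<in> ?U" if "u \<in> ?U" for c u
        using that by (auto simp: smult_smult_assoc)
      show "act I g *\<^sub>v u \<in> ?U" if "u \<in> ?U" for g u
      proof -
        from that obtain c where c: "u = c \<cdot>\<^sub>v z" by (rule rangeE)
        have z0: "c \<cdot>\<^sub>v 0\<^sub>v (vdim I) = 0 \<cdot>\<^sub>v z" 
          unfolding zero[symmetric] by (intro eq_vecI) auto
        show ?thesis
          unfolding c using z' z z0 I by (cases g) (auto simp: act_linear smult_smult_assoc)
      qed
    qed (use z' in auto)
    moreover have "?U \<noteq> {0\<^sub>v (vdim I)}"
      using False by (metis one_smult_vec rangeI singletonD)
    ultimately have "?U \<inter> (*\<^sub>v) i ` space M \<noteq> {0\<^sub>v (vdim I)}" by (rule ess)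
    moreover have "0\<^sub>v (vdim I) \<in> ?U \<inter> (*\<^sub>v) i ` space M"
      using subspD(2)[OF im] zero by auto
    ultimately obtain c where c: "c \<cdot>\<^sub>v z \<in> (*\<^sub>v) i ` space M" "c \<cdot>\<^sub>v z \<noteq> 0\<^sub>v (vdim I)" by blast
    then have "c \<noteq> 0" using zero by auto
    then show ?thesis
      using subspD(4)[OF im c(1), of "inverse c"] by (simp add: smult_smult_assoc)
  qed
  then obtain m where m: "m \<in> space M" "z = i *\<^sub>v m" by blast
  have "act M g *\<^sub>v m = sg r \<cdot>\<^sub>v m" if "act I g *\<^sub>v z = sg r \<cdot>\<^sub>v z" for g
  proof -
    have "i *\<^sub>v (act M g *\<^sub>v m) = i *\<^sub>v (sg r \<cdot>\<^sub>v m)"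
      using that m i'(3) by (simp add: hom_linear[OF i])
    then show ?thesis using inj m M by (auto dest!: inj_onD)
  qed
  then have "homog M r m" using m z' by (simp add: homog_def)
  then show ?thesis using that m by blast
qed

text \<open>The map from \<open>simple_module q\<close> to \<open>I\<close> given by
  \<open>w\<close> extends over the socle inclusion into \<open>P0 q\<close>. Since the socle vector
  of \<open>P0 q\<close> is a d p, the image of p is the required vector.\<close>

lemma injective_extend:
  assumes inj: "injective_module I" and w: "homog I q w"
    "act I ga *\<^sub>v w = 0\<^sub>v (vdim I)" "act I gd *\<^sub>v w = 0\<^sub>v (vdim I)"
  obtains P where "homog I q P" "act I ga *\<^sub>v (act I gd *\<^sub>v P) = (w :: 'k::field vec)"
proof -
  have I: "D4_module I" using inj by (simp add: injective_module_def)
  let ?j = "cols_mat 4 1 (\<lambda>_. unit_vec 4 3) :: 'k mat" and ?g = "cols_mat (vdim I) 1 (\<lambda>_. w)"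
  have "module_hom (simple_module q) I ?g" by (rule simple_hom(1)[OF I w])
  then obtain h where h: "module_hom (P0 q) I h" "h * ?j = ?g"
    using inj D4_simple D4_P0 simple_into_P0(1) unfolding injective_module_def by blast
  note h' = module_homD[OF h(1) D4_P0 I]
  have e0: "homog (P0 q) q (unit_vec 4 0 :: 'k vec)" by (simp add: homog_def act_P0')
  have "act I ga *\<^sub>v (act I gd *\<^sub>v (h *\<^sub>v unit_vec 4 0)) = h *\<^sub>v (act (P0 q) ga *\<^sub>v (act (P0 q) gd *\<^sub>v unit_vec 4 0))"
    using h'(3)[of "unit_vec 4 0" gd] h'(3)[of "unit_vec 4 2" ga] by (simp add: act_P0)
  also have "\<dots> = h *\<^sub>v (?j *\<^sub>v unit_vec 1 0)" by (simp only: act_P0 simple_into_P0(2))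
  also have "\<dots> = (h * ?j) *\<^sub>v unit_vec 1 0"
    by (rule assoc_mult_mat_vec[of _ "vdim I" 4 _ 1, symmetric]) (use h'(1) in auto)
  also have "\<dots> = w" unfolding h(2) by (rule simple_hom(2)[OF I w])
  finally show ?thesis using that hom_homog[OF D4_P0 I h(1) e0] by blast
qed

text \<open>
  In the injective envelope there are \<open>p\<^sub>j\<close> with \<open>a d p\<^sub>j = y\<^sub>j\<close>.  Since \<open>x\<^sub>j - (d p\<^sub>j - a p\<^sub>j\<^sub>+\<^sub>1)\<close> is
  annihilated by \<open>a\<close> and \<open>d\<close> but has the wrong degree to lie in the socle, it vanishes.  Hence
  \<open>d p\<^sub>j\<close> and \<open>a p\<^sub>j\<^sub>+\<^sub>1\<close> agree in the cokernel, which has top \<open>p\<^sub>0, \<dots>, p\<^sub>n\<close> and socle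
  \<open>a p\<^sub>0, d p\<^sub>0, \<dots>, d p\<^sub>n\<close>.
\<close>

lemma cosyzygy_zigzag:
  fixes M C :: "'k::field rep"
  assumes W: "zigzag n q M x y" and cos: "cosyzygy M C" and two: "(2::'k) \<noteq> 0"
  shows "\<exists>x' y'. zigzag (Suc n) (q + 1) C x' y'"
proof -
  note M = zigzagD(1)[OF W]
  obtain I i p where C: "D4_module C" and env: "injective_envelope M I i"
    and epi: "module_epi I C p" and kerp: "mat_kernel p = (*\<^sub>v) i ` space M"
    using cos by (auto simp: cosyzygy_def)
  have inj: "injective_module I" and I: "D4_module I" and i: "module_hom M I i"
    and i_inj: "inj_on ((*\<^sub>v) i) (space M)"
    using env by (auto simp: injective_envelope_def injective_module_def module_mono_def)
  have p: "module_hom I C p" and p_surj: "(*\<^sub>v) p ` space I = space C"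
    using epi by (auto simp: module_epi_def)
  note i' = module_homD[OF i M I] and p' = module_homD[OF p I C]
  let ?A = "\<lambda>v. act I ga *\<^sub>v v" and ?D = "\<lambda>v. act I gd *\<^sub>v v" and ?O = "0\<^sub>v (vdim I)"
  define Y where "Y j = i *\<^sub>v y j" for j
  have Y: "homog I q (Y j)" "Y j \<in> space I" "?A (Y j) = ?O" "?D (Y j) = ?O" if "j < Suc n" for j
    using that hom_homog[OF M I i zigzagD(6)[OF W]] i'(3)[of "y j" ga] i'(3)[of "y j" gd] zigzagD(6-9)[OF W, of j] hom_linear(5)[OF i]
    by (auto simp: Y_def homog_def)
  have bc: "act I gc *\<^sub>v u = act I gb *\<^sub>v u" if "u \<in> space I" for u
    by (rule envelope_bc[OF M env two zigzag_bc[OF W] that])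
  \<comment> \<open>Such a vector comes from \<open>M\<close>, where in degree \<open>q + 1\<close>
    there are only combinations of the \<open>x j\<close>, and a is injective on these.\<close>
  have socle_odd: "z = ?O" if z: "homog I (q + 1) z" "?A z = ?O" "?D z = ?O" for z
  proof -
    obtain m where m: "homog M (q + 1) m" "z = i *\<^sub>v m" using envelope_socle[OF M env z] .
    obtain \<alpha> where \<alpha>: "m = lc (vdim M) n \<alpha> x" using zigzag_homog(1)[OF W two m(1)] by blast
    have mc: "m \<in> space M" using homogD(1)[OF m(1)] .
    have "i *\<^sub>v (act M ga *\<^sub>v m) = i *\<^sub>v 0\<^sub>v (vdim M)"
      using i'(3)[OF mc, of ga] z(2) m(2) hom_linear(5)[OF i] by simp
    then have "act M ga *\<^sub>v m = 0\<^sub>v (vdim M)" using i_inj mc M by (auto dest!: inj_onD)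
    then have "m = 0\<^sub>v (vdim M)" using zigzag_x_independent[OF W] lc_zero_coeff unfolding \<alpha> by metis
    then show ?thesis using m(2) hom_linear(5)[OF i] by simp
  qed
  have socle_even: "\<exists>\<beta>. z = lc (vdim I) (Suc n) \<beta> Y" if z: "homog I q z" "?A z = ?O" "?D z = ?O" for z
  proof -
    obtain m where m: "homog M q m" "z = i *\<^sub>v m" using envelope_socle[OF M env z] .
    then obtain \<beta> where \<beta>: "m = lc (vdim M) (Suc n) \<beta> y" using zigzag_homog(2)[OF W two] by blast
    have "z = lc (vdim I) (Suc n) \<beta> (\<lambda>j. i *\<^sub>v y j)"
      unfolding m(2) \<beta> by (rule mult_mat_vec_lc[OF i'(1)]) (simp add: zigzagD(7)[OF W])
    then show ?thesis unfolding Y_def by blast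
  qed
  have "\<exists>P. homog I q P \<and> ?A (?D P) = Y j" if "j < Suc n" for j
    using injective_extend[OF inj Y(1)[OF that] Y(3,4)[OF that]] by blast
  then obtain P where P: "homog I q (P j)" "?A (?D (P j)) = Y j" if "j < Suc n" for j
    by metis
  have Pc: "P j \<in> space I" "?A (P j) \<in> space I" "?D (P j) \<in> space I" if "j < Suc n" for j
    using homogD(1)[OF P(1)[OF that]] I by auto
  have AP: "homog I (q + 1) (?A (P j))" and DP: "homog I (q + 1) (?D (P j))"
    and DAP: "?D (?A (P j)) = - Y j" if "j < Suc n" for j
    using homog_act[OF I P(1)[OF that]] P(2)[OF that] by simp_all
  have ix: "i *\<^sub>v x j = ?D (P j) - ?A (P (Suc j))" if j: "j < n" for j
  proof -
    have jj: "j < Suc n" "Suc j < Suc n" using j by auto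
    have ixh: "homog I (q + 1) (i *\<^sub>v x j)" using hom_homog[OF M I i zigzagD(2)[OF W j]] .
    note ixc = homogD(1)[OF ixh]
    have e: "?A (i *\<^sub>v x j) = Y j" "?D (i *\<^sub>v x j) = Y (Suc j)"
      using i'(3)[OF zigzagD(3)[OF W j], of ga] i'(3)[OF zigzagD(3)[OF W j], of gd] zigzagD(4,5)[OF W j]
      by (simp_all add: Y_def)
    define w where "w = ?D (P j) - ?A (P (Suc j))"
    have wh: "homog I (q + 1) w" unfolding w_def by (intro homog_subtract I DP AP jj)
    note wc = homogD(1)[OF wh]
    have "?O - - v = v" if "v \<in> space I" for v
      using that by (intro eq_vecI) auto
    then have w: "?A w = Y j" "?D w = Y (Suc j)"
      using jj Pc[of j] Pc[of "Suc j"] Y(2) I by (simp_all add: w_def act_linear D4_rels(1,2) P DAP)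
    have "homog I (q + 1) (i *\<^sub>v x j - w)" by (intro homog_subtract I ixh wh)
    moreover have "?A (i *\<^sub>v x j - w) = Y j - Y j" "?D (i *\<^sub>v x j - w) = Y (Suc j) - Y (Suc j)"
      by (simp_all only: act_linear(2)[OF I ixc wc] e w)
    ultimately have "i *\<^sub>v x j - w = ?O" using Y(2) jj by (rule_tac socle_odd) simp_all
    then show ?thesis using ixc wc unfolding w_def by (rule_tac diff_zero_vecD)
  qed
  \<comment> \<open>The listed vectors span \<open>I\<close>. A vector of pure degree is reduced
    modulo them by comparing what a, d and ad do to it; an arbitrary one is split into its two
    degrees.\<close>
  have gen: "u \<in> U" if U: "subsp (vdim I) U" and PU: "\<And>j. j < Suc n \<Longrightarrow> P j \<in> U"
    "\<And>j. j < Suc n \<Longrightarrow> ?A (P j) \<in> U" "\<And>j. j < Suc n \<Longrightarrow> ?D (P j) \<in> U" "\<And>j. j < Suc n \<Longrightarrow> Y j \<in> U"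
    and u: "u \<in> space I" for u U
  proof -
    let ?L = "\<lambda>\<beta> v. lc (vdim I) (Suc n) \<beta> v"
    have op: "act I g *\<^sub>v ?L \<beta> v = ?L \<beta> (\<lambda>j. act I g *\<^sub>v v j)" if "\<And>j. j < Suc n \<Longrightarrow> v j \<in> space I" for g \<beta> v
      by (rule mult_mat_vec_lc[OF act_carrier[OF I] that])
    \<comment> \<open>Subtracting a combination of the \<open>P j\<close> with the same image under
      ad leaves \<open>w\<close> with ad w = 0. Then a w and d w are socle vectors of degree
      \<open>q + 1\<close>, hence 0, so \<open>w\<close> lies in the socle and is a combination of
      the \<open>Y j\<close>.\<close>
    have even: "u \<in> U" if u: "homog I q u" for u
    proof -
      note uc = homogD(1)[OF u]
      have "homog I q (?A (?D u))"
        using homog_act(1)[OF I homog_act(2)[OF I u]] by (simp only: bit_add_1_1)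
      moreover have "?D (?A (?D u)) = ?O"
        using homog_act(3)[OF I homog_act(2)[OF I u]] I uc by (simp add: D4_rels(2) act_linear)
      moreover have "?A (?A (?D u)) = ?O" using I uc by (simp add: D4_rels(1))
      ultimately obtain \<beta> where \<beta>: "?A (?D u) = ?L \<beta> Y" using socle_even by blast
      define w where "w = u - ?L \<beta> P"
      have wh: "homog I q w" unfolding w_def by (intro homog_subtract I u homog_lc P)
      note wc = homogD(1)[OF wh]
      have "?A (?D (?L \<beta> P)) = ?L \<beta> (\<lambda>j. ?A (?D (P j)))" using Pc by (simp add: op)
      also have "\<dots> = ?L \<beta> Y" by (intro lc_cong P)
      finally have ADw: "?A (?D w) = ?O" using uc I \<beta> by (simp add: w_def act_linear)
      have Aw: "?A w = ?O"
        using homog_act[OF I wh] ADw I wc by (rule_tac socle_odd) (simp_all add: D4_rels(1))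
      have "?D w = ?O"
        using homog_act[OF I wh] ADw I wc by (rule_tac socle_odd) (simp_all add: D4_rels(2))
      then obtain \<gamma> where "w = ?L \<gamma> Y" using socle_even[OF wh Aw] by blast
      then have "w \<in> U" using lc_in_subsp[OF U PU(4)] by simp
      then show ?thesis using subsp_cancel[OF U, of u "?L \<beta> P"] lc_in_subsp[OF U PU(1)] uc by (simp add: w_def)
    qed
    \<comment> \<open>Now ad u is a socle vector of degree \<open>q + 1\<close>, hence 0. So a u and
      d u are socle vectors of degree \<open>q\<close>, that is, combinations of the
      \<open>Y j\<close>.\<close>
    have odd: "u \<in> U" if u: "homog I (q + 1) u" for u
    proof -
      note uc = homogD(1)[OF u]
      have "homog I (q + 1) (?A (?D u))"
        using homog_act(1)[OF I homog_act(2)[OF I u]] by (simp only: bit_add_1_1)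
      moreover have "?D (?A (?D u)) = ?O"
        using homog_act(3)[OF I homog_act(2)[OF I u]] I uc by (simp add: D4_rels(2) act_linear)
      ultimately have ADu: "?A (?D u) = ?O" using I uc by (rule_tac socle_odd) (simp_all add: D4_rels(1))
      have "homog I q (?A u)" "homog I q (?D u)"
        using homog_act(1,2)[OF I u] by (simp_all only: bit_add_1_1)
      moreover have "?D (?A u) = ?O" using homog_act(3)[OF I u] ADu by simp
      ultimately obtain \<beta> \<gamma> where \<beta>: "?A u = ?L \<beta> Y" "?D u = ?L \<gamma> Y"
        using socle_even ADu I uc D4_rels(1,2) by metis
      \<comment> \<open>Because ad sends \<open>P j\<close> to \<open>Y j\<close> and da sends it to
        - \<open>Y j\<close>, this \<open>v\<close> has the same images under a and d as
        \<open>u\<close>; the minus sign makes up for the anticommutation.\<close>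
      define v where "v = ?L \<beta> (\<lambda>j. ?D (P j)) - ?L \<gamma> (\<lambda>j. ?A (P j))"
      have vU: "v \<in> U" unfolding v_def by (intro subsp_diff[OF U] lc_in_subsp[OF U] PU)
      have zero: "?L \<delta> (\<lambda>j. ?O) = ?O" for \<delta> by (intro eq_vecI) (auto simp: lc_def)
      have neg: "?L \<delta> (\<lambda>j. - Y j) = - ?L \<delta> Y" for \<delta>
        by (rule eq_vecI) (use carrier_vecD[OF Y(2)] in \<open>auto simp: lc_def sum_negf[symmetric] simp del: sum.lessThan_Suc intro!: sum.cong\<close>)
      have "?A v = ?L \<beta> (\<lambda>j. ?A (?D (P j))) - ?L \<gamma> (\<lambda>j. ?A (?A (P j)))"
        unfolding v_def using Pc I by (simp add: act_linear op)
      also have "?L \<beta> (\<lambda>j. ?A (?D (P j))) = ?L \<beta> Y" by (intro lc_cong P)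
      also have "?L \<gamma> (\<lambda>j. ?A (?A (P j))) = ?L \<gamma> (\<lambda>j. ?O)" by (intro lc_cong D4_rels I Pc)
      finally have Av: "?A v = ?A u" using \<beta>(1) by (simp add: zero)
      have "?D v = ?L \<beta> (\<lambda>j. ?D (?D (P j))) - ?L \<gamma> (\<lambda>j. ?D (?A (P j)))"
        unfolding v_def using Pc I by (simp add: act_linear op)
      also have "?L \<beta> (\<lambda>j. ?D (?D (P j))) = ?L \<beta> (\<lambda>j. ?O)" by (intro lc_cong D4_rels I Pc)
      also have "?L \<gamma> (\<lambda>j. ?D (?A (P j))) = ?L \<gamma> (\<lambda>j. - Y j)" by (intro lc_cong DAP)
      finally have Dv: "?D v = ?D u" using \<beta>(2) by (simp add: zero neg)
      have vh: "homog I (q + 1) v" unfolding v_def by (intro homog_subtract I homog_lc AP DP)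
      have "u - v = ?O"
        using Av Dv uc homogD(1)[OF vh] I
        by (rule_tac socle_odd[OF homog_subtract[OF I u vh]]) (simp_all add: act_linear)
      then show ?thesis using subsp_cancel[OF U _ vU uc] subspD(2)[OF U] by simp
    qed
    \<comment> \<open>As b = c on \<open>I\<close>, every vector is half the sum of u + sg q b u and
      u - sg q b u, which have the degrees \<open>q\<close> and \<open>q + 1\<close>.\<close>
    define B where "B = act I gb *\<^sub>v u"
    have B: "B \<in> space I" "act I gb *\<^sub>v u = B" "act I gb *\<^sub>v B = u" "act I gc *\<^sub>v u = B" "act I gc *\<^sub>v B = u"
      using u I bc[OF u] bc[of B] by (simp_all add: B_def D4_rels)
    have "B + sg q \<cdot>\<^sub>v u = sg q \<cdot>\<^sub>v (u + sg q \<cdot>\<^sub>v B)" "B - sg q \<cdot>\<^sub>v u = - sg q \<cdot>\<^sub>v (u - sg q \<cdot>\<^sub>v B)"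
      using u B(1) by (auto intro!: eq_vecI simp: algebra_simps)
    then have h1: "homog I q (u + sg q \<cdot>\<^sub>v B)" and h2: "homog I (q + 1) (u - sg q \<cdot>\<^sub>v B)"
      unfolding homog_def sg_add_1 using u B I by (simp_all add: act_linear)
    have "inverse 2 \<cdot>\<^sub>v ((u + sg q \<cdot>\<^sub>v B) + (u - sg q \<cdot>\<^sub>v B)) \<in> U"
      using subspD(4)[OF U subspD(3)[OF U even[OF h1] odd[OF h2]]] .
    also have "inverse 2 \<cdot>\<^sub>v ((u + sg q \<cdot>\<^sub>v B) + (u - sg q \<cdot>\<^sub>v B)) = u"
      using u B(1) two by (intro eq_vecI) auto
    finally show ?thesis .
  qed
  \<comment> \<open>The socle vectors of the cokernel before projection. Besides the d
    \<open>P j\<close> only a \<open>P 0\<close> is listed, because a \<open>P (Suc j)\<close> and d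
    \<open>P j\<close> have the same image.\<close>
  define Y' where "Y' j = (case j of 0 \<Rightarrow> ?A (P 0) | Suc j' \<Rightarrow> ?D (P j'))" for j
  have Y'_simps: "Y' 0 = ?A (P 0)" "Y' (Suc j) = ?D (P j)" for j by (simp_all add: Y'_def)
  have Y'h: "homog I (q + 1) (Y' j)" if "j < Suc (Suc n)" for j
    using that AP DP by (cases j) (auto simp: Y'_simps)
  note Y'c = homogD(1)[OF Y'h]
  have p_ker: "p *\<^sub>v v = 0\<^sub>v (vdim C)" if "v \<in> (*\<^sub>v) i ` space M" for v
    using that kerp mat_kernelD(2)[OF p'(1)] by auto
  have pY: "p *\<^sub>v Y j = 0\<^sub>v (vdim C)" if "j < Suc n" for j
    using that zigzagD(7)[OF W] by (intro p_ker) (auto simp: Y_def)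
  have pDA: "p *\<^sub>v ?A (P (Suc k)) = p *\<^sub>v ?D (P k)" if k: "k < n" for k
  proof -
    have "p *\<^sub>v (i *\<^sub>v x k) = 0\<^sub>v (vdim C)" using zigzagD(3)[OF W k] by (intro p_ker) auto
    then have e: "p *\<^sub>v ?D (P k) - p *\<^sub>v ?A (P (Suc k)) = 0\<^sub>v (vdim C)"
      using ix[OF k] Pc[of k] Pc[of "Suc k"] k by (simp add: hom_linear[OF p])
    show ?thesis
      by (rule diff_zero_vecD[OF e, symmetric]) (use p'(2) Pc k in simp_all)
  qed
  let ?x' = "\<lambda>j. p *\<^sub>v P j" and ?y' = "\<lambda>j. p *\<^sub>v Y' j"
  have "zigzag (Suc n) (q + 1) C ?x' ?y'"
    unfolding zigzag_def
  proof (intro conjI allI impI C)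
    fix j assume j: "j < Suc n"
    have "homog C q (p *\<^sub>v P j)" by (rule hom_homog[OF I C p P(1)[OF j]])
    then show "homog C (q + 1 + 1) (p *\<^sub>v P j)" by (simp only: bit_add_1_1)
    show "act C gd *\<^sub>v (p *\<^sub>v P j) = p *\<^sub>v Y' (Suc j)"
      using p'(3)[OF Pc(1)[OF j], of gd] by (simp add: Y'_simps)
    show "act C ga *\<^sub>v (p *\<^sub>v P j) = p *\<^sub>v Y' j"
    proof (cases j)
      case 0
      then show ?thesis using p'(3)[OF Pc(1)[OF j], of ga] by (simp add: Y'_simps)
    next
      case (Suc k)
      then have "k < n" using j by simp
      then show ?thesis
        using p'(3)[OF Pc(1)[OF j], of ga] pDA[of k] Suc by (simp add: Y'_simps)
    qed
  next
    fix j assume "j \<le> Suc n"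
    then have j: "j < Suc (Suc n)" by simp
    show "homog C (q + 1) (p *\<^sub>v Y' j)" by (rule hom_homog[OF I C p Y'h[OF j]])
    have "p *\<^sub>v ?A (Y' j) = 0\<^sub>v (vdim C)" "p *\<^sub>v ?D (Y' j) = 0\<^sub>v (vdim C)"
      using j pY I Pc P(2) DAP Y(2) hom_linear(4,5)[OF p]
      by (cases j; auto simp: Y'_simps D4_rels(1,2))+
    then show "act C ga *\<^sub>v (p *\<^sub>v Y' j) = 0\<^sub>v (vdim C)" "act C gd *\<^sub>v (p *\<^sub>v Y' j) = 0\<^sub>v (vdim C)"
      using p'(3)[OF Y'c[OF j]] by simp_all
  next
    show "generates (vdim C) (?x' ` {..<Suc n} \<union> ?y' ` {..Suc n})"
      unfolding generates_def
    proof (intro conjI allI impI subsetI)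
      fix v assume "v \<in> ?x' ` {..<Suc n} \<union> ?y' ` {..Suc n}"
      then show "v \<in> space C" using p'(2) Pc Y'c by auto
    next
      fix U v assume U: "subsp (vdim C) U \<and> ?x' ` {..<Suc n} \<union> ?y' ` {..Suc n} \<subseteq> U" and v: "v \<in> space C"
      then have s: "subsp (vdim C) U" and x': "\<And>j. j < Suc n \<Longrightarrow> ?x' j \<in> U" and y': "\<And>j. j < Suc (Suc n) \<Longrightarrow> ?y' j \<in> U"
        by (auto simp: less_Suc_eq_le[symmetric])
      obtain u where u: "u \<in> space I" "v = p *\<^sub>v u" using v p_surj by auto
      \<comment> \<open>The preimage of \<open>U\<close> under \<open>p\<close> contains the
        spanning family of \<open>I\<close>: the \<open>Y j\<close> because \<open>p\<close> kills
        them, the a \<open>P (Suc k)\<close> because they agree with d \<open>P k\<close> in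
        \<open>C\<close>.\<close>
      have "u \<in> {v \<in> space I. p *\<^sub>v v \<in> U}"
      proof (rule gen[OF subsp_vimage[OF p'(1) s] _ _ _ _ u(1)])
        fix j assume j: "j < Suc n"
        show "P j \<in> {v \<in> space I. p *\<^sub>v v \<in> U}" using x' Pc j by simp
        show "?D (P j) \<in> {v \<in> space I. p *\<^sub>v v \<in> U}" using y'[of "Suc j"] Pc j by (simp add: Y'_simps)
        show "Y j \<in> {v \<in> space I. p *\<^sub>v v \<in> U}" using pY Y subspD(2)[OF s] j by simp
        have "p *\<^sub>v ?A (P j) \<in> U"
        proof (cases j)
          case 0
          then show ?thesis using y'[of 0] by (simp add: Y'_simps)
        next
          case (Suc k)
          then show ?thesis using pDA[of k] y'[of "Suc k"] j by (simp add: Y'_simps)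
        qed
        then show "?A (P j) \<in> {v \<in> space I. p *\<^sub>v v \<in> U}" using Pc j by simp
      qed
      then show "v \<in> U" using u by simp
    qed
  next
    fix \<beta> j assume "lc (vdim C) (Suc (Suc n)) \<beta> ?y' = 0\<^sub>v (vdim C)" and j: "j \<le> Suc n"
    \<comment> \<open>Lift the relation to \<open>I\<close>: \<open>z\<close> lies in the image of
      \<open>M\<close> and has degree \<open>q + 1\<close>, so it is the image of a combination of
      the \<open>x j\<close>, with coefficients \<open>\<mu>\<close>. Applying a and d to both
      descriptions yields equations that force all coefficients to vanish.\<close>
    define z where "z = lc (vdim I) (Suc (Suc n)) \<beta> Y'"
    have zh: "homog I (q + 1) z" unfolding z_def by (intro homog_lc I Y'h)
    note zc = homogD(1)[OF zh]
    have "p *\<^sub>v z = 0\<^sub>v (vdim C)"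
      unfolding z_def using \<open>lc _ _ \<beta> ?y' = _\<close> Y'c by (simp add: mult_mat_vec_lc[OF p'(1)])
    then have "z \<in> (*\<^sub>v) i ` space M" using mat_kernelI[OF p'(1) zc] kerp by simp
    then obtain m where m: "m \<in> space M" "z = i *\<^sub>v m" by auto
    have "act M g *\<^sub>v m = sg (q + 1) \<cdot>\<^sub>v m" if "act I g *\<^sub>v z = sg (q + 1) \<cdot>\<^sub>v z" for g
    proof -
      have "i *\<^sub>v (act M g *\<^sub>v m) = i *\<^sub>v (sg (q + 1) \<cdot>\<^sub>v m)"
        using that m i'(3)[OF m(1), of g] hom_linear(3)[OF i m(1)] by metis
      then show ?thesis using i_inj m M by (auto dest!: inj_onD)
    qed
    then have "homog M (q + 1) m" using m homogD[OF zh] by (simp add: homog_def)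
    then obtain \<mu> where \<mu>: "m = lc (vdim M) n \<mu> x" using zigzag_homog(1)[OF W two] by blast
    let ?e = "vdim M"
    have i_eq: "v = w" if "i *\<^sub>v v = i *\<^sub>v w" "v \<in> space M" "w \<in> space M" for v w
      using that i_inj by (auto dest!: inj_onD)
    have iy: "i *\<^sub>v lc ?e k \<gamma> v = lc (vdim I) k \<gamma> (\<lambda>j. i *\<^sub>v v j)" if "\<And>j. j < k \<Longrightarrow> v j \<in> space M" for k \<gamma> v
      by (rule mult_mat_vec_lc[OF i'(1) that])
    have op: "act I g *\<^sub>v z = lc (vdim I) (Suc (Suc n)) \<beta> (\<lambda>j. act I g *\<^sub>v Y' j)" for g
      unfolding z_def by (rule mult_mat_vec_lc[OF act_carrier[OF I] Y'c])
    have im: "act I g *\<^sub>v z = i *\<^sub>v lc ?e n \<mu> (\<lambda>j. act M g *\<^sub>v x j)" for g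
      using i'(3)[OF m(1), of g] mult_mat_vec_lc[OF act_carrier[OF M], of n x g \<mu>] zigzagD(3)[OF W] m(2)
      by (simp add: \<mu>)
    have zero: "lc (vdim I) k \<delta> (\<lambda>j. ?O) = ?O" for \<delta> k by (intro eq_vecI) (auto simp: lc_def)
    \<comment> \<open>a kills the first term and sends the others to the \<open>Y j\<close>;
      comparison gives \<open>\<beta> (Suc j) = \<mu> j\<close> for j < n and
      \<open>\<beta> (Suc n) = 0\<close>.\<close>
    have "?A z = \<beta> 0 \<cdot>\<^sub>v ?A (Y' 0) + lc (vdim I) (Suc n) (\<lambda>j. \<beta> (Suc j)) (\<lambda>j. ?A (Y' (Suc j)))"
      unfolding op by (rule lc_Suc_shift) (use Y'c[of 0] I in simp)
    also have "lc (vdim I) (Suc n) (\<lambda>j. \<beta> (Suc j)) (\<lambda>j. ?A (Y' (Suc j))) = lc (vdim I) (Suc n) (\<lambda>j. \<beta> (Suc j)) Y"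
      by (intro lc_cong) (simp add: Y'_simps P)
    also have "?A (Y' 0) = ?O" using I Pc by (simp add: Y'_simps D4_rels)
    finally have "?A z = i *\<^sub>v lc ?e (Suc n) (\<lambda>j. \<beta> (Suc j)) y"
      using iy[of "Suc n" y] zigzagD(7)[OF W] by (simp add: Y_def[abs_def] smult_zero_vec)
    moreover have "?A z = i *\<^sub>v lc ?e n \<mu> y"
      unfolding im by (intro arg_cong[where f = "(*\<^sub>v) i"] lc_cong zigzagD(4)[OF W])
    ultimately have "lc ?e (Suc n) (\<lambda>j. \<beta> (Suc j)) y = lc ?e n \<mu> y" by (rule_tac i_eq) auto
    also have "\<dots> = lc ?e (Suc n) (\<lambda>j. if j < n then \<mu> j else 0) y" by (intro lc_extend) simp
    finally have "lc ?e (Suc n) (\<lambda>j. \<beta> (Suc j) - (if j < n then \<mu> j else 0)) y = 0\<^sub>v ?e"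
      by (simp flip: lc_diff)
    then have \<beta>1: "\<beta> (Suc j) = (if j < n then \<mu> j else 0)" if "j \<le> n" for j
      using zigzagD(11)[OF W _ that] by fastforce
    \<comment> \<open>d keeps only the first term, which becomes \<open>- \<beta> 0\<close> times
      \<open>Y 0\<close>, while the other description involves only the images of \<open>y 1\<close>
      to \<open>y n\<close>.\<close>
    have "?D z = \<beta> 0 \<cdot>\<^sub>v ?D (Y' 0) + lc (vdim I) (Suc n) (\<lambda>j. \<beta> (Suc j)) (\<lambda>j. ?D (Y' (Suc j)))"
      unfolding op by (rule lc_Suc_shift) (use Y'c[of 0] I in simp)
    also have "lc (vdim I) (Suc n) (\<lambda>j. \<beta> (Suc j)) (\<lambda>j. ?D (Y' (Suc j))) = lc (vdim I) (Suc n) (\<lambda>j. \<beta> (Suc j)) (\<lambda>j. ?O)"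
      by (intro lc_cong) (simp add: Y'_simps D4_rels I Pc)
    also have "?D (Y' 0) = - Y 0" by (simp add: Y'_simps DAP)
    also have "\<beta> 0 \<cdot>\<^sub>v - Y 0 + lc (vdim I) (Suc n) (\<lambda>j. \<beta> (Suc j)) (\<lambda>j. ?O) = (- \<beta> 0) \<cdot>\<^sub>v Y 0"
      unfolding zero using Y(2)[of 0] by (auto intro!: eq_vecI)
    finally have "?D z = i *\<^sub>v ((- \<beta> 0) \<cdot>\<^sub>v y 0)"
      using zigzagD(7)[OF W, of 0] by (simp add: Y_def hom_linear[OF i])
    moreover have "?D z = i *\<^sub>v lc ?e n \<mu> (\<lambda>j. y (Suc j))"
      unfolding im by (intro arg_cong[where f = "(*\<^sub>v) i"] lc_cong zigzagD(5)[OF W])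
    ultimately have e: "(- \<beta> 0) \<cdot>\<^sub>v y 0 = lc ?e n \<mu> (\<lambda>j. y (Suc j))"
      using zigzagD(7)[OF W, of 0] by (rule_tac i_eq) auto
    \<comment> \<open>The equation from d says that the combination of \<open>y 0\<close> to
      \<open>y n\<close> with coefficients \<open>\<beta> 0\<close>, \<open>\<mu> 0\<close>,
      \<open>\<mu> 1\<close> and so on is zero; hence they all vanish.\<close>
    have "lc ?e (Suc n) (\<lambda>j. case j of 0 \<Rightarrow> \<beta> 0 | Suc j \<Rightarrow> \<mu> j) y = \<beta> 0 \<cdot>\<^sub>v y 0 + lc ?e n \<mu> (\<lambda>j. y (Suc j))"
      by (subst lc_Suc_shift) (use zigzagD(7)[OF W, of 0] in simp_all)
    also have "\<dots> = 0\<^sub>v ?e" unfolding e[symmetric] using zigzagD(7)[OF W, of 0] by (auto intro!: eq_vecI)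
    finally have \<mu>0: "(case k of 0 \<Rightarrow> \<beta> 0 | Suc k \<Rightarrow> \<mu> k) = 0" if "k \<le> n" for k
      using zigzagD(11)[OF W _ that] by blast
    show "\<beta> j = 0"
    proof (cases j)
      case 0
      then show ?thesis using \<mu>0[of 0] by simp
    next
      case (Suc k)
      then show ?thesis using \<beta>1[of k] \<mu>0[of "Suc k"] j by (auto split: if_splits)
    qed
  qed
  then show ?thesis by blast
qed

text \<open>Each step lengthens the zigzag by one and moves the socle into the other degree, whence
  the shift by \<open>of_nat s\<close> modulo 2.\<close>

lemma cosyzygy_power_zigzag:
  fixes M :: "'k::field rep"
  assumes "(cosyzygy ^^ s) (simple_module r) M" and two: "(2::'k) \<noteq> 0"
  shows "\<exists>x y. zigzag s (r + of_nat s) M x y"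
  using assms(1)
proof (induction s arbitrary: M)
  case 0
  then show ?case using simple_zigzag[of r] by auto
next
  case (Suc s)
  then obtain L where "(cosyzygy ^^ s) (simple_module r) L" "cosyzygy L M" by auto
  moreover from this obtain x y where "zigzag s (r + of_nat s) L x y" using Suc.IH by blast
  moreover have "r + of_nat (Suc s) = r + of_nat s + 1" by (simp only: of_nat_Suc ac_simps)
  ultimately show ?case using cosyzygy_zigzag[OF _ _ two] by metis
qed

section \<open>Direct sums\<close>

lemma vdim_direct_sum [simp]: "vdim (M \<oplus>\<^sub>D N) = vdim M + vdim N"
  by (simp add: direct_sum_def)

lemma act_direct_sum:
  assumes "D4_module M" "D4_module N" "u \<in> space M" "v \<in> space N"
  shows "act (M \<oplus>\<^sub>D N) g *\<^sub>v (u @\<^sub>v v) = (act M g *\<^sub>v u) @\<^sub>v (act N g *\<^sub>v v)"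
  unfolding direct_sum_def using assms
  by (simp add: zero_mult_mat_vec four_block_mat_mult_vec[OF act_carrier[OF assms(1)] zero_carrier_mat zero_carrier_mat
        act_carrier[OF assms(2)] assms(3,4)])

lemma act_direct_sum_carrier:
  "D4_module M \<Longrightarrow> D4_module N \<Longrightarrow> act (M \<oplus>\<^sub>D N) g \<in> carrier_mat (vdim M + vdim N) (vdim M + vdim N)"
  unfolding direct_sum_def by (simp add: act_carrier)

lemma generates_append:
  "generates (m + n) {u @\<^sub>v v | u v. u \<in> carrier_vec m \<and> v \<in> (carrier_vec n :: 'k::field vec set)}"
proof -
  have "w \<in> {u @\<^sub>v v | u v. u \<in> carrier_vec m \<and> v \<in> (carrier_vec n :: 'k vec set)}"
    if "w \<in> carrier_vec (m + n)" for w
    using that vec_first_last_append[of w m n] vec_first_carrier vec_last_carrier by (metis (mono_tags, lifting) mem_Collect_eq)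
  then show ?thesis unfolding generates_def by auto
qed

lemma D4_direct_sum:
  assumes M: "D4_module M" and N: "D4_module (N :: 'k::field rep)"
  shows "D4_module (M \<oplus>\<^sub>D N)"
proof -
  have z: "0\<^sub>v (vdim M + vdim N) = 0\<^sub>v (vdim M) @\<^sub>v (0\<^sub>v (vdim N) :: 'k vec)"
    by (intro eq_vecI) auto
  have n: "- (u @\<^sub>v v) = (- u) @\<^sub>v (- v)" for u v :: "'k vec"
    by (intro eq_vecI) auto
  have a: "(u @\<^sub>v v) + (u' @\<^sub>v v') = (u + u') @\<^sub>v (v + v')" "(u @\<^sub>v v) - (u' @\<^sub>v v') = (u - u') @\<^sub>v (v - v')"
    if "u \<in> space M" "u' \<in> space M" "v \<in> space N" "v' \<in> space N" for u v u' v' :: "'k vec"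
    using that by (auto intro!: eq_vecI)
  have e: "(v - w) - x + x = v - w" if "v \<in> space K" "w \<in> space K" "x \<in> space K" for v w x :: "'k vec" and K :: "'k rep"
    using that by (intro eq_vecI) auto
  have i: "- (- v) = v" for v :: "'k vec" by simp
  show ?thesis
    by (rule D4_moduleI[where S = "{u @\<^sub>v v | u v. u \<in> space M \<and> v \<in> space N}"])
      (use M N in \<open>auto simp: act_direct_sum_carrier generates_append
        act_direct_sum D4_rels z n a e i simp del: uminus_uminus_vec\<close>)
qed

lemma direct_sum_hom:
  assumes M: "D4_module M" and N: "D4_module N" and C: "D4_module (C :: 'k::field rep)"
    and f: "module_hom M C f" and g: "module_hom N C g"
  obtains h where "module_hom (M \<oplus>\<^sub>D N) C h"
    "\<forall>u\<in>space M. \<forall>v\<in>space N. h *\<^sub>v (u @\<^sub>v v) = f *\<^sub>v u + g *\<^sub>v v"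
proof -
  note f' = module_homD[OF f M C] and g' = module_homD[OF g N C]
  have cols: "lc (vdim C) m (($) w) (col k) = k *\<^sub>v w" if "k \<in> carrier_mat (vdim C) m" "w \<in> carrier_vec m" for m k and w :: "'k vec"
    using that by (intro eq_vecI) (auto simp: lc_def scalar_prod_def mult.commute atLeast0LessThan intro!: sum.cong)
  \<comment> \<open>The block matrix with the columns of \<open>f\<close> followed by those of
    \<open>g\<close>.\<close>
  define z where "z j = (if j < vdim M then col f j else col g (j - vdim M))" for j
  define h where "h = cols_mat (vdim C) (vdim M + vdim N) z"
  have h: "h *\<^sub>v (u @\<^sub>v v) = f *\<^sub>v u + g *\<^sub>v v" if "u \<in> space M" "v \<in> space N" for u v
  proof -
    have "h *\<^sub>v (u @\<^sub>v v) = lc (vdim C) (vdim M + vdim N) (($) (u @\<^sub>v v)) z"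
      unfolding h_def using that by (intro cols_mat_mult) simp
    also have "\<dots> = lc (vdim C) (vdim M) (($) (u @\<^sub>v v)) z
        + lc (vdim C) (vdim N) (\<lambda>i. (u @\<^sub>v v) $ (vdim M + i)) (\<lambda>i. z (vdim M + i))"
      by (rule lc_split)
    also have "lc (vdim C) (vdim M) (($) (u @\<^sub>v v)) z = lc (vdim C) (vdim M) (($) u) (col f)"
      using that by (auto simp: lc_def z_def intro!: eq_vecI sum.cong)
    also have "lc (vdim C) (vdim N) (\<lambda>i. (u @\<^sub>v v) $ (vdim M + i)) (\<lambda>i. z (vdim M + i))
        = lc (vdim C) (vdim N) (($) v) (col g)"
      using that by (auto simp: lc_def z_def intro!: eq_vecI sum.cong)
    finally show ?thesis using cols[OF f'(1) that(1)] cols[OF g'(1) that(2)] by simp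
  qed
  have "module_hom (M \<oplus>\<^sub>D N) C h"
  proof (rule module_homI[OF D4_direct_sum[OF M N] C])
    show "h \<in> carrier_mat (vdim C) (vdim (M \<oplus>\<^sub>D N))" by (simp add: h_def)
    show "generates (vdim (M \<oplus>\<^sub>D N)) {u @\<^sub>v v | u v. u \<in> space M \<and> v \<in> space N}"
      by (simp add: generates_append)
    fix k w assume "w \<in> {u @\<^sub>v v | u v. u \<in> space M \<and> v \<in> space N}"
    then obtain u v where "u \<in> space M" "v \<in> space N" "w = u @\<^sub>v v" by blast
    then show "h *\<^sub>v (act (M \<oplus>\<^sub>D N) k *\<^sub>v w) = act C k *\<^sub>v (h *\<^sub>v w)"
      using M N C by (simp add: act_direct_sum h f' g' act_linear)
  qed
  then show ?thesis using that h by blast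
qed

text \<open>Only the containment of images is kept, because the maps out of direct sums serve to
  prove surjectivity.\<close>

lemma direct_sum_hom_image:
  assumes M: "D4_module M" and N: "D4_module N" and C: "D4_module (C :: 'k::field rep)"
    and f: "module_hom M C f" and g: "module_hom N C g"
  obtains h where "module_hom (M \<oplus>\<^sub>D N) C h"
    "(*\<^sub>v) f ` space M \<subseteq> (*\<^sub>v) h ` space (M \<oplus>\<^sub>D N)" "(*\<^sub>v) g ` space N \<subseteq> (*\<^sub>v) h ` space (M \<oplus>\<^sub>D N)"
proof -
  obtain h where h: "module_hom (M \<oplus>\<^sub>D N) C h"
    "\<forall>u\<in>space M. \<forall>v\<in>space N. h *\<^sub>v (u @\<^sub>v v) = f *\<^sub>v u + g *\<^sub>v v"
    using direct_sum_hom[OF assms] by blast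
  have "f *\<^sub>v u \<in> (*\<^sub>v) h ` space (M \<oplus>\<^sub>D N)" if "u \<in> space M" for u
    using that bspec[OF bspec[OF h(2) that], of "0\<^sub>v (vdim N)"] hom_linear(5)[OF g] module_homD(2)[OF f M C that]
    by (intro image_eqI[of _ _ "u @\<^sub>v 0\<^sub>v (vdim N)"]) auto
  moreover have "g *\<^sub>v v \<in> (*\<^sub>v) h ` space (M \<oplus>\<^sub>D N)" if "v \<in> space N" for v
    using that bspec[OF bspec[OF h(2), of "0\<^sub>v (vdim M)"] that] hom_linear(5)[OF f] module_homD(2)[OF g N C that]
    by (intro image_eqI[of _ _ "0\<^sub>v (vdim M) @\<^sub>v v"]) auto
  ultimately show ?thesis using that[OF h(1)] by blast
qed

lemma vdim_copies [simp]: "vdim (copies m P) = m * vdim P"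
  by (induction m) auto

lemma D4_copies: "D4_module P \<Longrightarrow> D4_module (copies m P)"
proof (induction m)
  case 0
  show ?case by (auto simp: D4_module_def Let_def intro!: eq_matI)
qed (simp add: D4_direct_sum)

lemma copies_hom:
  assumes P: "D4_module P" and C: "D4_module (C :: 'k::field rep)"
    and "\<And>k. k < m \<Longrightarrow> module_hom P C (f k)"
  shows "\<exists>h. module_hom (copies m P) C h \<and> (\<forall>k<m. (*\<^sub>v) (f k) ` space P \<subseteq> (*\<^sub>v) h ` space (copies m P))"
  using assms(3)
proof (induction m arbitrary: f)
  case 0
  have "module_hom (copies 0 P) C (0\<^sub>m (vdim C) 0)"
    using carrier_matD[OF act_carrier[OF C]] by (auto simp: module_hom_def intro!: eq_matI)
  then show ?case by blast
next
  case (Suc m)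
  obtain h where h: "module_hom (copies m P) C h"
    "\<And>k. k < m \<Longrightarrow> (*\<^sub>v) (f (Suc k)) ` space P \<subseteq> (*\<^sub>v) h ` space (copies m P)"
    using Suc.IH[of "\<lambda>k. f (Suc k)"] Suc.prems by auto
  obtain h' where h': "module_hom (P \<oplus>\<^sub>D copies m P) C h'"
    "(*\<^sub>v) (f 0) ` space P \<subseteq> (*\<^sub>v) h' ` space (P \<oplus>\<^sub>D copies m P)"
    "(*\<^sub>v) h ` space (copies m P) \<subseteq> (*\<^sub>v) h' ` space (P \<oplus>\<^sub>D copies m P)"
    using direct_sum_hom_image[OF P D4_copies[OF P] C Suc.prems[of 0] h(1)] by blast
  have "(*\<^sub>v) (f k) ` space P \<subseteq> (*\<^sub>v) h' ` space (P \<oplus>\<^sub>D copies m P)" if "k < Suc m" for k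
  proof (cases k)
    case (Suc k')
    then show ?thesis using h(2)[of k'] h'(3) that by auto
  qed (use h'(2) in simp)
  then show ?case using h'(1) by (intro exI[of _ h']) simp
qed

section \<open>Tensor products\<close>

text \<open>Pure tensors in the index convention of \<open>kronecker\<close>: position k stands for
  the pair (k div n, k mod n), where n is the dimension of the second factor.\<close>

definition tensor_vec :: "'k::field vec \<Rightarrow> 'k vec \<Rightarrow> 'k vec" where
  "tensor_vec u v = vec (dim_vec u * dim_vec v) (\<lambda>k. u $ (k div dim_vec v) * v $ (k mod dim_vec v))"

lemma tensor_vec_carrier: "u \<in> carrier_vec m \<Longrightarrow> v \<in> carrier_vec n \<Longrightarrow> tensor_vec u v \<in> carrier_vec (m * n)"
  by (auto simp: tensor_vec_def)

lemma div_mod_less: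
  assumes "k < m * (n::nat)"
  shows "k div n < m" "k mod n < n"
  using assms less_mult_imp_div_less by (blast, cases "n = 0", auto)

lemma tensor_vec_linear:
  shows "u \<in> carrier_vec m \<Longrightarrow> u' \<in> carrier_vec m \<Longrightarrow> v \<in> carrier_vec n \<Longrightarrow> tensor_vec (u + u') v = tensor_vec u v + tensor_vec u' v"
    and "u \<in> carrier_vec m \<Longrightarrow> v \<in> carrier_vec n \<Longrightarrow> v' \<in> carrier_vec n \<Longrightarrow> tensor_vec u (v + v') = tensor_vec u v + tensor_vec u v'"
    and "u \<in> carrier_vec m \<Longrightarrow> u' \<in> carrier_vec m \<Longrightarrow> v \<in> carrier_vec n \<Longrightarrow> tensor_vec (u - u') v = tensor_vec u v - tensor_vec u' v"
    and "u \<in> carrier_vec m \<Longrightarrow> v \<in> carrier_vec n \<Longrightarrow> v' \<in> carrier_vec n \<Longrightarrow> tensor_vec u (v - v') = tensor_vec u v - tensor_vec u v'"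
    and "tensor_vec (c \<cdot>\<^sub>v u) v = c \<cdot>\<^sub>v tensor_vec u v" "tensor_vec u (c \<cdot>\<^sub>v v) = c \<cdot>\<^sub>v tensor_vec u v"
    and "tensor_vec (- u) v = - tensor_vec u v" "tensor_vec u (- v) = - tensor_vec u v"
    and "tensor_vec (0\<^sub>v m) v = 0\<^sub>v (m * dim_vec v)" "tensor_vec u (0\<^sub>v n) = 0\<^sub>v (dim_vec u * n)"
  by (auto simp: tensor_vec_def algebra_simps div_mod_less(1) div_mod_less(2)[where m = m]
      div_mod_less(2)[where m = "dim_vec u"]
      div_mod_less(2)[where m = "dim_vec u", unfolded mult.commute[of "dim_vec u"]] intro!: eq_vecI)

lemma sum_div_mod:
  fixes f :: "nat \<Rightarrow> nat \<Rightarrow> 'a::comm_monoid_add"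
  shows "(\<Sum>l<m * n. f (l div n) (l mod n)) = (\<Sum>i<m. \<Sum>j<n. f i j)"
proof (cases "n = 0")
  case False
  have add: "(\<Sum>i<k + l. g i) = (\<Sum>i<k. g i) + (\<Sum>i<l. g (k + i))" for g :: "nat \<Rightarrow> 'a" and k l
    by (induction l) (auto simp: algebra_simps)
  show ?thesis
  proof (induction m)
    case (Suc m)
    have "(\<Sum>l<Suc m * n. f (l div n) (l mod n)) = (\<Sum>l<m * n + n. f (l div n) (l mod n))"
      by (simp add: add.commute)
    also have "\<dots> = (\<Sum>l<m * n. f (l div n) (l mod n)) + (\<Sum>j<n. f ((m * n + j) div n) ((m * n + j) mod n))"
      by (rule add)
    also have "(\<Sum>j<n. f ((m * n + j) div n) ((m * n + j) mod n)) = (\<Sum>j<n. f m j)"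
      using False by (intro sum.cong) auto
    finally show ?case using Suc by simp
  qed simp
qed simp

lemma kronecker_carrier:
  "A \<in> carrier_mat a m \<Longrightarrow> B \<in> carrier_mat b n \<Longrightarrow> kronecker A B \<in> carrier_mat (a * b) (m * n)"
  by (auto simp: kronecker_def)

lemma kronecker_mult_tensor_vec:
  assumes A: "A \<in> carrier_mat a m" and B: "B \<in> carrier_mat b n"
    and u: "u \<in> carrier_vec m" and v: "v \<in> carrier_vec n"
  shows "kronecker A B *\<^sub>v tensor_vec u v = tensor_vec (A *\<^sub>v u) (B *\<^sub>v v)"
proof (rule eq_vecI)
  fix k assume "k < dim_vec (tensor_vec (A *\<^sub>v u) (B *\<^sub>v v))"
  then have k: "k < a * b" using A B by (simp add: tensor_vec_def)
  note k' = div_mod_less[OF k]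
  have "(kronecker A B *\<^sub>v tensor_vec u v) $ k
      = (\<Sum>l<m * n. (A $$ (k div b, l div n) * u $ (l div n)) * (B $$ (k mod b, l mod n) * v $ (l mod n)))"
    using k A B u v by (auto simp: kronecker_def tensor_vec_def scalar_prod_def atLeast0LessThan intro!: sum.cong)
  also have "\<dots> = (\<Sum>i<m. \<Sum>j<n. (A $$ (k div b, i) * u $ i) * (B $$ (k mod b, j) * v $ j))"
    by (rule sum_div_mod)
  also have "\<dots> = (\<Sum>i<m. A $$ (k div b, i) * u $ i) * (\<Sum>j<n. B $$ (k mod b, j) * v $ j)"
    by (simp add: sum_product)
  also have "\<dots> = (A *\<^sub>v u) $ (k div b) * (B *\<^sub>v v) $ (k mod b)"
    using A B u v k' by (simp add: scalar_prod_def atLeast0LessThan)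
  also have "\<dots> = tensor_vec (A *\<^sub>v u) (B *\<^sub>v v) $ k" using A B k by (simp add: tensor_vec_def)
  finally show "(kronecker A B *\<^sub>v tensor_vec u v) $ k = tensor_vec (A *\<^sub>v u) (B *\<^sub>v v) $ k" .
qed (use A B in \<open>simp add: kronecker_def tensor_vec_def\<close>)

text \<open>Pass from the spanning sets to all vectors one factor at a time: with the other factor
  fixed, the vectors whose tensor lies in \<open>U\<close> form a subspace. Pure tensors suffice
  because a unit vector of the product is a tensor of two unit vectors.\<close>

lemma generates_tensor_vec:
  assumes S: "generates m S" and T: "generates n (T :: 'k::field vec set)"
  shows "generates (m * n) {tensor_vec u v | u v. u \<in> S \<and> v \<in> T}"
proof -
  have Sc: "u \<in> carrier_vec m" if "u \<in> S" for u using S that by (auto simp: generates_def)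
  have Tc: "v \<in> carrier_vec n" if "v \<in> T" for v using T that by (auto simp: generates_def)
  show ?thesis
    unfolding generates_def
  proof (intro conjI allI impI subsetI)
    fix w assume "w \<in> {tensor_vec u v | u v. u \<in> S \<and> v \<in> T}"
    then show "w \<in> carrier_vec (m * n)" using tensor_vec_carrier Sc Tc by blast
  next
    fix U and w :: "'k vec" assume U: "subsp (m * n) U \<and> {tensor_vec u v | u v. u \<in> S \<and> v \<in> T} \<subseteq> U" and w: "w \<in> carrier_vec (m * n)"
    note s = subspD[OF conjunct1[OF U]]
    have 1: "tensor_vec u v \<in> U" if u: "u \<in> carrier_vec m" and v: "v \<in> T" for u v
    proof -
      have "subsp m {u \<in> carrier_vec m. tensor_vec u v \<in> U}"
        using Tc[OF v] s by (intro subspI) (auto simp: tensor_vec_linear)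
      then show ?thesis using generatesD[OF S _ _ u] U Sc v by blast
    qed
    have 2: "tensor_vec u v \<in> U" if u: "u \<in> carrier_vec m" and v: "v \<in> carrier_vec n" for u v
    proof -
      have "subsp n {v \<in> carrier_vec n. tensor_vec u v \<in> U}"
        using u s by (intro subspI) (auto simp: tensor_vec_linear)
      then show ?thesis using generatesD[OF T _ _ v] 1 u Tc by blast
    qed
    have "unit_vec (m * n) k \<in> U" if k: "k < m * n" for k
    proof -
      have "(i = k) = (i div n = k div n \<and> i mod n = k mod n)" for i
        by (metis div_mult_mod_eq)
      then have "unit_vec (m * n) k = tensor_vec (unit_vec m (k div n)) (unit_vec n (k mod n) :: 'k vec)"
        using k div_mod_less[OF k] div_mod_less[of _ m n] by (intro eq_vecI) (auto simp: tensor_vec_def)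
      then show ?thesis using 2 by simp
    qed
    then show "w \<in> U" using unit_vecs_generate[OF conjunct1[OF U] _ w] by blast
  qed
qed

lemma vdim_tensor [simp]: "vdim (M \<otimes>\<^sub>D N) = vdim M * vdim N"
  by (simp add: tensor_def)

lemma act_tensor:
  assumes M: "D4_module M" and N: "D4_module N" and u: "u \<in> space M" and v: "v \<in> space N"
  shows "act (M \<otimes>\<^sub>D N) ga *\<^sub>v tensor_vec u v = tensor_vec (act M ga *\<^sub>v u) (act N gb *\<^sub>v v) + tensor_vec u (act N ga *\<^sub>v v)"
    and "act (M \<otimes>\<^sub>D N) gb *\<^sub>v tensor_vec u v = tensor_vec (act M gb *\<^sub>v u) (act N gb *\<^sub>v v)"
    and "act (M \<otimes>\<^sub>D N) gc *\<^sub>v tensor_vec u v = tensor_vec (act M gc *\<^sub>v u) (act N gc *\<^sub>v v)"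
    and "act (M \<otimes>\<^sub>D N) gd *\<^sub>v tensor_vec u v = tensor_vec (act M gd *\<^sub>v u) (act N gc *\<^sub>v v) + tensor_vec u (act N gd *\<^sub>v v)"
  using u
  by (simp_all add: tensor_def
      add_mult_distrib_mat_vec[OF kronecker_carrier[OF act_carrier[OF M] act_carrier[OF N]]
        kronecker_carrier[OF one_carrier_mat act_carrier[OF N]] tensor_vec_carrier[OF u v]]
      kronecker_mult_tensor_vec[OF act_carrier[OF M] act_carrier[OF N] u v]
      kronecker_mult_tensor_vec[OF one_carrier_mat act_carrier[OF N] u v])

lemma act_tensor_carrier:
  "D4_module M \<Longrightarrow> D4_module N \<Longrightarrow> act (M \<otimes>\<^sub>D N) g \<in> carrier_mat (vdim M * vdim N) (vdim M * vdim N)"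
  by (cases g) (auto simp: tensor_def intro!: add_carrier_mat kronecker_carrier act_carrier)

text \<open>On pure tensors each relation reduces to those of the two factors; any mixed terms
  cancel because b and c anticommute with a and d.\<close>

lemma D4_tensor:
  assumes M: "D4_module M" and N: "D4_module (N :: 'k::field rep)"
  shows "D4_module (M \<otimes>\<^sub>D N)"
proof (rule D4_moduleI)
  let ?S = "{tensor_vec u v | u v. u \<in> space M \<and> v \<in> space N}"
  have top: "generates n (carrier_vec n :: 'k vec set)" for n by (auto simp: generates_def)
  show "generates (vdim (M \<otimes>\<^sub>D N)) ?S" using generates_tensor_vec[OF top top] by simp
  show "act (M \<otimes>\<^sub>D N) g \<in> carrier_mat (vdim (M \<otimes>\<^sub>D N)) (vdim (M \<otimes>\<^sub>D N))" for g
    using act_tensor_carrier[OF M N] by simp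
  let ?n = "vdim M * vdim N"
  have tc: "tensor_vec u v \<in> carrier_vec ?n" if "u \<in> space M" "v \<in> space N" for u v
    using that by (rule tensor_vec_carrier)
  have add: "act (M \<otimes>\<^sub>D N) g *\<^sub>v (v + w) = act (M \<otimes>\<^sub>D N) g *\<^sub>v v + act (M \<otimes>\<^sub>D N) g *\<^sub>v w"
    if "v \<in> carrier_vec ?n" "w \<in> carrier_vec ?n" for g v w
    using mult_add_distrib_mat_vec[OF act_tensor_carrier[OF M N]] that by blast
  fix w assume "w \<in> ?S"
  then obtain u v where u: "u \<in> space M" and v: "v \<in> space N" and w: "w = tensor_vec u v" by blast
  note [simp] = u v act_closed[OF M] act_closed[OF N] act_tensor[OF M N] D4_rels[OF M] D4_rels[OF N]
    act_linear[OF M] act_linear[OF N] tc add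
  note lin = tensor_vec_linear(1-4)[where m = "vdim M" and n = "vdim N"] tensor_vec_linear(5-)
  have cancel: "- x + x = 0\<^sub>v ?n" "x + - x = 0\<^sub>v ?n" if "x \<in> carrier_vec ?n" for x :: "'k vec"
    using that by auto
  show "act (M \<otimes>\<^sub>D N) ga *\<^sub>v (act (M \<otimes>\<^sub>D N) ga *\<^sub>v w) = 0\<^sub>v (vdim (M \<otimes>\<^sub>D N))"
    "act (M \<otimes>\<^sub>D N) gd *\<^sub>v (act (M \<otimes>\<^sub>D N) gd *\<^sub>v w) = 0\<^sub>v (vdim (M \<otimes>\<^sub>D N))"
    "act (M \<otimes>\<^sub>D N) gb *\<^sub>v (act (M \<otimes>\<^sub>D N) gb *\<^sub>v w) = w"
    "act (M \<otimes>\<^sub>D N) gc *\<^sub>v (act (M \<otimes>\<^sub>D N) gc *\<^sub>v w) = w"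
    "act (M \<otimes>\<^sub>D N) gb *\<^sub>v (act (M \<otimes>\<^sub>D N) gc *\<^sub>v w) = act (M \<otimes>\<^sub>D N) gc *\<^sub>v (act (M \<otimes>\<^sub>D N) gb *\<^sub>v w)"
    unfolding w by (simp_all add: lin cancel carrier_vecD[OF u] carrier_vecD[OF v])
  have neg: "- (x + y) = - x + - y" if "x \<in> carrier_vec ?n" "y \<in> carrier_vec ?n" for x y :: "'k vec"
    using that by (intro eq_vecI) auto
  show "act (M \<otimes>\<^sub>D N) gb *\<^sub>v (act (M \<otimes>\<^sub>D N) ga *\<^sub>v w) = - (act (M \<otimes>\<^sub>D N) ga *\<^sub>v (act (M \<otimes>\<^sub>D N) gb *\<^sub>v w))"
    "act (M \<otimes>\<^sub>D N) gd *\<^sub>v (act (M \<otimes>\<^sub>D N) gb *\<^sub>v w) = - (act (M \<otimes>\<^sub>D N) gb *\<^sub>v (act (M \<otimes>\<^sub>D N) gd *\<^sub>v w))"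
    "act (M \<otimes>\<^sub>D N) gc *\<^sub>v (act (M \<otimes>\<^sub>D N) ga *\<^sub>v w) = - (act (M \<otimes>\<^sub>D N) ga *\<^sub>v (act (M \<otimes>\<^sub>D N) gc *\<^sub>v w))"
    "act (M \<otimes>\<^sub>D N) gd *\<^sub>v (act (M \<otimes>\<^sub>D N) gc *\<^sub>v w) = - (act (M \<otimes>\<^sub>D N) gc *\<^sub>v (act (M \<otimes>\<^sub>D N) gd *\<^sub>v w))"
    unfolding w by (simp_all add: lin neg)
  \<comment> \<open>In the application \<open>e\<close> and \<open>f\<close> are the mixed terms, of
    opposite sign in da and ad. What survives is \<open>z - r\<close>, the tensor of u and v minus
    that of bc u and bc v.\<close>
  have fin: "((p - r - s) + e) + (- f + (z - p - g)) + ((s + f) + (- e + g)) = z - r"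
    if "p \<in> carrier_vec ?n" "r \<in> carrier_vec ?n" "s \<in> carrier_vec ?n" "e \<in> carrier_vec ?n"
      "f \<in> carrier_vec ?n" "z \<in> carrier_vec ?n" "g \<in> carrier_vec ?n" for p r s e f z g :: "'k vec"
    using that by (intro eq_vecI) auto
  let ?BCu = "act M gb *\<^sub>v (act M gc *\<^sub>v u)" and ?BCv = "act N gb *\<^sub>v (act N gc *\<^sub>v v)"
    and ?ADu = "act M ga *\<^sub>v (act M gd *\<^sub>v u)" and ?ADv = "act N ga *\<^sub>v (act N gd *\<^sub>v v)"
    and ?e = "tensor_vec (act M ga *\<^sub>v u) (act N gd *\<^sub>v (act N gb *\<^sub>v v))"
    and ?f = "tensor_vec (act M gd *\<^sub>v u) (act N ga *\<^sub>v (act N gc *\<^sub>v v))"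
  have DA: "act (M \<otimes>\<^sub>D N) gd *\<^sub>v (act (M \<otimes>\<^sub>D N) ga *\<^sub>v w)
      = ((tensor_vec u ?BCv - tensor_vec ?BCu ?BCv - tensor_vec ?ADu ?BCv) + ?e) + (- ?f + (tensor_vec u v - tensor_vec u ?BCv - tensor_vec u ?ADv))"
    unfolding w by (simp add: lin)
  have AD: "act (M \<otimes>\<^sub>D N) ga *\<^sub>v (act (M \<otimes>\<^sub>D N) gd *\<^sub>v w) = (tensor_vec ?ADu ?BCv + ?f) + (- ?e + tensor_vec u ?ADv)"
    unfolding w by (simp add: lin)
  show "act (M \<otimes>\<^sub>D N) gd *\<^sub>v (act (M \<otimes>\<^sub>D N) ga *\<^sub>v w) + act (M \<otimes>\<^sub>D N) ga *\<^sub>v (act (M \<otimes>\<^sub>D N) gd *\<^sub>v w)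
      = w - act (M \<otimes>\<^sub>D N) gb *\<^sub>v (act (M \<otimes>\<^sub>D N) gc *\<^sub>v w)"
    unfolding DA AD by (subst fin) (simp_all add: w)
qed

lemma homog_tensor_vec:
  assumes M: "D4_module M" and N: "D4_module N" and u: "homog M q u" and v: "homog N q' v"
  shows "homog (M \<otimes>\<^sub>D N) (q + q') (tensor_vec u v)"
  using act_tensor(2,3)[OF M N homogD(1)[OF u] homogD(1)[OF v]] tensor_vec_carrier[OF homogD(1)[OF u] homogD(1)[OF v]]
  unfolding homog_def[of "M \<otimes>\<^sub>D N"] sg_add
  by (simp add: homogD[OF u] homogD[OF v] tensor_vec_linear(5,6) smult_smult_assoc mult.commute)

section \<open>Decomposition of the tensor product\<close>

lemma projective_cover_hits:
  assumes cover: "projective_cover (simple_module q) P p" and two: "(2::'k::field) \<noteq> 0"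
  shows "D4_module (P :: 'k rep)" "vdim P = 4"
    and "D4_module C \<Longrightarrow> homog C q w \<Longrightarrow> \<exists>f. module_hom P C f \<and> w \<in> (*\<^sub>v) f ` space P"
proof -
  obtain h where epi: "module_epi P (P0 q) h" and P: "vdim P = 4" "D4_module P"
    using projective_cover_simple[OF cover two] .
  show "D4_module P" "vdim P = 4" by (fact P)+
  assume C: "D4_module C" and w: "homog C q w"
  have h: "module_hom P (P0 q) h" using epi by (simp add: module_epi_def)
  \<comment> \<open>The map out of \<open>P0 q\<close> determined by \<open>w\<close>, preceded by
    the surjection \<open>h\<close>, reaches \<open>w\<close>.\<close>
  obtain f where f: "module_hom (P0 q) C f" "f *\<^sub>v unit_vec 4 0 = w"
    using P0_hom[OF C w] by blast
  have "unit_vec 4 0 \<in> (*\<^sub>v) h ` space P" using epi by (simp add: module_epi_def)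
  then obtain v where v: "v \<in> space P" "h *\<^sub>v v = unit_vec 4 0" by (metis imageE)
  have "(f * h) *\<^sub>v v = w"
    using assoc_mult_mat_vec[of f "vdim C" 4 h "vdim P" v] module_homD(1)[OF f(1) D4_P0 C]
      module_homD(1)[OF h P(2) D4_P0] v f(2) by simp
  then show "\<exists>f. module_hom P C f \<and> w \<in> (*\<^sub>v) f ` space P"
    using module_hom_comp[OF P(2) D4_P0 C h f(1)] v(1) by blast
qed

text \<open>The \<open>x i\<close> and \<open>y i\<close> form a basis of \<open>M\<close>, so
  families in \<open>C\<close> obeying the same rules for a, d and the degrees are the values of a
  linear map, which is then a homomorphism.\<close>

lemma zigzag_hom:
  assumes W: "zigzag n q M x y" and C: "D4_module (C :: 'k::field rep)"
    and u: "\<And>i. i < n \<Longrightarrow> homog C (q + 1) (u i) \<and> act C ga *\<^sub>v u i = v i \<and> act C gd *\<^sub>v u i = v (Suc i)"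
    and v: "\<And>i. i \<le> n \<Longrightarrow> homog C q (v i) \<and> act C ga *\<^sub>v v i = 0\<^sub>v (vdim C) \<and> act C gd *\<^sub>v v i = 0\<^sub>v (vdim C)"
  shows "\<exists>f. module_hom M C f \<and> (\<forall>i<n. u i \<in> (*\<^sub>v) f ` space M) \<and> (\<forall>i\<le>n. v i \<in> (*\<^sub>v) f ` space M)"
proof -
  note M = zigzagD(1)[OF W]
  obtain f where f: "f \<in> carrier_mat (vdim C) (vdim M)" "\<And>i. i < n \<Longrightarrow> f *\<^sub>v x i = u i" "\<And>i. i \<le> n \<Longrightarrow> f *\<^sub>v y i = v i"
    using zigzag_basis(2)[OF W, of u "vdim C" v] u v by (metis homogD(1))
  have hom: "module_hom M C f"
  proof (rule module_homI[OF M C f(1) zigzagD(10)[OF W]])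
    fix g w assume "w \<in> x ` {..<n} \<union> y ` {..n}"
    then consider i where "i < n" "w = x i" | i where "i \<le> n" "w = y i" by auto
    then show "f *\<^sub>v (act M g *\<^sub>v w) = act C g *\<^sub>v (f *\<^sub>v w)"
    proof cases
      case 1
      then show ?thesis
        using u[of i] f(2)[of i] f(3)[of i] f(3)[of "Suc i"] zigzagD(3-5)[OF W, of i] homogD[OF zigzagD(2)[OF W, of i]]
          homogD[of C "q + 1" "u i"]
        by (cases g) (simp_all add: mult_mat_vec[OF f(1)] del: add_bit_eq_xor)
    next
      case 2
      then show ?thesis
        using v[of i] f(3)[of i] zigzagD(7-9)[OF W, of i] homogD[OF zigzagD(6)[OF W, of i]]
          homogD[of C q "v i"]
        by (cases g) (simp_all add: mult_mat_vec[OF f(1)] mult_mat_vec_zero[OF f(1)])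
    qed
  qed
  then show ?thesis using f(2,3) zigzagD(3,7)[OF W] by (metis image_eqI)
qed

text \<open>The tops \<open>x\<^sub>i \<otimes> x'\<^sub>j\<close> generate the projective summands; a complement is spanned along the
  path \<open>(0,0), \<dots>, (s,0), (s,1), \<dots>, (s,t)\<close> in the grid of the socle elements \<open>y\<^sub>i \<otimes> y'\<^sub>j\<close>.\<close>

lemma tensor_zigzag:
  fixes M N X P :: "'k::field rep"
  assumes W: "zigzag s q M x y" and W': "zigzag t q' N x' y'" and X: "zigzag (s + t) (q + q') X xx yy"
    and P: "D4_module P" "vdim P = 4"
    and hits: "\<And>C w. D4_module C \<Longrightarrow> homog C (q + q') w \<Longrightarrow> \<exists>f. module_hom P C f \<and> w \<in> (*\<^sub>v) f ` space P"
  shows "M \<otimes>\<^sub>D N \<cong>\<^sub>D X \<oplus>\<^sub>D copies (s * t) P"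
proof -
  note M = zigzagD(1)[OF W] and N = zigzagD(1)[OF W']
  let ?T = "M \<otimes>\<^sub>D N"
  have T: "D4_module ?T" by (rule D4_tensor[OF M N])
  \<comment> \<open>The scalar by which b and c act on every \<open>x' j\<close>; on the
    \<open>y' j\<close> they act by its negative. It enters through the first terms of the
    comultiplications of a and d.\<close>
  define \<beta> :: 'k where "\<beta> = sg (q' + 1)"
  have \<beta>: "\<beta> * \<beta> = 1" "\<beta> \<noteq> 0" unfolding \<beta>_def by simp_all
  let ?A = "\<lambda>w. act ?T ga *\<^sub>v w" and ?D = "\<lambda>w. act ?T gd *\<^sub>v w" and ?O = "0\<^sub>v (vdim ?T)"
  note tc = tensor_vec_carrier[of _ "vdim M" _ "vdim N"]
  have bx: "act N gb *\<^sub>v x' j = \<beta> \<cdot>\<^sub>v x' j" "act N gc *\<^sub>v x' j = \<beta> \<cdot>\<^sub>v x' j" if "j < t" for j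
    using homogD[OF zigzagD(2)[OF W' that]] unfolding \<beta>_def by blast+
  have byy: "act N gb *\<^sub>v y' j = (- \<beta>) \<cdot>\<^sub>v y' j" "act N gc *\<^sub>v y' j = (- \<beta>) \<cdot>\<^sub>v y' j" if "j \<le> t" for j
    using homogD[OF zigzagD(6)[OF W' that]] unfolding \<beta>_def by (simp_all only: sg_add_1 minus_minus)
  have c: "i < s \<Longrightarrow> x i \<in> space M" "i \<le> s \<Longrightarrow> y i \<in> space M" "j < t \<Longrightarrow> x' j \<in> space N" "j \<le> t \<Longrightarrow> y' j \<in> space N" for i j
    using zigzagD(3,7)[OF W] zigzagD(3,7)[OF W'] by blast+
  have t0: "tensor_vec (0\<^sub>v (vdim M)) v = ?O" if "v \<in> space N" for v using that by (simp add: tensor_vec_linear(9))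
  have t0': "tensor_vec u (0\<^sub>v (vdim N)) = ?O" if "u \<in> space M" for u using that by (simp add: tensor_vec_linear(10))
  have xx': "?A (tensor_vec (x i) (x' j)) = \<beta> \<cdot>\<^sub>v tensor_vec (y i) (x' j) + tensor_vec (x i) (y' j)"
    "?D (tensor_vec (x i) (x' j)) = \<beta> \<cdot>\<^sub>v tensor_vec (y (Suc i)) (x' j) + tensor_vec (x i) (y' (Suc j))" if "i < s" "j < t" for i j
    using that by (simp_all add: act_tensor[OF M N] c bx zigzagD(4,5)[OF W] zigzagD(4,5)[OF W'] tensor_vec_linear(5,6))
  have xy': "?A (tensor_vec (x i) (y' j)) = (- \<beta>) \<cdot>\<^sub>v tensor_vec (y i) (y' j)"
    "?D (tensor_vec (x i) (y' j)) = (- \<beta>) \<cdot>\<^sub>v tensor_vec (y (Suc i)) (y' j)" if "i < s" "j \<le> t" for i j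
    using that tc[OF c(2) c(4), of i j] tc[OF c(2) c(4), of "Suc i" j]
    by (simp_all add: act_tensor[OF M N] c byy zigzagD(4,5)[OF W] zigzagD(8,9)[OF W'] tensor_vec_linear(5,6) t0' right_zero_vec[of _ "vdim M * vdim N"])
  have yx': "?A (tensor_vec (y i) (x' j)) = tensor_vec (y i) (y' j)" "?D (tensor_vec (y i) (x' j)) = tensor_vec (y i) (y' (Suc j))"
    if "i \<le> s" "j < t" for i j
    using that tc[OF c(2) c(4), of i j] tc[OF c(2) c(4), of i "Suc j"]
    by (simp_all add: act_tensor[OF M N] c bx zigzagD(8,9)[OF W] zigzagD(4,5)[OF W'] tensor_vec_linear(5,6) t0 smult_zero_vec)
  have yy': "?A (tensor_vec (y i) (y' j)) = ?O" "?D (tensor_vec (y i) (y' j)) = ?O" if "i \<le> s" "j \<le> t" for i j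
    using that by (simp_all add: act_tensor[OF M N] c byy zigzagD(8,9)[OF W] zigzagD(8,9)[OF W'] tensor_vec_linear(5,6) t0 t0' smult_zero_vec)
  have hxx: "homog ?T (q + q') (tensor_vec (x i) (x' j))" if "i < s" "j < t" for i j
  proof -
    have "homog ?T ((q + 1) + (q' + 1)) (tensor_vec (x i) (x' j))"
      by (rule homog_tensor_vec[OF M N zigzagD(2)[OF W that(1)] zigzagD(2)[OF W' that(2)]])
    moreover have "(q + 1) + (q' + 1) = (q + q') + 1 + 1" by (simp only: ac_simps)
    ultimately show ?thesis by (simp only: bit_add_1_1)
  qed
  have hxy: "homog ?T (q + q' + 1) (tensor_vec (x i) (y' j))" if "i < s" "j \<le> t" for i j
  proof -
    have "homog ?T ((q + 1) + q') (tensor_vec (x i) (y' j))"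
      by (rule homog_tensor_vec[OF M N zigzagD(2)[OF W that(1)] zigzagD(6)[OF W' that(2)]])
    moreover have "(q + 1) + q' = q + q' + 1" by (simp only: ac_simps)
    ultimately show ?thesis by (simp only:)
  qed
  have hyx: "homog ?T (q + q' + 1) (tensor_vec (y i) (x' j))" if "i \<le> s" "j < t" for i j
  proof -
    have "homog ?T (q + (q' + 1)) (tensor_vec (y i) (x' j))"
      by (rule homog_tensor_vec[OF M N zigzagD(6)[OF W that(1)] zigzagD(2)[OF W' that(2)]])
    then show ?thesis by (simp only: add.assoc)
  qed
  have hyy: "homog ?T (q + q') (tensor_vec (y i) (y' j))" if "i \<le> s" "j \<le> t" for i j
    by (rule homog_tensor_vec[OF M N zigzagD(6)[OF W that(1)] zigzagD(6)[OF W' that(2)]])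
  \<comment> \<open>The \<open>u k\<close> are the edges of the path, first along j = 0 and then
    along i = s. The factor \<open>- \<beta>\<close> cancels the one in \<open>xy'\<close>, as
    \<open>\<beta>\<close> squares to 1, so that a and d send \<open>u k\<close> exactly to
    \<open>v k\<close> and \<open>v (Suc k)\<close>.\<close>
  define u where "u k = (if k < s then (- \<beta>) \<cdot>\<^sub>v tensor_vec (x k) (y' 0) else tensor_vec (y s) (x' (k - s)))" for k
  define v where "v k = (if k \<le> s then tensor_vec (y k) (y' 0) else tensor_vec (y s) (y' (k - s)))" for k
  \<comment> \<open>The two branches of \<open>v\<close> agree at the corner k = s.\<close>
  have v_ge: "v k = tensor_vec (y s) (y' (k - s))" if "s \<le> k" for k
    using that by (cases "k = s") (auto simp: v_def)
  have u_props: "homog ?T (q + q' + 1) (u k) \<and> ?A (u k) = v k \<and> ?D (u k) = v (Suc k)" if k: "k < s + t" for k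
  proof (cases "k < s")
    case True
    then have "?A (u k) = v k \<and> ?D (u k) = v (Suc k)"
      using homogD(1)[OF hxy[OF True, of 0]] \<beta>
      by (simp add: u_def v_def act_linear[OF T] xy' smult_smult_assoc)
    then show ?thesis using True homog_smult[OF T hxy[OF True, of 0], of "- \<beta>"] by (simp only: u_def if_True le0)
  next
    case False
    then have kt: "k - s < t" and Suc_k: "Suc k - s = Suc (k - s)" and uk: "u k = tensor_vec (y s) (x' (k - s))"
      using k by (auto simp: u_def)
    have "?A (u k) = v k" "?D (u k) = v (Suc k)"
      using False yx'[OF le_refl kt] v_ge[of k] v_ge[of "Suc k"] by (simp_all add: uk Suc_k)
    then show ?thesis using hyx[OF le_refl kt] unfolding uk by blast
  qed
  have v_props: "homog ?T (q + q') (v k) \<and> ?A (v k) = ?O \<and> ?D (v k) = ?O" if k: "k \<le> s + t" for k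
    using k yy'[of k 0] yy'[of s "k - s"] hyy[of k 0] hyy[of s "k - s"] unfolding v_def by (cases "k \<le> s") auto
  obtain f where f: "module_hom X ?T f" "\<And>k. k < s + t \<Longrightarrow> u k \<in> (*\<^sub>v) f ` space X"
    "\<And>k. k \<le> s + t \<Longrightarrow> v k \<in> (*\<^sub>v) f ` space X"
    using zigzag_hom[OF X T, of u v, OF u_props v_props] by blast
  define w where "w k = tensor_vec (x (k div t)) (x' (k mod t))" for k
  have "\<exists>g. module_hom P ?T g \<and> w k \<in> (*\<^sub>v) g ` space P" if "k < s * t" for k
    unfolding w_def by (intro hits T hxx div_mod_less[OF that])
  then obtain g where g: "\<And>k. k < s * t \<Longrightarrow> module_hom P ?T (g k)" "\<And>k. k < s * t \<Longrightarrow> w k \<in> (*\<^sub>v) (g k) ` space P"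
    by metis
  let ?C = "copies (s * t) P"
  have C: "D4_module ?C" by (rule D4_copies[OF P(1)])
  obtain g' where g': "module_hom ?C ?T g'" "\<And>k. k < s * t \<Longrightarrow> (*\<^sub>v) (g k) ` space P \<subseteq> (*\<^sub>v) g' ` space ?C"
    using copies_hom[OF P(1) T, of "s * t" g] g(1) by blast
  obtain h where h: "module_hom (X \<oplus>\<^sub>D ?C) ?T h" "(*\<^sub>v) f ` space X \<subseteq> (*\<^sub>v) h ` space (X \<oplus>\<^sub>D ?C)"
    "(*\<^sub>v) g' ` space ?C \<subseteq> (*\<^sub>v) h ` space (X \<oplus>\<^sub>D ?C)"
    using direct_sum_hom_image[OF zigzagD(1)[OF X] C T f(1) g'(1)] by blast
  have XC: "D4_module (X \<oplus>\<^sub>D ?C)" by (rule D4_direct_sum[OF zigzagD(1)[OF X] C])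
  \<comment> \<open>It remains to see that the image \<open>U\<close> contains all four kinds of
    tensors of basis vectors.\<close>
  define U where "U = (*\<^sub>v) h ` space (X \<oplus>\<^sub>D ?C)"
  have sub: "is_submodule ?T U" unfolding U_def by (rule hom_image_submodule[OF XC T h(1)])
  note s = is_submoduleD(1)[OF sub] and U_act = is_submoduleD(2)[OF sub]
  have uU: "u k \<in> U" if "k < s + t" for k using f(2)[OF that] h(2) unfolding U_def by blast
  have vU: "v k \<in> U" if "k \<le> s + t" for k using f(3)[OF that] h(2) unfolding U_def by blast
  have xxU: "tensor_vec (x i) (x' j) \<in> U" if "i < s" "j < t" for i j
  proof -
    have "i * t + j < Suc i * t" using that by simp
    also have "\<dots> \<le> s * t" using that by (intro mult_right_mono) auto
    finally have "w (i * t + j) \<in> U" using g(2) g'(2) h(3) unfolding U_def by blast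
    then show ?thesis using that by (simp add: w_def)
  qed
  have unscale: "z \<in> U" if "b \<cdot>\<^sub>v z \<in> U" "b \<noteq> 0" for z b
    using subspD(4)[OF s that(1), of "inverse b"] that(2) by (simp add: smult_smult_assoc)
  have from_sum: "z \<in> U" if "z' + z \<in> U" "z' \<in> U" "z \<in> space ?T" for z z'
  proof -
    have "z' \<in> space ?T" using subspD(1)[OF s that(2)] .
    then have "(z' + z) - z' = z" using that(3) by (intro eq_vecI) auto
    then show ?thesis using subsp_diff[OF s that(1,2)] by simp
  qed
  have from_sum': "z' \<in> U" if "z' + z \<in> U" "z \<in> U" "z' \<in> space ?T" for z z'
  proof -
    have "z \<in> space ?T" using subspD(1)[OF s that(2)] .
    then have "(z' + z) - z = z'" using that(3) by (rule_tac add_diff_cancel_vec)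
    then show ?thesis using subsp_diff[OF s that(1,2)] by simp
  qed
  \<comment> \<open>ad applied to the tensor of \<open>x i\<close> and \<open>x' j\<close> links the
    socle elements at (i + 1, j) and (i, j + 1). Membership in \<open>U\<close> thus spreads along
    antidiagonals from the row j = 0 and the column i = s, which lie on the path.\<close>
  have yyU: "\<forall>i\<le>s. tensor_vec (y i) (y' j) \<in> U" if "j \<le> t" for j
    using that
  proof (induction j)
    case 0
    have "tensor_vec (y i) (y' 0) \<in> U" if "i \<le> s" for i using vU[of i] that by (simp add: v_def)
    then show ?case by blast
  next
    case (Suc j)
    show ?case
    proof (intro allI impI)
      fix i assume i: "i \<le> s"
      show "tensor_vec (y i) (y' (Suc j)) \<in> U"
      proof (cases "i = s")
        case True
        then show ?thesis using vU[of "s + Suc j"] v_ge[of "s + Suc j"] Suc.prems by simp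
      next
        case False
        then have i: "i < s" and j: "j < t" "Suc j \<le> t" using i Suc.prems by auto
        have cc: "tensor_vec (y (Suc i)) (x' j) \<in> space ?T" "tensor_vec (x i) (y' (Suc j)) \<in> space ?T" "tensor_vec (y i) (y' (Suc j)) \<in> space ?T"
          using i j by (auto intro!: tc c)
        have "?A (?D (tensor_vec (x i) (x' j))) = \<beta> \<cdot>\<^sub>v tensor_vec (y (Suc i)) (y' j) + (- \<beta>) \<cdot>\<^sub>v tensor_vec (y i) (y' (Suc j))"
          using i j cc by (simp add: xx' act_linear[OF T] yx' xy')
        then have "\<beta> \<cdot>\<^sub>v tensor_vec (y (Suc i)) (y' j) + (- \<beta>) \<cdot>\<^sub>v tensor_vec (y i) (y' (Suc j)) \<in> U"
          using U_act[OF U_act[OF xxU[OF i j(1)]], of ga gd] by simp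
        moreover have "\<beta> \<cdot>\<^sub>v tensor_vec (y (Suc i)) (y' j) \<in> U"
          using Suc i by (intro subspD(4)[OF s]) simp
        ultimately have "(- \<beta>) \<cdot>\<^sub>v tensor_vec (y i) (y' (Suc j)) \<in> U"
          by (rule from_sum) (use cc in simp)
        then show ?thesis by (rule unscale) (use \<beta> in simp)
      qed
    qed
  qed
  \<comment> \<open>d applied to the tensor of \<open>x i\<close> and \<open>x' j\<close> gives the
    claim for j + 1 once the tensor of \<open>y (Suc i)\<close> and \<open>x' j\<close> is in
    \<open>U\<close>. The latter is on the path if i + 1 = s; otherwise a applied to the tensor of
    \<open>x (Suc i)\<close> and \<open>x' j\<close> reduces it to the induction hypothesis.\<close>
  have xyU: "\<forall>i<s. tensor_vec (x i) (y' j) \<in> U" if "j \<le> t" for j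
    using that
  proof (induction j)
    case 0
    have "(- \<beta>) \<cdot>\<^sub>v tensor_vec (x i) (y' 0) \<in> U" if "i < s" for i
      using uU[of i] that by (simp add: u_def)
    then show ?case using unscale[of "- \<beta>"] \<beta>(2) by simp
  next
    case (Suc j)
    show ?case
    proof (intro allI impI)
      fix i assume i: "i < s"
      have j: "j < t" using Suc.prems by simp
      have "tensor_vec (y (Suc i)) (x' j) \<in> U"
      proof (cases "Suc i = s")
        case True
        then show ?thesis using uU[of "s + j"] j by (simp add: u_def)
      next
        case False
        then have i': "Suc i < s" using i by simp
        have "\<beta> \<cdot>\<^sub>v tensor_vec (y (Suc i)) (x' j) + tensor_vec (x (Suc i)) (y' j) \<in> U"
          using U_act[OF xxU[OF i' j], of ga] xx'(1)[OF i' j] by simp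
        then have "\<beta> \<cdot>\<^sub>v tensor_vec (y (Suc i)) (x' j) \<in> U"
          by (rule from_sum') (use Suc i' j tc[OF c(2,3)] in auto)
        then show ?thesis by (rule unscale[OF _ \<beta>(2)])
      qed
      then have *: "\<beta> \<cdot>\<^sub>v tensor_vec (y (Suc i)) (x' j) \<in> U" by (rule subspD(4)[OF s])
      have "\<beta> \<cdot>\<^sub>v tensor_vec (y (Suc i)) (x' j) + tensor_vec (x i) (y' (Suc j)) \<in> U"
        using U_act[OF xxU[OF i j], of gd] xx'(2)[OF i j] by simp
      then show "tensor_vec (x i) (y' (Suc j)) \<in> U"
        by (rule from_sum[OF _ *]) (use i j tc[OF c(1,4)] in auto)
    qed
  qed
  \<comment> \<open>Off the column i = s, a applied to the tensor of \<open>x i\<close> and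
    \<open>x' j\<close> produces this vector up to a scalar and a term already covered by
    \<open>xyU\<close>.\<close>
  have yxU: "tensor_vec (y i) (x' j) \<in> U" if i: "i \<le> s" and j: "j < t" for i j
  proof (cases "i = s")
    case True
    then show ?thesis using uU[of "s + j"] j by (simp add: u_def)
  next
    case False
    then have i: "i < s" using i by simp
    have "\<beta> \<cdot>\<^sub>v tensor_vec (y i) (x' j) + tensor_vec (x i) (y' j) \<in> U"
      using U_act[OF xxU[OF i j], of ga] xx'(1)[OF i j] by simp
    then have "\<beta> \<cdot>\<^sub>v tensor_vec (y i) (x' j) \<in> U"
      by (rule from_sum') (use xyU i j tc[OF c(2,3)] in auto)
    then show ?thesis by (rule unscale[OF _ \<beta>(2)])
  qed
  have "U = space ?T"
  proof (intro equalityI subsetI)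
    fix z assume "z \<in> space ?T"
    then have z: "z \<in> carrier_vec (vdim M * vdim N)" by simp
    have s': "subsp (vdim M * vdim N) U" using s by simp
    show "z \<in> U"
      by (rule generatesD[OF generates_tensor_vec[OF zigzagD(10)[OF W] zigzagD(10)[OF W']] s' _ z])
        (use xxU xyU yxU yyU in auto)
  qed (use subspD(1)[OF s] in blast)
  then have "module_epi (X \<oplus>\<^sub>D ?C) ?T h" using h(1) by (simp add: module_epi_def U_def)
  \<comment> \<open>Both dimensions are known: (2s + 1)(2t + 1) = 2(s + t) + 1 + 4st.\<close>
  moreover have "vdim (X \<oplus>\<^sub>D ?C) = vdim ?T"
    using zigzag_basis(1)[OF W] zigzag_basis(1)[OF W'] zigzag_basis(1)[OF X] P(2) by (simp add: algebra_simps)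
  ultimately show ?thesis using module_iso_of_epi[OF XC T] by blast
qed

lemma of_nat_bit: "of_nat n = (if even n then 0 else 1 :: bit)"
  by (induction n) auto

theorem corollary2p17:
  fixes s t :: nat and r r' :: bit
    and P :: "bit \<Rightarrow> 'k::alg_closed_field rep"
    and M N X :: "'k rep"
  assumes "CHAR('k) \<noteq> 2"
    and "s \<ge> 1" and "t \<ge> 1"
    and "\<And>q. \<exists>p. projective_cover (simple_module q) (P q) p"
    and "(cosyzygy ^^ s) (simple_module r) M"
    and "(cosyzygy ^^ t) (simple_module r') N"
    and "(cosyzygy ^^ (s + t)) (simple_module (r + r')) X"
  shows "(even (s + t) \<longrightarrow> M \<otimes>\<^sub>D N \<cong>\<^sub>D X \<oplus>\<^sub>D copies (s * t) (P (r + r'))) \<and>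
         (odd (s + t) \<longrightarrow> M \<otimes>\<^sub>D N \<cong>\<^sub>D X \<oplus>\<^sub>D copies (s * t) (P (r + r' + 1)))"
proof -
  \<comment> \<open>If 2 = 0, the characteristic divides 2, hence is 1 or 2; a field does not have
    characteristic 1.\<close>
  have two: "(2::'k) \<noteq> 0"
  proof
    assume "(2::'k) = 0"
    then have "CHAR('k) dvd 2" using of_nat_eq_0_iff_char_dvd[of 2, where 'a = 'k] by simp
    then have "CHAR('k) = 1 \<or> CHAR('k) = 2" using two_is_prime_nat prime_nat_iff by blast
    then show False using assms(1) by simp
  qed
  obtain x y where W: "zigzag s (r + of_nat s) M x y"
    using cosyzygy_power_zigzag[OF assms(5) two] by blast
  obtain x' y' where W': "zigzag t (r' + of_nat t) N x' y'"
    using cosyzygy_power_zigzag[OF assms(6) two] by blast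
  obtain xx yy where "zigzag (s + t) (r + r' + of_nat (s + t)) X xx yy"
    using cosyzygy_power_zigzag[OF assms(7) two] by blast
  \<comment> \<open>The socle degree of \<open>X\<close> is also the degree of the tensors of
    \<open>x i\<close> with \<open>x' j\<close>, which generate the projective part; modulo 2 it
    depends on s + t only through the parity.\<close>
  moreover have Q: "r + r' + of_nat (s + t) = (r + of_nat s) + (r' + of_nat t)"
    by (simp only: of_nat_add ac_simps)
  ultimately have X: "zigzag (s + t) ((r + of_nat s) + (r' + of_nat t)) X xx yy" by (simp only:)
  obtain p where p: "projective_cover (simple_module ((r + of_nat s) + (r' + of_nat t)))
      (P ((r + of_nat s) + (r' + of_nat t))) p"
    using assms(4) by blast
  have "M \<otimes>\<^sub>D N \<cong>\<^sub>D X \<oplus>\<^sub>D copies (s * t) (P ((r + of_nat s) + (r' + of_nat t)))"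
    by (rule tensor_zigzag[OF W W' X projective_cover_hits[OF p two]])
  then have iso: "M \<otimes>\<^sub>D N \<cong>\<^sub>D X \<oplus>\<^sub>D copies (s * t) (P (r + r' + of_nat (s + t)))"
    by (simp only: Q)
  show ?thesis
  proof (intro conjI impI)
    assume "even (s + t)"
    then have "r + r' + of_nat (s + t) = r + r'" by (simp only: of_nat_bit if_True add_0_right)
    then show "M \<otimes>\<^sub>D N \<cong>\<^sub>D X \<oplus>\<^sub>D copies (s * t) (P (r + r'))" using iso by (simp only:)
  next
    assume "odd (s + t)"
    then have "r + r' + of_nat (s + t) = r + r' + 1" by (simp only: of_nat_bit if_False)
    then show "M \<otimes>\<^sub>D N \<cong>\<^sub>D X \<oplus>\<^sub>D copies (s * t) (P (r + r' + 1))" using iso by (simp only:)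
  qed
qed

end
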